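(* Let $r\in\mathbb N$ and a $1$-periodic function $x\in L^r_{\infty,\infty}(\mathbb R)$ be given. Suppose that one of the following conditions holds: a) the numbers $a_1=0$, $a_2\ge 0$, $\lambda>0$ and $b\ne 0$ are such that $\|x^{(k)}\|\le\|\Psi^{(k)}_{a_1,a_2,b,\lambda}\|$ for $k\in\{0,r-1,r\}$; b) the numbers $a_1\ge 0$, $a_2=0$, $\lambda>0$ and $b\neq 0$ are such that $\|x^{(k)}\|\le\|\Psi^{(k)}_{a_1,a_2,b,\lambda}\|$ for $k\in\{0,r-2,r\}$; c) the numbers $a_1\ge 0$, $a_2\ge 0$, $\lambda>0$ and $b\ne 0$ are such that $\|x^{(k)}\|\le\|\Psi^{(k)}_{a_1,a_2,b,\lambda}\|$ for $k\in\{0,r-1,r-2,r\}$. Then for all $t>0$ $$\int_0^t r(|x'|,u)\,du\le\lambda^{r-1}\int_0^t r(|\Psi'_{a_1,a_2,b,1}|,u)\,du,$$ where $r(f,\cdot)$ denotes the decreasing rearrangement of a $1$-periodic non-negative function $f$ integrable over the period.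
   Context: $\|\cdot\|$ is the norm of $L_\infty(\mathbb R)$ (essential supremum of the absolute value). $L^r_\infty(\mathbb R)$ is the space of functions $x:\mathbb R\to\mathbb R$ such that $x^{(r-1)}$ (with $x^{(0)}=x$) is locally absolutely continuous and $x^{(r)}\in L_\infty(\mathbb R)$; $L^r_{\infty,\infty}(\mathbb R)=L^r_\infty(\mathbb R)\cap L_\infty(\mathbb R)$. For $a_1,a_2\ge 0$ put $T=a_1+a_2+2$ and define $\psi_1(a_1,a_2;t)$ on $[0,T]$ to be $0$ for $t\in[0,a_1]$, $t-a_1$ for $t\in[a_1,a_1+1]$, $1$ for $t\in[a_1+1,a_1+a_2+1]$, and $2+a_1+a_2-t$ for $t\in[a_1+a_2+1,T]$. Extend it to $[T,2T]$ by $\psi_1(a_1,a_2;t)=-\psi_1(a_1,a_2;t-T)$ and then $2T$-periodically to $\mathbb R$. For $r\in\mathbb N$, $\psi_r(a_1,a_2;\cdot)$ is the $(r-1)$-th $2T$-periodic integral of $\psi_1(a_1,a_2;\cdot)$ with zero mean over the period (so that $\psi_r'(a_1,a_2;t)=\psi_{r-1}(a_1,a_2;t)$ for $r\ge2$). For $r\in\mathbb N$, $a_1,a_2\ge0$, $\lambda>0$, $b\in\mathbb R$, $$\Psi_{a_1,a_2,b,\lambda}(t)=\Psi_{r;a_1,a_2,b,\lambda}(t)=b\left(\frac{\lambda}{2a_1+2a_2+4}\right)^{r}\psi_r\!\left(a_1,a_2;\frac{2a_1+2a_2+4}{\lambda}\,t\right),$$ a $\lambda$-periodic function; $\Psi_{a_1,a_2,b,1}$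 is the same with $\lambda=1$ (same $r$). For a $1$-periodic non-negative function $f$ integrable over the period, its decreasing rearrangement is $r(f,u)=\inf\{y\ge 0:\ \mathrm{meas}\{s\in[0,1]: f(s)>y\}\le u\}$, $u\geq 0$ (so $r(f,u)=0$ for $u\ge1$). The rearrangement notation $r(\cdot,\cdot)$ is unrelated to the integer $r$.
   Formalization: Restricted orders: a) needs r≥2 or a_2=0 (for r=1, a_2>0 a fine zigzag of slope ±b is a counterexample); b), c) need r≥3, or r=2 with a_1=0 (r=1: x^(-1) is undefined; r=2, a_1>0: joining the humps of Ψ' without its zero intervals is a counterexample for suitable λ). *)

theory Defs
  imports "HOL-Analysis.Analysis" "HOL-Probability.Essential_Supremum"
begin

definition Linf_norm :: "(real \<Rightarrow> real) \<Rightarrow> ereal" where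
  "Linf_norm f = esssup lebesgue (\<lambda>t. ereal \<bar>f t\<bar>)"

definition Linf :: "(real \<Rightarrow> real) set" where
  "Linf = {f. f \<in> borel_measurable lebesgue \<and> Linf_norm f < \<infinity>}"

definition abs_cont_on :: "real \<Rightarrow> real \<Rightarrow> (real \<Rightarrow> real) \<Rightarrow> bool" where
  "abs_cont_on a b f \<longleftrightarrow>
     (\<forall>\<epsilon>>0. \<exists>\<delta>>0. \<forall>D. finite D \<and> (\<forall>(u, v)\<in>D. a \<le> u \<and> u \<le> v \<and> v \<le> b) \<and>
        disjoint_family_on (\<lambda>(u, v). {u<..<v}) D \<and> (\<Sum>(u, v)\<in>D. v - u) < \<delta> \<longrightarrow>
        (\<Sum>(u, v)\<in>D. \<bar>f v - f u\<bar>) < \<epsilon>)"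

definition loc_abs_cont :: "(real \<Rightarrow> real) \<Rightarrow> bool" where
  "loc_abs_cont f \<longleftrightarrow> (\<forall>a b. a \<le> b \<longrightarrow> abs_cont_on a b f)"

text \<open>
  The \<open>k\<close>-th derivative is \<open>(deriv ^^ k) x\<close>. Since \<open>deriv\<close> is total, the existence of the
  derivatives up to order \<open>r - 1\<close> is required explicitly. The derivative of order \<open>r\<close> exists
  almost everywhere, by local absolute continuity; on the remaining null set \<open>deriv\<close> returns
  one fixed unspecified value, which affects neither measurability nor any quantity below.
\<close>

definition Lr_inf :: "nat \<Rightarrow> (real \<Rightarrow> real) set" where
  "Lr_inf r = {x. (\<forall>k<r - 1. \<forall>t. (deriv ^^ k) x differentiable (at t)) \<and>
                  loc_abs_cont ((deriv ^^ (r - 1)) x) \<and> (deriv ^^ r) x \<in> Linf}"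

definition Lr_inf_inf :: "nat \<Rightarrow> (real \<Rightarrow> real) set" where
  "Lr_inf_inf r = Lr_inf r \<inter> Linf"

definition psi1_base :: "real \<Rightarrow> real \<Rightarrow> real \<Rightarrow> real" where
  "psi1_base a1 a2 t =
     (if t \<le> a1 then 0
      else if t \<le> a1 + 1 then t - a1
      else if t \<le> a1 + a2 + 1 then 1
      else 2 + a1 + a2 - t)"

definition psi1 :: "real \<Rightarrow> real \<Rightarrow> real \<Rightarrow> real" where
  "psi1 a1 a2 t =
     (let T = a1 + a2 + 2; s = t - 2 * T * of_int \<lfloor>t / (2 * T)\<rfloor>
      in if s \<le> T then psi1_base a1 a2 s else - psi1_base a1 a2 (s - T))"

text \<open>The antiderivative with zero mean over \<open>[0, P]\<close>; it is \<open>P\<close>-periodic if \<open>f\<close> is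
  \<open>P\<close>-periodic with zero mean. The interval integral is oriented, so \<open>t < 0\<close> is covered.\<close>

definition periodic_integral :: "real \<Rightarrow> (real \<Rightarrow> real) \<Rightarrow> real \<Rightarrow> real" where
  "periodic_integral P f t =
     (LBINT s=0..t. f s) - (LBINT \<tau>=0..P. (LBINT s=0..\<tau>. f s)) / P"

text \<open>Only \<open>r \<ge> 1\<close> is meaningful.\<close>

definition psi :: "nat \<Rightarrow> real \<Rightarrow> real \<Rightarrow> real \<Rightarrow> real" where
  "psi r a1 a2 = (periodic_integral (2 * (a1 + a2 + 2)) ^^ (r - 1)) (psi1 a1 a2)"

definition Psi :: "nat \<Rightarrow> real \<Rightarrow> real \<Rightarrow> real \<Rightarrow> real \<Rightarrow> real \<Rightarrow> real" where
  "Psi r a1 a2 b lam t =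
     b * (lam / (2 * a1 + 2 * a2 + 4)) ^ r * psi r a1 a2 ((2 * a1 + 2 * a2 + 4) / lam * t)"

text \<open>Values in \<open>ennreal\<close>, so that the infimum of the empty set is \<open>\<infinity>\<close>.\<close>

definition decr_rearr :: "(real \<Rightarrow> real) \<Rightarrow> real \<Rightarrow> ennreal" where
  "decr_rearr f u =
     Inf {ennreal y | y. 0 \<le> y \<and> emeasure lebesgue {s \<in> {0..1}. f s > y} \<le> ennreal u}"

end

theory Submission imports Defs
begin

text \<open>
  Let \<Psi> denote the comparison wave with its period \<lambda> enlarged to a rational \<lambda>', so that x and \<Psi> have a
  common period; at the end \<lambda>' tends to \<lambda>. If x crossed a monotone branch of a shift of
  \<Psi> the wrong way, then x - \<Psi> would change sign more than twice per period of \<Psi> on average. By Rolle's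
  theorem this excess survives differentiation up to order r - 1 (or r - 2), where the norm bounds and the
  explicit shape of the wave forbid it. Applied to x, this bounds x' in terms of \<Psi>'; applied to x', it
  writes x' as \<Psi>' composed with a 1-Lipschitz function. On each interval between consecutive zeros of x'
  the integral of the excess of |x'| over a level y is then controlled by comparing level sets, together
  with the fact that the integral of |x'| is at most twice the norm of x. Summing over the intervals and
  passing from excess integrals to rearrangements gives the inequality.

  Almost everywhere differentiability of absolutely continuous functions is needed because \<open>deriv\<close> has
  an unspecified value at points of non-differentiability.
\<close>

section \<open>Almost everywhere differentiability of absolutely continuous functions\<close>

text \<open>Enlarging \<lambda> serves twice: with a rational period sign changes can be counted on
  a common period, and the bound on the function itself becomes strict, so that it never reaches the
  extreme values of the wave and the rising branch can be inverted. The comparison is run twice as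
  well: for \<open>x\<close> it yields a bound on \<open>x'\<close> that is not among the
  hypotheses, and this bound is what the same comparison asks for when it starts from
  \<open>x'\<close>. Components between zeros of \<open>x'\<close> need not match the period of the
  wave; what is compared is excess per unit length, with a quarter period of the wave as the
  extremal piece. That ratio does not see the period, so the wave may be rescaled to period 1, and
  \<open>lam ^ (r - 1)\<close> is the factor left by the rescaling. Excess integrals suffice
  because, at the level given by the rearrangement of the wave at \<open>t\<close>, its integral up
  to \<open>t\<close> is exactly \<open>t\<close> times the level plus the whole excess. The case
  \<open>r = 1\<close> stands apart: \<open>Psi'\<close> is then no continuous wave but has constant
  modulus almost everywhere.\<close>

definition nonoverlapping :: "(real \<times> real) set \<Rightarrow> bool" where
  "nonoverlapping D \<longleftrightarrow> finite D \<and> (\<forall>(u, v)\<in>D. u < v) \<and> disjoint_family_on (\<lambda>(u, v). {u<..<v}) D"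

abbreviation incr :: "(real \<Rightarrow> real) \<Rightarrow> (real \<times> real) set \<Rightarrow> real" where
  "incr f D \<equiv> (\<Sum>(u, v)\<in>D. f v - f u)"

section \<open>Families of nonoverlapping intervals and their increments\<close>

lemma open_intervals_disjoint_cases:
  fixes u v u' v' :: real
  assumes "{u<..<v} \<inter> {u'<..<v'} = {}" "u < v" "u' < v'"
  shows "v' \<le> u \<or> v \<le> u'"
proof (rule ccontr)
  assume "\<not> ?thesis"
  then have "max u u' < min v v'" using assms by auto
  then obtain z where "max u u' < z" "z < min v v'" using dense by blast
  then show False using assms by auto
qed

lemma nonoverlappingI:
  assumes "finite D" "\<And>u v. (u, v) \<in> D \<Longrightarrow> u < v"
    "\<And>u v u' v'. (u, v) \<in> D \<Longrightarrow> (u', v') \<in> D \<Longrightarrow> (u, v) \<noteq> (u', v') \<Longrightarrow> v \<le> u' \<or> v' \<le> u"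
  shows "nonoverlapping D"
  unfolding nonoverlapping_def disjoint_family_on_def
  using assms by (fastforce simp: disjoint_iff)

lemma nonoverlappingD:
  assumes "nonoverlapping D"
  shows "finite D" "(u, v) \<in> D \<Longrightarrow> u < v"
    "(u, v) \<in> D \<Longrightarrow> (u', v') \<in> D \<Longrightarrow> (u, v) \<noteq> (u', v') \<Longrightarrow> v \<le> u' \<or> v' \<le> u"
proof -
  show "finite D" "(u, v) \<in> D \<Longrightarrow> u < v" using assms by (auto simp: nonoverlapping_def)
  assume *: "(u, v) \<in> D" "(u', v') \<in> D" "(u, v) \<noteq> (u', v')"
  then have "{u<..<v} \<inter> {u'<..<v'} = {}"
    using assms unfolding nonoverlapping_def disjoint_family_on_def by fastforce
  moreover have "u < v" "u' < v'" using * assms by (auto simp: nonoverlapping_def)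
  ultimately show "v \<le> u' \<or> v' \<le> u"
    using open_intervals_disjoint_cases by blast
qed

lemma nonoverlapping_subset: "nonoverlapping D \<Longrightarrow> D' \<subseteq> D \<Longrightarrow> nonoverlapping D'"
  by (rule nonoverlappingI) (blast intro: finite_subset dest: nonoverlappingD)+

lemma nonoverlapping_Un:
  assumes "nonoverlapping A" "nonoverlapping B"
    and "\<And>u v u' v'. (u, v) \<in> A \<Longrightarrow> (u', v') \<in> B \<Longrightarrow> v \<le> u' \<or> v' \<le> u"
  shows "nonoverlapping (A \<union> B)" "A \<inter> B = {}"
proof -
  show "nonoverlapping (A \<union> B)"
  proof (rule nonoverlappingI)
    show "finite (A \<union> B)" using nonoverlappingD(1) assms by auto
    show "u < v" if "(u, v) \<in> A \<union> B" for u v using that nonoverlappingD(2) assms(1,2) by blast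
    fix u v u' v' assume "(u, v) \<in> A \<union> B" "(u', v') \<in> A \<union> B" "(u, v) \<noteq> (u', v')"
    then show "v \<le> u' \<or> v' \<le> u"
      using nonoverlappingD(3)[OF assms(1)] nonoverlappingD(3)[OF assms(2)] assms(3) by blast
  qed
  show "A \<inter> B = {}"
  proof (rule ccontr)
    assume "\<not> ?thesis"
    then obtain u v where "(u, v) \<in> A" "(u, v) \<in> B" by auto
    then show False using assms(3)[of u v u v] nonoverlappingD(2)[OF assms(1), of u v] by auto
  qed
qed

text \<open>Once the gaps are filled, the increments of every \<open>g\<close> telescope to
  \<open>g q - g p\<close>, so the increment over the gaps is a difference of two known increments.
  The induction takes out one interval and treats what lies to its left and to its right, each with
  fewer intervals.\<close>

lemma complete_subdivision:
  assumes "nonoverlapping D" "p \<le> q" "\<And>u v. (u, v) \<in> D \<Longrightarrow> p \<le> u \<and> v \<le> q"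
  shows "\<exists>D'. nonoverlapping D' \<and> D \<subseteq> D' \<and> (\<forall>(u, v)\<in>D'. p \<le> u \<and> v \<le> q) \<and>
    (\<forall>g. incr g D' = g q - g p)"
  using assms
proof (induction "card D" arbitrary: D p q rule: less_induct)
  case less
  show ?case
  proof (cases "D = {}")
    case True
    show ?thesis
    \<comment> \<open>A family contains no degenerate intervals, so for \<open>p = q\<close> its
      completion is empty.\<close>
    proof (cases "p = q")
      case True
      then show ?thesis using \<open>D = {}\<close> by (intro exI[of _ "{}"]) (auto simp: nonoverlapping_def disjoint_family_on_def)
    next
      case False
      then show ?thesis using \<open>D = {}\<close> less.prems
        by (intro exI[of _ "{(p, q)}"]) (auto simp: nonoverlapping_def disjoint_family_on_def)
    qed
  next
    case False
    then obtain u v where uv: "(u, v) \<in> D" by auto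
    note D = nonoverlappingD[OF less.prems(1)]
    define L where "L = {(u', v')\<in>D. v' \<le> u}"
    define R where "R = {(u', v')\<in>D. v \<le> u'}"
    have uv': "u < v" "p \<le> u" "v \<le> q" using D(2)[OF uv] less.prems(3)[OF uv] by auto
    have LR: "L \<subseteq> D" "R \<subseteq> D" "nonoverlapping L" "nonoverlapping R"
      using less.prems(1) by (auto simp: L_def R_def intro: nonoverlapping_subset)
    have "L \<subseteq> D - {(u, v)}" "R \<subseteq> D - {(u, v)}" using uv' by (auto simp: L_def R_def)
    then have "card L < card D" "card R < card D"
      using uv D(1) by (meson card_Diff1_less card_mono finite_Diff le_less_trans)+
    have D_eq: "D \<subseteq> L \<union> {(u, v)} \<union> R"
    proof
      fix ab assume "ab \<in> D"
      moreover obtain a b where "ab = (a, b)" by force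
      ultimately show "ab \<in> L \<union> {(u, v)} \<union> R" using D(3)[OF uv, of a b] by (auto simp: L_def R_def)
    qed
    obtain L' where L': "nonoverlapping L'" "L \<subseteq> L'" "\<forall>(a, b)\<in>L'. p \<le> a \<and> b \<le> u" "\<And>g. incr g L' = g u - g p"
    proof -
      have "p \<le> a \<and> b \<le> u" if "(a, b) \<in> L" for a b using that less.prems(3) by (auto simp: L_def)
      from less.hyps[OF \<open>card L < card D\<close> LR(3) uv'(2) this] show thesis using that by blast
    qed
    obtain R' where R': "nonoverlapping R'" "R \<subseteq> R'" "\<forall>(a, b)\<in>R'. v \<le> a \<and> b \<le> q" "\<And>g. incr g R' = g q - g v"
    proof -
      have "v \<le> a \<and> b \<le> q" if "(a, b) \<in> R" for a b using that less.prems(3) by (auto simp: R_def)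
      from less.hyps[OF \<open>card R < card D\<close> LR(4) uv'(3) this] show thesis using that by blast
    qed
    have M: "nonoverlapping {(u, v)}" using uv' by (auto simp: nonoverlapping_def disjoint_family_on_def)
    have "b \<le> a' \<or> b' \<le> a" if "(a, b) \<in> L'" "(a', b') \<in> {(u, v)}" for a b a' b'
      using that L'(3) by fastforce
    from nonoverlapping_Un[OF L'(1) M this]
    have 1: "nonoverlapping (L' \<union> {(u, v)})" "L' \<inter> {(u, v)} = {}" by auto
    have sep: "b \<le> a' \<or> b' \<le> a" if "(a, b) \<in> L' \<union> {(u, v)}" "(a', b') \<in> R'" for a b a' b'
      using that L'(3) R'(3) uv' by fastforce
    have 2: "nonoverlapping (L' \<union> {(u, v)} \<union> R')" "(L' \<union> {(u, v)}) \<inter> R' = {}"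
      using nonoverlapping_Un[OF 1(1) R'(1) sep] by auto
    have fin: "finite L'" "finite R'" using nonoverlappingD L' R' by auto
    have "incr g (L' \<union> {(u, v)} \<union> R') = incr g (L' \<union> {(u, v)}) + incr g R'" for g
      using 2(2) fin by (intro sum.union_disjoint) auto
    moreover have "incr g (L' \<union> {(u, v)}) = incr g L' + incr g {(u, v)}" for g
      using 1(2) fin by (intro sum.union_disjoint) auto
    ultimately have "incr g (L' \<union> {(u, v)} \<union> R') = g q - g p" for g
      by (simp only: L'(4) R'(4)) simp
    moreover have "D \<subseteq> L' \<union> {(u, v)} \<union> R'" using D_eq L'(2) R'(2) by blast
    moreover have "p \<le> a \<and> b \<le> q" if "(a, b) \<in> L' \<union> {(u, v)} \<union> R'" for a b
    proof -
      consider "(a, b) \<in> L'" | "a = u" "b = v" | "(a, b) \<in> R'" using \<open>(a, b) \<in> _\<close> by blast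
      then show ?thesis
      proof cases
        case 1
        then show ?thesis using L'(3) uv' by auto
      next
        case 2
        then show ?thesis using uv' by auto
      next
        case 3
        then show ?thesis using R'(3) uv' by auto
      qed
    qed
    ultimately show ?thesis using 2(1)
      by (intro exI[of _ "L' \<union> {(u, v)} \<union> R'"] conjI ballI allI) auto
  qed
qed

text \<open>The members of \<open>I\<close> are subdivided one at a time; pieces lying in different
  members cannot overlap, so the subdivisions can be united.\<close>

lemma complete_subdivision_family:
  assumes "nonoverlapping I" "nonoverlapping D"
    "\<And>u v. (u, v) \<in> D \<Longrightarrow> \<exists>(p, q)\<in>I. p \<le> u \<and> v \<le> q"
  shows "\<exists>D'. nonoverlapping D' \<and> D \<subseteq> D' \<and> (\<forall>(u, v)\<in>D'. \<exists>(p, q)\<in>I. p \<le> u \<and> v \<le> q) \<and>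
    (\<forall>g. incr g D' = incr g I)"
proof -
  have "finite I" using assms(1) nonoverlappingD by auto
  then show ?thesis using assms
  proof (induction I arbitrary: D rule: finite_induct)
    case empty
    then have "D = {}" by auto
    then show ?case using empty.prems(1) by (intro exI[of _ "{}"]) auto
  next
    case (insert pq I)
    obtain p q where pq: "pq = (p, q)" by force
    note I = nonoverlappingD[OF insert.prems(1)]
    define A where "A = {(u, v)\<in>D. p \<le> u \<and> v \<le> q}"
    define B where "B = {(u, v)\<in>D. \<exists>(p, q)\<in>I. p \<le> u \<and> v \<le> q}"
    have AB: "D = A \<union> B"
    proof (intro equalityI subsetI)
      fix i assume "i \<in> D"
      then show "i \<in> A \<union> B" using insert.prems(3)[of "fst i" "snd i"] by (auto simp: A_def B_def pq)
    qed (auto simp: A_def B_def)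
    then have nn: "nonoverlapping A" "nonoverlapping B"
      by (auto intro: nonoverlapping_subset[OF insert.prems(2)])
    have "p < q" using I(2)[of p q] pq by simp
    obtain A' where A': "nonoverlapping A'" "A \<subseteq> A'" "\<forall>(u, v)\<in>A'. p \<le> u \<and> v \<le> q" "\<And>g. incr g A' = g q - g p"
    proof -
      have "p \<le> u \<and> v \<le> q" if "(u, v) \<in> A" for u v using that by (simp add: A_def)
      from complete_subdivision[OF nn(1) less_imp_le[OF \<open>p < q\<close>] this] show thesis using that by blast
    qed
    have "nonoverlapping I" by (rule nonoverlapping_subset[OF insert.prems(1)]) auto
    moreover have "\<exists>(p, q)\<in>I. p \<le> u \<and> v \<le> q" if "(u, v) \<in> B" for u v using that unfolding B_def by auto
    ultimately have "\<exists>B'. nonoverlapping B' \<and> B \<subseteq> B' \<and> (\<forall>(u, v)\<in>B'. \<exists>(p, q)\<in>I. p \<le> u \<and> v \<le> q) \<and>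
       (\<forall>g. incr g B' = incr g I)" by (intro insert.IH nn(2))
    then obtain B' where B': "nonoverlapping B'" "B \<subseteq> B'" "\<forall>(u, v)\<in>B'. \<exists>(p, q)\<in>I. p \<le> u \<and> v \<le> q"
       "\<And>g. incr g B' = incr g I"
      by auto
    have sep: "v \<le> u' \<or> v' \<le> u" if uv: "(u, v) \<in> A'" "(u', v') \<in> B'" for u v u' v'
    proof -
      obtain p' q' where "(p', q') \<in> I" "p' \<le> u'" "v' \<le> q'" using B'(3) uv(2) by auto
      moreover have "p \<le> u" "v \<le> q" using A'(3) uv(1) by auto
      moreover have "(p', q') \<noteq> (p, q)" using insert.hyps \<open>(p', q') \<in> I\<close> pq by auto
      ultimately show ?thesis using I(3)[of p q p' q'] pq by force
    qed
    have U: "nonoverlapping (A' \<union> B')" "A' \<inter> B' = {}" using nonoverlapping_Un[OF A'(1) B'(1) sep] by auto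
    have fin: "finite A'" "finite B'" using nonoverlappingD A' B' by auto
    have "incr g (A' \<union> B') = incr g A' + incr g B'" for g
      using fin U(2) by (intro sum.union_disjoint) auto
    moreover have "incr g (insert pq I) = g q - g p + incr g I" for g
      using insert.hyps by (simp add: pq)
    ultimately have "incr g (A' \<union> B') = incr g (insert pq I)" for g
      by (simp only: A'(4) B'(4))
    moreover have "\<exists>(p, q)\<in>insert pq I. p \<le> u \<and> v \<le> q" if "(u, v) \<in> A' \<union> B'" for u v
      using that A'(3) B'(3) unfolding pq by (elim UnE) auto
    moreover have "D \<subseteq> A' \<union> B'" using AB A'(2) B'(2) by blast
    ultimately show ?case using U(1)
      by (intro exI[of _ "A' \<union> B'"] conjI ballI allI) (auto simp del: bex_simps)
  qed
qed

text \<open>The signed sum replaces the sum of absolute increments because it telescopes over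
  subdivisions.\<close>

lemma abs_cont_onD:
  assumes "abs_cont_on a b f" "\<epsilon> > 0"
  obtains \<delta> where "\<delta> > 0" "\<And>D. nonoverlapping D \<Longrightarrow> (\<forall>(u, v)\<in>D. a \<le> u \<and> v \<le> b) \<Longrightarrow>
     incr (\<lambda>x. x) D < \<delta> \<Longrightarrow> \<bar>incr f D\<bar> < \<epsilon>"
proof -
  obtain \<delta> where \<delta>: "\<delta> > 0" "\<And>D. finite D \<Longrightarrow> (\<forall>(u, v)\<in>D. a \<le> u \<and> u \<le> v \<and> v \<le> b) \<Longrightarrow>
        disjoint_family_on (\<lambda>(u, v). {u<..<v}) D \<Longrightarrow> (\<Sum>(u, v)\<in>D. v - u) < \<delta> \<Longrightarrow>
        (\<Sum>(u, v)\<in>D. \<bar>f v - f u\<bar>) < \<epsilon>"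
    using assms unfolding abs_cont_on_def by meson
  have "\<bar>incr f D\<bar> < \<epsilon>" if "nonoverlapping D" "\<forall>(u, v)\<in>D. a \<le> u \<and> v \<le> b" "incr (\<lambda>x. x) D < \<delta>" for D
  proof -
    have "\<bar>incr f D\<bar> \<le> (\<Sum>(u, v)\<in>D. \<bar>f v - f u\<bar>)"
      by (rule order_trans[OF sum_abs]) (auto intro!: sum_mono)
    also have "\<dots> < \<epsilon>"
      using that by (intro \<delta>(2)) (auto simp: nonoverlapping_def less_imp_le split: prod.splits)
    finally show ?thesis .
  qed
  then show thesis using \<delta>(1) that by blast
qed

text \<open>Comparing the increments of \<open>f\<close> over a family of intervals with those over a subfamily that
  nearly exhausts it: the gaps form a family of small total length.\<close>

lemma abs_cont_gap:
  assumes "abs_cont_on a b f" "\<epsilon> > 0"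
  obtains \<delta> where "\<delta> > 0" "\<And>I D. nonoverlapping I \<Longrightarrow> nonoverlapping D \<Longrightarrow> (\<forall>(u, v)\<in>I. a \<le> u \<and> v \<le> b) \<Longrightarrow>
     (\<And>u v. (u, v) \<in> D \<Longrightarrow> \<exists>(p, q)\<in>I. p \<le> u \<and> v \<le> q) \<Longrightarrow>
     incr (\<lambda>x. x) I - incr (\<lambda>x. x) D < \<delta> \<Longrightarrow> \<bar>incr f I - incr f D\<bar> < \<epsilon>"
proof -
  obtain \<delta> where \<delta>: "\<delta> > 0" "\<And>D. nonoverlapping D \<Longrightarrow> (\<forall>(u, v)\<in>D. a \<le> u \<and> v \<le> b) \<Longrightarrow>
     incr (\<lambda>x. x) D < \<delta> \<Longrightarrow> \<bar>incr f D\<bar> < \<epsilon>"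
    using abs_cont_onD[OF assms] by metis
  have "\<bar>incr f I - incr f D\<bar> < \<epsilon>" if *: "nonoverlapping I" "nonoverlapping D" "\<forall>(u, v)\<in>I. a \<le> u \<and> v \<le> b"
     "\<And>u v. (u, v) \<in> D \<Longrightarrow> \<exists>(p, q)\<in>I. p \<le> u \<and> v \<le> q" "incr (\<lambda>x. x) I - incr (\<lambda>x. x) D < \<delta>" for I D
  proof -
    obtain D' where D': "nonoverlapping D'" "D \<subseteq> D'" "\<forall>(u, v)\<in>D'. \<exists>(p, q)\<in>I. p \<le> u \<and> v \<le> q"
      "\<And>g. incr g D' = incr g I"
      using complete_subdivision_family[OF *(1,2,4)] by auto
    have "finite D'" using D' nonoverlappingD by auto
    then have eq: "incr g (D' - D) = incr g I - incr g D" for g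
      using D'(2,4) by (simp add: sum_diff)
    have "\<forall>(u, v)\<in>D' - D. a \<le> u \<and> v \<le> b" using D'(3) *(3) by fastforce
    then have "\<bar>incr f (D' - D)\<bar> < \<epsilon>"
      using \<delta>(2)[of "D' - D"] eq *(5) nonoverlapping_subset[OF D'(1)] by auto
    then show ?thesis using eq by simp
  qed
  then show thesis using that \<delta>(1) by blast
qed

section \<open>Vitali coverings and slopes over straddling intervals\<close>

lemma countable_imp_negligible: "countable (A :: real set) \<Longrightarrow> negligible A"
  by (simp add: negligible_iff_null_sets null_sets_completionI countable_imp_null_set_lborel)

text \<open>On the line closed balls are closed intervals, so the Vitali covering theorem gives a
  countable disjoint subfamily that covers almost all of \<open>E\<close>. Continuity of measure
  from above reduces it to finitely many members, and passing to open intervals costs only countably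
  many endpoints.\<close>

lemma Vitali_finite_real:
  fixes E U :: "real set"
  assumes E: "E \<in> lmeasurable" and U: "open U" "E \<subseteq> U" and "\<epsilon> > 0"
    and Q: "\<And>t e. t \<in> E \<Longrightarrow> e > 0 \<Longrightarrow> \<exists>u v. u < t \<and> t < v \<and> v - u < e \<and> Q u v"
  obtains D where "nonoverlapping D" "\<And>u v. (u, v) \<in> D \<Longrightarrow> {u..v} \<subseteq> U \<and> Q u v"
    "measure lebesgue (E - (\<Union>(u, v)\<in>D. {u<..<v})) < \<epsilon>"
proof -
  define K where "K = {(u, v). u < v \<and> {u..v} \<subseteq> U \<and> Q u v}"
  define a where "a = (\<lambda>(u, v). (u + v) / 2 :: real)"
  define r where "r = (\<lambda>(u, v). (v - u) / 2 :: real)"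
  have cb: "cball (a i) (r i) = {fst i..snd i}" for i
    by (cases i) (auto simp: a_def r_def cball_def dist_real_def field_simps abs_le_iff)
  obtain C where C: "countable C" "C \<subseteq> K"
     "pairwise (\<lambda>i j. disjnt (cball (a i) (r i)) (cball (a j) (r j))) C"
     "negligible(E - (\<Union>i \<in> C. cball (a i) (r i)))"
  proof (rule Vitali_covering_theorem_cballs[of K r E a])
    show "0 < r i" if "i \<in> K" for i using that by (auto simp: K_def r_def)
    fix t d :: real assume t: "t \<in> E" "0 < d"
    then obtain e where e: "e > 0" "ball t e \<subseteq> U" using U open_contains_ball by blast
    obtain u v where uv: "u < t" "t < v" "v - u < min e d" "Q u v" using Q[of t "min e d"] t e by auto
    have "{u..v} \<subseteq> ball t e" using uv by (auto simp: dist_real_def)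
    then have "(u, v) \<in> K" using uv e by (auto simp: K_def)
    then show "\<exists>i. i \<in> K \<and> t \<in> cball (a i) (r i) \<and> r i < d"
      using uv t(2) by (intro exI[of _ "(u, v)"]) (auto simp: cb, auto simp: r_def)
  qed
  define F where "F n = {i\<in>C. to_nat_on C i < n}" for n
  have inj: "inj_on (to_nat_on C) C" using C(1) by auto
  have fin: "finite (F n)" for n
    unfolding F_def by (rule inj_on_finite[of "to_nat_on C" _ "{..<n}"]) (use inj in \<open>auto intro: inj_on_subset\<close>)
  define S where "S n = E - (\<Union>(u, v)\<in>F n. {u<..<v})" for n
  have S: "S n \<in> lmeasurable" for n
    unfolding S_def using fin by (intro fmeasurable_Diff E sets.finite_UN) auto
  have null: "negligible (\<Inter>n. S n)"
  proof (rule negligible_subset)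
    show "negligible ((E - (\<Union>i \<in> C. cball (a i) (r i))) \<union> (fst ` C \<union> snd ` C))"
      using C(1) C(4) by (auto intro!: negligible_Un countable_imp_negligible)
    show "(\<Inter>n. S n) \<subseteq> (E - (\<Union>i \<in> C. cball (a i) (r i))) \<union> (fst ` C \<union> snd ` C)"
    proof
      fix t assume t: "t \<in> (\<Inter>n. S n)"
      have "t = fst i \<or> t = snd i" if "i \<in> C" "t \<in> {fst i..snd i}" for i
      proof (rule ccontr)
        assume "\<not> ?thesis"
        then have "fst i < t" "t < snd i" using that by auto
        moreover have "i \<in> F (Suc (to_nat_on C i))" using that by (auto simp: F_def)
        ultimately have "t \<notin> S (Suc (to_nat_on C i))" by (force simp: S_def)
        then show False using t by auto
      qed
      moreover have "t \<in> E" using t by (auto simp: S_def)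
      ultimately show "t \<in> (E - (\<Union>i \<in> C. cball (a i) (r i))) \<union> (fst ` C \<union> snd ` C)"
        unfolding cb by blast
    qed
  qed
  have "decseq S" unfolding decseq_def S_def F_def by fastforce
  then have "(\<lambda>n. measure lebesgue (S n)) \<longlonglongrightarrow> measure lebesgue (\<Inter>n. S n)"
    using S fmeasurableD2[OF S] by (intro Lim_measure_decseq) (auto simp del: emeasure_completion)
  moreover have "measure lebesgue (\<Inter>n. S n) = 0" using null by (simp add: negligible_imp_measure0)
  ultimately obtain n where n: "measure lebesgue (S n) < \<epsilon>"
    using \<open>\<epsilon> > 0\<close> order_tendstoD(2) eventually_sequentially by (metis order_refl)
  have "nonoverlapping (F n)"
  proof (rule nonoverlappingI[OF fin])
    have FK: "F n \<subseteq> K" "F n \<subseteq> C" using C by (auto simp: F_def)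
    show "u < v" if "(u, v) \<in> F n" for u v using that FK by (auto simp: K_def)
    fix u v u' v' assume *: "(u, v) \<in> F n" "(u', v') \<in> F n" "(u, v) \<noteq> (u', v')"
    then have "disjnt {u..v} {u'..v'}" using C(3) FK unfolding pairwise_def cb by (metis fst_conv snd_conv subsetD)
    then have "{u<..<v} \<inter> {u'<..<v'} = {}" by (auto simp: disjnt_def)
    moreover have "u < v" "u' < v'" using * FK by (auto simp: K_def)
    ultimately show "v \<le> u' \<or> v' \<le> u" using open_intervals_disjoint_cases by blast
  qed
  moreover have "{u..v} \<subseteq> U \<and> Q u v" if "(u, v) \<in> F n" for u v using that C(2) by (auto simp: F_def K_def)
  ultimately show thesis using that n by (auto simp: S_def)
qed

lemma emeasure_lborel_Ioo_cases: "emeasure lborel {a<..<b} = ennreal (b - a)" for a b :: real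
  by (cases "a \<le> b") (auto simp: ennreal_neg)

lemma measure_nonoverlapping:
  assumes "nonoverlapping D"
  shows "(\<Union>(u, v)\<in>D. {u<..<v}) \<in> lmeasurable"
    "measure lebesgue (\<Union>(u, v)\<in>D. {u<..<v}) = incr (\<lambda>x. x) D"
proof -
  have fin: "finite D" and d: "disjoint_family_on (\<lambda>(u, v). {u<..<v}) D" and lt: "\<And>u v. (u, v) \<in> D \<Longrightarrow> u < v"
    using assms by (auto simp: nonoverlapping_def)
  show 1: "(\<Union>(u, v)\<in>D. {u<..<v}) \<in> lmeasurable"
    using fin by (intro fmeasurable.finite_UN) (auto split: prod.splits)
  have "measure lebesgue (\<Union>i\<in>D. case i of (u, v) \<Rightarrow> {u<..<v}) = (\<Sum>i\<in>D. measure lebesgue (case i of (u, v) \<Rightarrow> {u<..<v}))"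
    using fin d by (intro measure_finite_Union) (auto split: prod.splits simp flip: less_top simp: emeasure_lborel_Ioo_cases)
  also have "\<dots> = incr (\<lambda>x. x) D"
    using lt by (intro sum.cong) (force split: prod.splits)+
  finally show "measure lebesgue (\<Union>(u, v)\<in>D. {u<..<v}) = incr (\<lambda>x. x) D" .
qed

text \<open>An upper derivate over arbitrarily short intervals that strictly straddle
  \<open>t\<close>. Strict straddling makes the condition open at each scale, so the set of such
  points is Borel for arbitrary \<open>f\<close>. For \<open>- f\<close> and
  \<open>- \<alpha>\<close> it speaks of slopes of \<open>f\<close> below \<alpha>.\<close>

definition steep :: "(real \<Rightarrow> real) \<Rightarrow> real \<Rightarrow> real \<Rightarrow> bool" where
  "steep f \<beta> t \<longleftrightarrow> (\<forall>e>0. \<exists>u v. u < t \<and> t < v \<and> v - u < e \<and> f v - f u > \<beta> * (v - u))"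

lemma sets_steep: "{t. steep f \<beta> t} \<in> sets borel"
proof -
  have "{t. steep f \<beta> t} = (\<Inter>n. \<Union>{{u<..<v} | u v. v - u < inverse (real (Suc n)) \<and> f v - f u > \<beta> * (v - u)})"
    (is "_ = (\<Inter>n. \<Union>(?U n))")
  proof (intro set_eqI iffI)
    fix t assume "t \<in> {t. steep f \<beta> t}"
    then have st: "\<forall>e>0. \<exists>u v. u < t \<and> t < v \<and> v - u < e \<and> f v - f u > \<beta> * (v - u)"
      unfolding steep_def mem_Collect_eq .
    have *: "\<exists>u v. u < t \<and> t < v \<and> v - u < inverse (real (Suc n)) \<and> f v - f u > \<beta> * (v - u)" for n
      by (rule st[rule_format]) simp
    then have "t \<in> \<Union>(?U n)" for n
    proof -
      obtain u v where uv: "u < t" "t < v" "v - u < inverse (real (Suc n)) \<and> f v - f u > \<beta> * (v - u)"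
        using *[of n] by (elim exE conjE) (rule that, assumption+, rule conjI)
      show ?thesis by (rule UnionI[of "{u<..<v}"]) (use uv in \<open>auto simp del: of_nat_Suc\<close>)
    qed
    then show "t \<in> (\<Inter>n. \<Union>(?U n))" by (rule INT_I)
  next
    fix t assume t: "t \<in> (\<Inter>n. \<Union>(?U n))"
    show "t \<in> {t. steep f \<beta> t}" unfolding steep_def
    proof (intro CollectI allI impI)
      fix e :: real assume "e > 0"
      then obtain n where n: "inverse (real (Suc n)) < e" using reals_Archimedean by blast
      have "t \<in> \<Union>(?U n)" using t by blast
      then obtain u v where "t \<in> {u<..<v}" "v - u < inverse (real (Suc n))" "f v - f u > \<beta> * (v - u)" by blast
      then show "\<exists>u v. u < t \<and> t < v \<and> v - u < e \<and> f v - f u > \<beta> * (v - u)" using n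
        by (intro exI[of _ u] exI[of _ v]) auto
    qed
  qed
  moreover have "\<Union>(?U n) \<in> sets borel" for n by (intro borel_open open_Union) auto
  ultimately show ?thesis by auto
qed

lemma steep_mono: "steep f \<beta> t \<Longrightarrow> \<alpha> \<le> \<beta> \<Longrightarrow> steep f \<alpha> t"
  unfolding steep_def
proof (intro allI impI)
  fix e :: real assume *: "\<forall>e>0. \<exists>u v. u < t \<and> t < v \<and> v - u < e \<and> f v - f u > \<beta> * (v - u)" "\<alpha> \<le> \<beta>" "e > 0"
  then obtain u v where uv: "u < t" "t < v" "v - u < e" "f v - f u > \<beta> * (v - u)" by blast
  moreover have "\<alpha> * (v - u) \<le> \<beta> * (v - u)" using * uv by (intro mult_right_mono) auto
  ultimately have "f v - f u > \<alpha> * (v - u)" by linarith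
  then show "\<exists>u v. u < t \<and> t < v \<and> v - u < e \<and> f v - f u > \<alpha> * (v - u)"
    using uv by (intro exI[of _ u] exI[of _ v] conjI)
qed

lemma lmeasurable_Icc_subset:
  assumes "E \<in> sets lebesgue" "E \<subseteq> {a<..<b :: real}" shows "E \<in> lmeasurable"
  using assms by (intro bounded_set_imp_lmeasurable) (auto intro: bounded_subset[OF bounded_box[of a b, unfolded box_real]])

lemma Union_intervals_subset:
  assumes "\<And>u v. (u, v) \<in> D \<Longrightarrow> {u..v} \<subseteq> U"
  shows "(\<Union>(u, v)\<in>D. {u<..<v}) \<subseteq> (U :: real set)"
proof
  fix t assume "t \<in> (\<Union>(u, v)\<in>D. {u<..<v})"
  then obtain u v where "(u, v) \<in> D" "t \<in> {u<..<v}" by blast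
  then show "t \<in> U" using assms[of u v] by auto
qed

lemma incr_le:
  assumes "nonoverlapping D" "\<And>u v. (u, v) \<in> D \<Longrightarrow> f v - f u \<le> c * (v - u)"
  shows "incr f D \<le> c * incr (\<lambda>x. x) D"
proof -
  have "incr f D \<le> (\<Sum>i\<in>D. c * (case i of (u, v) \<Rightarrow> v - u))"
    using assms(2) by (intro sum_mono) auto
  then show ?thesis by (simp add: sum_distrib_left)
qed

lemma incr_uminus: "incr (\<lambda>x. - f x) D = - incr f D"
  by (simp add: sum_negf[symmetric] split_beta)

text \<open>Connectedness: if \<open>v\<close> lay beyond the right end \<open>q\<close> of the
  member containing \<open>u\<close>, then \<open>q\<close> would lie inside another member, and the
  two members would overlap.\<close>

lemma subinterval_of_nonoverlapping_Union:
  assumes "nonoverlapping D" "u < v" "{u..v} \<subseteq> (\<Union>(p, q)\<in>D. {p<..<q})"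
  shows "\<exists>(p, q)\<in>D. p \<le> u \<and> v \<le> q"
proof -
  have "u \<in> {u..v}" "v \<in> {u..v}" using assms by auto
  then have "u \<in> (\<Union>(p, q)\<in>D. {p<..<q})" using assms(3) by blast
  then obtain p q where pq: "(p, q) \<in> D" "p < u" "u < q" by auto
  have "v \<le> q"
  proof (rule ccontr)
    assume "\<not> v \<le> q"
    then have "q \<in> {u..v}" using pq by auto
    then have "q \<in> (\<Union>(p, q)\<in>D. {p<..<q})" using assms(3) by blast
    then obtain p' q' where "(p', q') \<in> D" "p' < q" "q < q'" by auto
    then show False using nonoverlappingD(3)[OF assms(1) pq(1), of p' q'] pq by auto
  qed
  then show ?thesis using pq by (intro bexI[of _ "(p, q)"]) auto
qed

lemma intervals_within:
  assumes "\<And>u v. (u, v) \<in> D \<Longrightarrow> {u..v} \<subseteq> {a<..<b :: real} \<and> u < v"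
  shows "\<forall>(u, v)\<in>D. a \<le> u \<and> v \<le> b"
proof clarify
  fix u v assume "(u, v) \<in> D"
  from assms[OF this] have "{u..v} \<subseteq> {a<..<b}" "u \<in> {u..v}" "v \<in> {u..v}" by auto
  then have "u \<in> {a<..<b}" "v \<in> {a<..<b}" by blast+
  then show "a \<le> u \<and> v \<le> b" by simp
qed

text \<open>If the set had measure \<open>\<mu> > 0\<close>, a Vitali family \<open>D1\<close> of
  total length about \<mu> has slopes below \<alpha>, and a second family \<open>D2\<close>, inside
  the members of \<open>D1\<close>, has nearly the same length and slopes above \<beta>. Absolute
  continuity makes the increments of \<open>f\<close> over the two families nearly equal, although
  the slopes separate them by about \<open>(\<beta> - \<alpha>) * \<mu>\<close>.\<close>

lemma negligible_two_slopes:
  assumes f: "abs_cont_on a b f" and "\<alpha> < \<beta>"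
  shows "negligible {t\<in>{a<..<b}. steep f \<beta> t \<and> steep (\<lambda>t. - f t) (-\<alpha>) t}" (is "negligible ?E")
proof (rule ccontr)
  assume non: "\<not> negligible ?E"
  have "?E = {a<..<b} \<inter> {t. steep f \<beta> t} \<inter> {t. steep (\<lambda>t. - f t) (-\<alpha>) t}" by auto
  then have "?E \<in> sets borel" using sets_steep by auto
  then have E: "?E \<in> lmeasurable" by (intro lmeasurable_Icc_subset[of _ a b]) auto
  define \<mu> where "\<mu> = measure lebesgue ?E"
  have "\<mu> > 0" using non E by (simp add: \<mu>_def negligible_iff_measure zero_less_measure_iff measure_nonneg order_le_less)
  define \<eta> where "\<eta> = (\<beta> - \<alpha>) * \<mu> / 4"
  have "\<eta> > 0" using \<open>\<mu> > 0\<close> \<open>\<alpha> < \<beta>\<close> by (simp add: \<eta>_def)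
  obtain \<delta> where \<delta>: "\<delta> > 0" "\<And>I D. nonoverlapping I \<Longrightarrow> nonoverlapping D \<Longrightarrow> (\<forall>(u, v)\<in>I. a \<le> u \<and> v \<le> b) \<Longrightarrow>
     (\<And>u v. (u, v) \<in> D \<Longrightarrow> \<exists>(p, q)\<in>I. p \<le> u \<and> v \<le> q) \<Longrightarrow>
     incr (\<lambda>x. x) I - incr (\<lambda>x. x) D < \<delta> \<Longrightarrow> \<bar>incr f I - incr f D\<bar> < \<eta>"
    using abs_cont_gap[OF f \<open>\<eta> > 0\<close>] by metis
  \<comment> \<open>The three caps keep the length gap, which is below
    \<open>3 * \<epsilon>\<close>, under \<delta>; make \<open>?s2\<close> at least three quarters
    of \<mu>; and keep the error \<open>3 * \<bar>\<alpha>\<bar> * \<epsilon>\<close> plus \<eta>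
    below \<open>(\<beta> - \<alpha>) * (3 / 4 * \<mu>)\<close>. The \<open>+ 1\<close> covers
    \<open>\<alpha> = 0\<close>.\<close>
  define \<epsilon> where "\<epsilon> = min (\<delta> / 4) (min (\<mu> / 8) ((\<beta> - \<alpha>) * \<mu> / (16 * (\<bar>\<alpha>\<bar> + 1))))"
  have \<epsilon>: "\<epsilon> \<le> \<delta> / 4" "\<epsilon> \<le> \<mu> / 8" unfolding \<epsilon>_def by (rule min.cobounded1, meson min.cobounded1 min.cobounded2 order_trans)
  have \<epsilon>0: "\<epsilon> > 0" using \<delta>(1) \<open>\<mu> > 0\<close> \<open>\<alpha> < \<beta>\<close> by (auto simp: \<epsilon>_def)
  have "\<epsilon> \<le> (\<beta> - \<alpha>) * \<mu> / (16 * (\<bar>\<alpha>\<bar> + 1))" by (simp add: \<epsilon>_def)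
  moreover have "16 * (\<bar>\<alpha>\<bar> + 1) > 0" by simp
  ultimately have "\<epsilon> * (16 * (\<bar>\<alpha>\<bar> + 1)) \<le> (\<beta> - \<alpha>) * \<mu>" using pos_le_divide_eq by blast
  moreover have "\<epsilon> * (16 * (\<bar>\<alpha>\<bar> + 1)) = 16 * (\<epsilon> * \<bar>\<alpha>\<bar>) + 16 * \<epsilon>" by (simp add: distrib_left)
  ultimately have \<epsilon>': "16 * (\<epsilon> * \<bar>\<alpha>\<bar>) \<le> (\<beta> - \<alpha>) * \<mu>" using \<epsilon>0 by linarith
  obtain V where V: "open V" "?E \<subseteq> V" "V - ?E \<in> lmeasurable" "emeasure lebesgue (V - ?E) < ennreal \<epsilon>"
    by (rule sets_lebesgue_outer_open[OF fmeasurableD[OF E] \<epsilon>0])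
  define U where "U = V \<inter> {a<..<b}"
  have U: "open U" "?E \<subseteq> U" "U \<subseteq> {a<..<b}" using V by (auto simp: U_def)
  have Um: "U \<in> lmeasurable" by (rule lmeasurable_Icc_subset[OF _ U(3)]) (use U(1) in auto)
  have "measure lebesgue (U - ?E) \<le> measure lebesgue (V - ?E)"
    using Um E V(3) by (intro measure_mono_fmeasurable) (auto simp: U_def fmeasurable_Diff fmeasurableD)
  also have "\<dots> < \<epsilon>" using V(3,4) \<epsilon>0 by (simp add: emeasure_eq_measure2 ennreal_less_iff)
  finally have mU: "measure lebesgue U < \<mu> + \<epsilon>"
    using U(2) Um E by (simp add: measurable_measure_Diff \<mu>_def fmeasurableD)
  obtain D1 where D1: "nonoverlapping D1" "\<And>u v. (u, v) \<in> D1 \<Longrightarrow> {u..v} \<subseteq> U \<and> - f v - - f u > - \<alpha> * (v - u)"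
    "measure lebesgue (?E - (\<Union>(u, v)\<in>D1. {u<..<v})) < \<epsilon>"
    by (rule Vitali_finite_real[OF E U(1,2) \<epsilon>0, of "\<lambda>u v. - f v - - f u > - \<alpha> * (v - u)"])
       (auto simp: steep_def)
  define U2 where "U2 = (\<Union>(u, v)\<in>D1. {u<..<v})"
  have U2: "open U2" "U2 \<in> lmeasurable" "measure lebesgue U2 = incr (\<lambda>x. x) D1"
    using measure_nonoverlapping[OF D1(1)] by (auto simp: U2_def)
  have U2U: "U2 \<subseteq> U" unfolding U2_def by (rule Union_intervals_subset) (use D1(2) in blast)
  define E2 where "E2 = ?E \<inter> U2"
  have E2: "E2 \<in> lmeasurable" "E2 \<subseteq> U2" using E U2 by (auto simp: E2_def)
  obtain D2 where D2: "nonoverlapping D2" "\<And>u v. (u, v) \<in> D2 \<Longrightarrow> {u..v} \<subseteq> U2 \<and> f v - f u > \<beta> * (v - u)"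
    "measure lebesgue (E2 - (\<Union>(u, v)\<in>D2. {u<..<v})) < \<epsilon>"
    by (rule Vitali_finite_real[OF E2(1) U2(1) E2(2) \<epsilon>0, of "\<lambda>u v. f v - f u > \<beta> * (v - u)"])
       (auto simp: steep_def E2_def)
  let ?s1 = "incr (\<lambda>x. x) D1" and ?s2 = "incr (\<lambda>x. x) D2"
  note m2 = measure_nonoverlapping[OF D2(1)]
  have s1: "?s1 < \<mu> + \<epsilon>"
    using measure_mono_fmeasurable[OF U2U fmeasurableD[OF U2(2)] Um] mU U2(3) by simp
  have "\<mu> \<le> measure lebesgue (?E - U2) + measure lebesgue E2"
  proof -
    have "measure lebesgue ((?E - U2) \<union> E2) \<le> measure lebesgue (?E - U2) + measure lebesgue E2"
      using E U2(2) E2(1) by (intro measure_Un_le) (auto intro: fmeasurableD)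
    moreover have "(?E - U2) \<union> E2 = ?E" by (auto simp: E2_def)
    ultimately show ?thesis by (simp only: \<mu>_def)
  qed
  moreover have "measure lebesgue E2 \<le> measure lebesgue (E2 - (\<Union>(u, v)\<in>D2. {u<..<v})) + ?s2"
  proof -
    have "measure lebesgue E2 \<le> measure lebesgue ((E2 - (\<Union>(u, v)\<in>D2. {u<..<v})) \<union> (\<Union>(u, v)\<in>D2. {u<..<v}))"
      using E2 m2 by (intro measure_mono_fmeasurable) (auto intro: fmeasurableD)
    also have "\<dots> \<le> measure lebesgue (E2 - (\<Union>(u, v)\<in>D2. {u<..<v})) + ?s2"
      unfolding m2(2)[symmetric] using E2 m2(1) by (intro measure_Un_le) (auto intro: fmeasurableD)
    finally show ?thesis .
  qed
  \<comment> \<open>Covering \<open>?E\<close> by \<open>D1\<close> and \<open>E2\<close> by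
    \<open>D2\<close> loses less than \<epsilon> each time.\<close>
  ultimately have s2: "?s2 \<ge> \<mu> - 2 * \<epsilon>" using D1(3) D2(3) by (simp add: U2_def)
  have "\<bar>incr f D1 - incr f D2\<bar> < \<eta>"
  proof (rule \<delta>(2)[OF D1(1) D2(1)])
    have "{u..v} \<subseteq> {a<..<b} \<and> u < v" if "(u, v) \<in> D1" for u v
      using that D1(2) U(3) nonoverlappingD(2)[OF D1(1)] by blast
    then show "\<forall>(u, v)\<in>D1. a \<le> u \<and> v \<le> b" by (rule intervals_within)
    show "\<exists>(p, q)\<in>D1. p \<le> u \<and> v \<le> q" if "(u, v) \<in> D2" for u v
      using subinterval_of_nonoverlapping_Union[OF D1(1)] D2(2)[OF that] nonoverlappingD(2)[OF D2(1) that]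
      unfolding U2_def by blast
    show "?s1 - ?s2 < \<delta>" using s1 s2 \<epsilon> \<delta>(1) by linarith
  qed
  moreover have "incr f D1 \<le> \<alpha> * ?s1" by (rule incr_le[OF D1(1)]) (use D1(2) in fastforce)
  moreover have "incr (\<lambda>x. - f x) D2 \<le> - \<beta> * ?s2" by (rule incr_le[OF D2(1)]) (use D2(2) in fastforce)
  then have "incr f D2 \<ge> \<beta> * ?s2" unfolding incr_uminus by simp
  ultimately have "\<beta> * ?s2 - \<alpha> * ?s1 < \<eta>" by linarith
  moreover have "\<alpha> * ?s1 \<le> \<alpha> * ?s2 + \<bar>\<alpha>\<bar> * (3 * \<epsilon>)"
  proof -
    have "?s2 \<le> ?s1"
    proof -
      have "(\<Union>(u, v)\<in>D2. {u<..<v}) \<subseteq> U2" by (rule Union_intervals_subset) (use D2(2) in blast)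
      from measure_mono_fmeasurable[OF this fmeasurableD[OF m2(1)] U2(2)] show ?thesis using m2(2) U2(3) by simp
    qed
    then have "\<bar>\<alpha> * (?s1 - ?s2)\<bar> \<le> \<bar>\<alpha>\<bar> * (3 * \<epsilon>)" unfolding abs_mult
      using s1 s2 by (intro mult_left_mono) auto
    then show ?thesis by (simp add: algebra_simps)
  qed
  ultimately have "(\<beta> - \<alpha>) * ?s2 < \<eta> + \<bar>\<alpha>\<bar> * (3 * \<epsilon>)" by (simp add: algebra_simps)
  moreover have "(\<beta> - \<alpha>) * (3 / 4 * \<mu>) \<le> (\<beta> - \<alpha>) * ?s2"
    using s2 \<epsilon>(2) \<open>\<alpha> < \<beta>\<close> by (intro mult_left_mono) auto
  moreover have "(\<beta> - \<alpha>) * \<mu> > 0" using \<open>\<mu> > 0\<close> \<open>\<alpha> < \<beta>\<close> by simp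
  ultimately show False using \<epsilon>' unfolding \<eta>_def by (simp add: field_simps)
qed

text \<open>Inside a window shorter than \<delta> every family has increment below 1, while
  intervals of slope above \<open>N\<close> filling more than half of a set of measure \<mu> have
  total increment above \<open>N * \<mu> / 2\<close>. So the set is null in each window, and
  countably many windows suffice.\<close>

lemma negligible_infinite_slope:
  assumes f: "abs_cont_on a b f"
  shows "negligible {t\<in>{a<..<b}. \<forall>n. steep f (real n) t}" (is "negligible ?E")
proof -
  obtain \<delta> where \<delta>: "\<delta> > 0" "\<And>D. nonoverlapping D \<Longrightarrow> (\<forall>(u, v)\<in>D. a \<le> u \<and> v \<le> b) \<Longrightarrow>
     incr (\<lambda>x. x) D < \<delta> \<Longrightarrow> \<bar>incr f D\<bar> < 1"
    using abs_cont_onD[OF f, of 1] by auto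
  have "?E = {a<..<b} \<inter> (\<Inter>n. {t. steep f (real n) t})" by auto
  then have Em: "?E \<in> sets borel" using sets_steep by auto
  have neg: "negligible (?E \<inter> {c<..<c + \<delta> / 2})" for c
  proof (rule ccontr)
    let ?F = "?E \<inter> {c<..<c + \<delta> / 2}"
    assume non: "\<not> negligible ?F"
    have F: "?F \<in> lmeasurable" using Em by (intro lmeasurable_Icc_subset[of _ a b]) auto
    define \<mu> where "\<mu> = measure lebesgue ?F"
    have "\<mu> > 0" using non F by (simp add: \<mu>_def negligible_iff_measure zero_less_measure_iff measure_nonneg order_le_less)
    obtain N :: nat where N: "real N > 2 / \<mu>" using reals_Archimedean2 by blast
    define U where "U = {a<..<b} \<inter> {c<..<c + \<delta> / 2}"
    have U: "open U" "?F \<subseteq> U" by (auto simp: U_def)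
    obtain D where D: "nonoverlapping D" "\<And>u v. (u, v) \<in> D \<Longrightarrow> {u..v} \<subseteq> U \<and> f v - f u > real N * (v - u)"
      "measure lebesgue (?F - (\<Union>(u, v)\<in>D. {u<..<v})) < \<mu> / 2"
      by (rule Vitali_finite_real[OF F U, of "\<mu> / 2" "\<lambda>u v. f v - f u > real N * (v - u)"])
         (use \<open>\<mu> > 0\<close> in \<open>auto simp: steep_def\<close>)
    note m = measure_nonoverlapping[OF D(1)]
    let ?s = "incr (\<lambda>x. x) D"
    have "\<mu> \<le> measure lebesgue ((?F - (\<Union>(u, v)\<in>D. {u<..<v})) \<union> (\<Union>(u, v)\<in>D. {u<..<v}))"
      unfolding \<mu>_def using F m by (intro measure_mono_fmeasurable) (auto intro: fmeasurableD)
    also have "\<dots> \<le> measure lebesgue (?F - (\<Union>(u, v)\<in>D. {u<..<v})) + ?s"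
      unfolding m(2)[symmetric] using F m(1) by (intro measure_Un_le) (auto intro: fmeasurableD)
    finally have s: "?s > \<mu> / 2" using D(3) by simp
    have "(\<Union>(u, v)\<in>D. {u<..<v}) \<subseteq> {c<..<c + \<delta> / 2}"
      by (rule Union_intervals_subset) (use D(2) in \<open>unfold U_def, blast\<close>)
    from measure_mono_fmeasurable[OF this fmeasurableD[OF m(1)]] have "?s \<le> \<delta> / 2"
      using m(2) \<delta>(1) by simp
    moreover have "{u..v} \<subseteq> {a<..<b} \<and> u < v" if "(u, v) \<in> D" for u v
      using that D(2) nonoverlappingD(2)[OF D(1)] unfolding U_def by blast
    then have "\<forall>(u, v)\<in>D. a \<le> u \<and> v \<le> b" by (rule intervals_within)
    ultimately have "\<bar>incr f D\<bar> < 1" using \<delta> D(1) by auto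
    moreover have "incr (\<lambda>x. - f x) D \<le> - real N * ?s" by (rule incr_le[OF D(1)]) (use D(2) in fastforce)
    then have "incr f D \<ge> real N * ?s" unfolding incr_uminus by simp
    moreover have "real N * ?s \<ge> real N * (\<mu> / 2)" using s by (intro mult_left_mono) auto
    moreover have "real N * (\<mu> / 2) > 1" using N \<open>\<mu> > 0\<close> by (simp add: field_simps)
    ultimately show False by linarith
  qed
  have "?E \<subseteq> (\<Union>c\<in>\<rat>. ?E \<inter> {c<..<c + \<delta> / 2})"
  proof
    fix t assume "t \<in> ?E"
    obtain c where "c \<in> \<rat>" "t - \<delta> / 2 < c" "c < t" using Rats_dense_in_real[of "t - \<delta> / 2" t] \<delta>(1) by auto
    then show "t \<in> (\<Union>c\<in>\<rat>. ?E \<inter> {c<..<c + \<delta> / 2})" using \<open>t \<in> ?E\<close> by (intro UN_I[of c]) auto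
  qed
  moreover have "negligible (\<Union>c\<in>\<rat>. ?E \<inter> {c<..<c + \<delta> / 2})"
    using neg by (intro negligible_countable_Union) (auto simp: countable_rat)
  ultimately show ?thesis using negligible_subset by blast
qed

lemma abs_cont_on_uminus: "abs_cont_on a b f \<Longrightarrow> abs_cont_on a b (\<lambda>t. - f t)"
  unfolding abs_cont_on_def by (simp add: abs_minus_commute)

lemma loc_abs_cont_isCont:
  assumes "loc_abs_cont f" shows "isCont f t"
  unfolding continuous_at_eps_delta
proof (intro allI impI)
  fix e :: real assume "e > 0"
  have "abs_cont_on (t - 1) (t + 1) f" using assms by (simp add: loc_abs_cont_def)
  then obtain \<delta> where \<delta>: "\<delta> > 0" "\<And>D. nonoverlapping D \<Longrightarrow> (\<forall>(u, v)\<in>D. t - 1 \<le> u \<and> v \<le> t + 1) \<Longrightarrow>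
     incr (\<lambda>x. x) D < \<delta> \<Longrightarrow> \<bar>incr f D\<bar> < e"
    using abs_cont_onD[of "t - 1" "t + 1" f e] \<open>e > 0\<close> by metis
  have single: "nonoverlapping {(u, v)}" if "u < v" for u v :: real
    using that by (auto simp: nonoverlapping_def disjoint_family_on_def)
  have "dist (f s) (f t) < e" if s: "dist s t < min 1 \<delta>" for s
  proof (rule linorder_cases[of s t])
    assume "s = t" then show ?thesis using \<open>e > 0\<close> by simp
  next
    assume "s < t"
    then show ?thesis using \<delta>(2)[OF single[of s t]] s by (auto simp: dist_real_def)
  next
    assume "t < s"
    then show ?thesis using \<delta>(2)[OF single[of t s]] s by (auto simp: dist_real_def)
  qed
  then show "\<exists>d>0. \<forall>x'. dist x' t < d \<longrightarrow> dist (f x') (f t) < e"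
    using \<delta>(1) by (intro exI[of _ "min 1 \<delta>"]) auto
qed

lemma not_steepE:
  assumes "\<not> steep f \<beta> t"
  obtains e where "e > 0" "\<And>u v. u < t \<Longrightarrow> t < v \<Longrightarrow> v - u < e \<Longrightarrow> f v - f u \<le> \<beta> * (v - u)"
  using assms unfolding steep_def by (metis not_less)

lemma steepI:
  assumes "e > 0" "\<And>u v. u < t \<Longrightarrow> t < v \<Longrightarrow> v - u < e \<Longrightarrow> f v - f u > \<beta> * (v - u)"
  shows "steep f \<beta> t"
  unfolding steep_def
proof (intro allI impI)
  fix e' :: real assume "e' > 0"
  define d where "d = min e e' / 3"
  have "d > 0" "2 * d < e" "2 * d < e'" using \<open>e > 0\<close> \<open>e' > 0\<close> by (auto simp: d_def)
  then show "\<exists>u v. u < t \<and> t < v \<and> v - u < e' \<and> f v - f u > \<beta> * (v - u)"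
    using assms(2)[of "t - d" "t + d"] by (intro exI[of _ "t - d"] exI[of _ "t + d"]) auto
qed

text \<open>Continuity at \<open>t\<close> allows one endpoint of a straddling interval to tend to
  \<open>t\<close>, which turns the two-sided estimate into one-sided ones.\<close>

lemma differentiable_of_slopes:
  fixes f :: "real \<Rightarrow> real"
  assumes cont: "isCont f t"
    and slopes: "\<And>\<epsilon>. \<epsilon> > 0 \<Longrightarrow> \<exists>e>0. \<forall>u v. u < t \<longrightarrow> t < v \<longrightarrow> v - u < e \<longrightarrow> \<bar>f v - f u - D * (v - u)\<bar> \<le> \<epsilon> * (v - u)"
  shows "f differentiable (at t)"
proof -
  have lim: "((\<lambda>u. f u) \<longlongrightarrow> f t) (at_left t)" "((\<lambda>u. f u) \<longlongrightarrow> f t) (at_right t)"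
    using cont by (auto simp: isCont_def filterlim_at_split)
  have "(f has_field_derivative D) (at t)"
    unfolding DERIV_def LIM_eq
  proof (intro allI impI)
    fix r :: real assume "r > 0"
    then obtain e where e: "e > 0" "\<And>u v. u < t \<Longrightarrow> t < v \<Longrightarrow> v - u < e \<Longrightarrow> \<bar>f v - f u - D * (v - u)\<bar> \<le> (r / 2) * (v - u)"
      using slopes[of "r / 2"] by auto
    have right: "\<bar>f v - f t - D * (v - t)\<bar> \<le> (r / 2) * (v - t)" if v: "t < v" "v - t < e" for v
    proof (rule tendsto_le[OF trivial_limit_at_left_real])
      show "((\<lambda>u. (r / 2) * (v - u)) \<longlongrightarrow> (r / 2) * (v - t)) (at_left t)" by (intro tendsto_intros)
      show "((\<lambda>u. \<bar>f v - f u - D * (v - u)\<bar>) \<longlongrightarrow> \<bar>f v - f t - D * (v - t)\<bar>) (at_left t)"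
        by (intro tendsto_intros lim)
      have "eventually (\<lambda>u. u \<in> {v - e<..<t}) (at_left t)" using v by (intro eventually_at_leftI[of "v - e"]) auto
      then show "\<forall>\<^sub>F u in at_left t. \<bar>f v - f u - D * (v - u)\<bar> \<le> r / 2 * (v - u)"
        by eventually_elim (use e v in auto)
    qed
    have left: "\<bar>f t - f u - D * (t - u)\<bar> \<le> (r / 2) * (t - u)" if u: "u < t" "t - u < e" for u
    proof (rule tendsto_le[OF trivial_limit_at_right_real])
      show "((\<lambda>v. (r / 2) * (v - u)) \<longlongrightarrow> (r / 2) * (t - u)) (at_right t)" by (intro tendsto_intros)
      show "((\<lambda>v. \<bar>f v - f u - D * (v - u)\<bar>) \<longlongrightarrow> \<bar>f t - f u - D * (t - u)\<bar>) (at_right t)"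
        by (intro tendsto_intros lim)
      have "eventually (\<lambda>v. v \<in> {t<..<u + e}) (at_right t)" using u by (intro eventually_at_rightI[of _ "u + e"]) auto
      then show "\<forall>\<^sub>F v in at_right t. \<bar>f v - f u - D * (v - u)\<bar> \<le> r / 2 * (v - u)"
        by eventually_elim (use e u in auto)
    qed
    have "norm ((f (t + h) - f t) / h - D) < r" if h: "h \<noteq> 0" "\<bar>h\<bar> < e" for h
    proof -
      have "\<bar>f (t + h) - f t - D * h\<bar> \<le> (r / 2) * \<bar>h\<bar>"
        using right[of "t + h"] left[of "t + h"] h by (cases "h > 0") (auto simp: abs_if algebra_simps split: if_splits)
      also have "\<dots> < r * \<bar>h\<bar>" using h \<open>r > 0\<close> by simp
      finally have "\<bar>(f (t + h) - f t - D * h) / h\<bar> < r" using h by (simp add: abs_divide divide_less_eq)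
      moreover have "(f (t + h) - f t - D * h) / h = (f (t + h) - f t) / h - D" using h by (simp add: diff_divide_distrib)
      ultimately show ?thesis by simp
    qed
    then show "\<exists>s>0. \<forall>x. x \<noteq> 0 \<and> norm (x - 0) < s \<longrightarrow> norm ((f (t + x) - f t) / x - D) < r"
      using e(1) by (intro exI[of _ e]) auto
  qed
  then show ?thesis using real_differentiable_def by blast
qed

text \<open>The only candidate for the derivative is the supremum \<open>D\<close> of the rational
  slopes that \<open>f\<close> exceeds near \<open>t\<close>. Excluding infinite slopes makes
  \<open>D\<close> finite; excluding two separated slopes keeps all short straddling slopes above
  any number below \<open>D\<close>.\<close>

lemma not_differentiable_cases:
  fixes f :: "real \<Rightarrow> real"
  assumes cont: "isCont f t" and non: "\<not> f differentiable (at t)"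
  shows "(\<exists>\<alpha>\<in>\<rat>. \<exists>\<beta>\<in>\<rat>. \<alpha> < \<beta> \<and> steep f \<beta> t \<and> steep (\<lambda>t. - f t) (-\<alpha>) t) \<or>
    (\<forall>n. steep f (real n) t) \<or> (\<forall>n. steep (\<lambda>t. - f t) (real n) t)"
proof (rule ccontr)
  assume "\<not> ?thesis"
  then obtain n m :: nat where n: "\<not> steep f (real n) t" and m: "\<not> steep (\<lambda>t. - f t) (real m) t"
    and two: "\<And>\<alpha> \<beta>. \<alpha> \<in> \<rat> \<Longrightarrow> \<beta> \<in> \<rat> \<Longrightarrow> \<alpha> < \<beta> \<Longrightarrow> steep f \<beta> t \<Longrightarrow> \<not> steep (\<lambda>t. - f t) (-\<alpha>) t" by blast
  define S where "S = {\<beta>\<in>\<rat>. steep f \<beta> t}"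
  have bdd: "bdd_above S"
  proof (rule bdd_aboveI[of _ "real n"])
    fix \<beta> assume "\<beta> \<in> S"
    then show "\<beta> \<le> real n" using n steep_mono[of f \<beta> t "real n"] by (cases "real n \<le> \<beta>") (auto simp: S_def)
  qed
  \<comment> \<open>Otherwise all short straddling slopes would be at most \<open>- m - 1\<close>,
    and \<open>- f\<close> would be steep at level \<open>m\<close>.\<close>
  have "steep f (- real m - 1) t"
  proof (rule ccontr)
    assume "\<not> ?thesis"
    then obtain e where e: "e > 0" "\<And>u v. u < t \<Longrightarrow> t < v \<Longrightarrow> v - u < e \<Longrightarrow> f v - f u \<le> (- real m - 1) * (v - u)"
      by (rule not_steepE) blast
    have "steep (\<lambda>t. - f t) (real m) t"
      by (rule steepI[OF e(1)]) (use e(2) in \<open>fastforce simp: algebra_simps\<close>)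
    then show False using m by blast
  qed
  moreover have "- real m - 1 \<in> \<rat>" by (intro Rats_diff Rats_minus_iff[THEN iffD2] Rats_of_nat Rats_1)
  ultimately have "- real m - 1 \<in> S" by (simp add: S_def)
  then have ne: "S \<noteq> {}" by blast
  define D where "D = Sup S"
  have "f differentiable (at t)"
  proof (rule differentiable_of_slopes[OF cont, where D = D])
    fix \<epsilon> :: real assume "\<epsilon> > 0"
    obtain \<beta> where \<beta>: "\<beta> \<in> \<rat>" "D < \<beta>" "\<beta> < D + \<epsilon>" using Rats_dense_in_real[of D "D + \<epsilon>"] \<open>\<epsilon> > 0\<close> by auto
    have "\<beta> \<notin> S" using cSup_upper[OF _ bdd, of \<beta>] \<beta> by (auto simp: D_def)
    then have "\<not> steep f \<beta> t" using \<beta> by (auto simp: S_def)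
    then obtain e1 where e1: "e1 > 0" "\<And>u v. u < t \<Longrightarrow> t < v \<Longrightarrow> v - u < e1 \<Longrightarrow> f v - f u \<le> \<beta> * (v - u)"
      by (rule not_steepE) blast
    obtain \<beta>' where \<beta>': "\<beta>' \<in> S" "D - \<epsilon> < \<beta>'"
      using less_cSupE[of "D - \<epsilon>" S] ne \<open>\<epsilon> > 0\<close> unfolding D_def by (metis diff_less_eq less_add_same_cancel1)
    obtain \<alpha> where \<alpha>: "\<alpha> \<in> \<rat>" "D - \<epsilon> < \<alpha>" "\<alpha> < \<beta>'" using Rats_dense_in_real[OF \<beta>'(2)] by auto
    have "\<not> steep (\<lambda>t. - f t) (-\<alpha>) t" using two[of \<alpha> \<beta>'] \<alpha> \<beta>' by (auto simp: S_def)
    then obtain e2 where e2: "e2 > 0" "\<And>u v. u < t \<Longrightarrow> t < v \<Longrightarrow> v - u < e2 \<Longrightarrow> - f v - - f u \<le> -\<alpha> * (v - u)"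
      by (rule not_steepE) blast
    have "\<bar>f v - f u - D * (v - u)\<bar> \<le> \<epsilon> * (v - u)" if uv: "u < t" "t < v" "v - u < min e1 e2" for u v
    proof -
      have "\<beta> * (v - u) \<le> (D + \<epsilon>) * (v - u)" using uv \<beta> by (intro mult_right_mono) auto
      moreover have "(D - \<epsilon>) * (v - u) \<le> \<alpha> * (v - u)" using uv \<alpha> by (intro mult_right_mono) auto
      moreover have "f v - f u \<le> \<beta> * (v - u)" using e1(2) uv by auto
      moreover have "f v - f u \<ge> \<alpha> * (v - u)" using e2(2)[of u v] uv by auto
      ultimately have "f v - f u \<le> (D + \<epsilon>) * (v - u)" "f v - f u \<ge> (D - \<epsilon>) * (v - u)" by linarith+
      then show ?thesis unfolding abs_le_iff by (simp add: algebra_simps)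
    qed
    then show "\<exists>e>0. \<forall>u v. u < t \<longrightarrow> t < v \<longrightarrow> v - u < e \<longrightarrow> \<bar>f v - f u - D * (v - u)\<bar> \<le> \<epsilon> * (v - u)"
      using e1(1) e2(1) by (intro exI[of _ "min e1 e2"]) auto
  qed
  then show False using non by simp
qed

theorem loc_abs_cont_AE_differentiable:
  assumes "loc_abs_cont f"
  shows "negligible {t. \<not> f differentiable (at t)}"
proof (rule negligible_subset)
  let ?A = "\<lambda>k \<alpha> \<beta>. {t\<in>{- real k<..<real k}. steep f \<beta> t \<and> steep (\<lambda>t. - f t) (-\<alpha>) t}"
  let ?B = "\<lambda>k. {t\<in>{- real k<..<real k}. \<forall>n. steep f (real n) t}"
  let ?C = "\<lambda>k. {t\<in>{- real k<..<real k}. \<forall>n. steep (\<lambda>t. - f t) (real n) t}"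
  let ?X = "(\<Union>k. (\<Union>(\<alpha>, \<beta>)\<in>{(\<alpha>, \<beta>). \<alpha> \<in> \<rat> \<and> \<beta> \<in> \<rat> \<and> \<alpha> < \<beta>}. ?A k \<alpha> \<beta>) \<union> ?B k \<union> ?C k)"
  have ac: "abs_cont_on (- real k) (real k) f" for k using assms by (simp add: loc_abs_cont_def)
  have c: "countable {(\<alpha>, \<beta>). \<alpha> \<in> \<rat> \<and> \<beta> \<in> \<rat> \<and> \<alpha> < (\<beta> :: real)}"
    by (rule countable_subset[of _ "\<rat> \<times> \<rat>"]) (auto simp: countable_rat)
  show "negligible ?X"
  proof (intro negligible_countable_Union)
    fix S assume "S \<in> range (\<lambda>k. (\<Union>(\<alpha>, \<beta>)\<in>{(\<alpha>, \<beta>). \<alpha> \<in> \<rat> \<and> \<beta> \<in> \<rat> \<and> \<alpha> < \<beta>}. ?A k \<alpha> \<beta>) \<union> ?B k \<union> ?C k)"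
    then obtain k where S: "S = (\<Union>(\<alpha>, \<beta>)\<in>{(\<alpha>, \<beta>). \<alpha> \<in> \<rat> \<and> \<beta> \<in> \<rat> \<and> \<alpha> < \<beta>}. ?A k \<alpha> \<beta>) \<union> ?B k \<union> ?C k" by blast
    have "negligible (\<Union>(\<alpha>, \<beta>)\<in>{(\<alpha>, \<beta>). \<alpha> \<in> \<rat> \<and> \<beta> \<in> \<rat> \<and> \<alpha> < \<beta>}. ?A k \<alpha> \<beta>)"
      using c negligible_two_slopes[OF ac[of k]] by (intro negligible_countable_Union countable_image) auto
    then show "negligible S" unfolding S
      using negligible_infinite_slope[OF ac[of k]] negligible_infinite_slope[OF abs_cont_on_uminus[OF ac[of k]]]
      by (intro negligible_Un)
  qed auto
  show "{t. \<not> f differentiable (at t)} \<subseteq> ?X"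
  proof
    fix t assume t: "t \<in> {t. \<not> f differentiable (at t)}"
    obtain k :: nat where "\<bar>t\<bar> < real k" using reals_Archimedean2 by blast
    then have k: "t \<in> {- real k<..<real k}" by auto
    from not_differentiable_cases[OF loc_abs_cont_isCont[OF assms]] t
    consider \<alpha> \<beta> where "\<alpha> \<in> \<rat>" "\<beta> \<in> \<rat>" "\<alpha> < \<beta>" "steep f \<beta> t" "steep (\<lambda>t. - f t) (-\<alpha>) t"
      | "\<forall>n. steep f (real n) t" | "\<forall>n. steep (\<lambda>t. - f t) (real n) t" by blast
    then show "t \<in> ?X"
    proof cases
      case 1
      then have "t \<in> ?A k \<alpha> \<beta>" "(\<alpha>, \<beta>) \<in> {(\<alpha>, \<beta>). \<alpha> \<in> \<rat> \<and> \<beta> \<in> \<rat> \<and> \<alpha> < \<beta>}" using k by auto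
      then show ?thesis by blast
    next
      case 2
      then have "t \<in> ?B k" using k by auto
      then show ?thesis by blast
    next
      case 3
      then have "t \<in> ?C k" using k by auto
      then show ?thesis by blast
    qed
  qed
qed

text \<open>No integral of the derivative is formed. Short intervals around points of
  differentiability have slope at most \<open>B + \<epsilon>\<close> in modulus; a Vitali family of
  them fills the interval up to length \<delta>, and absolute continuity bounds the contribution of
  the gaps.\<close>

theorem loc_abs_cont_Lipschitz:
  assumes f: "loc_abs_cont f" and B: "AE t in lebesgue. \<bar>deriv f t\<bar> \<le> B"
  shows "\<bar>f q - f p\<bar> \<le> B * \<bar>q - p\<bar>"
proof -
  have main: "\<bar>f q - f p\<bar> \<le> B * (q - p)" if "p < q" for p q
  proof (rule field_le_epsilon)
    fix \<epsilon>' :: real assume "\<epsilon>' > 0"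
    define \<epsilon> where "\<epsilon> = \<epsilon>' / (q - p + 1)"
    have \<epsilon>: "\<epsilon> > 0" "\<epsilon> * (q - p + 1) = \<epsilon>'" using \<open>\<epsilon>' > 0\<close> \<open>p < q\<close> by (auto simp: \<epsilon>_def)
    have "abs_cont_on p q f" using f \<open>p < q\<close> by (simp add: loc_abs_cont_def)
    then obtain \<delta> where \<delta>: "\<delta> > 0" "\<And>I D. nonoverlapping I \<Longrightarrow> nonoverlapping D \<Longrightarrow> (\<forall>(u, v)\<in>I. p \<le> u \<and> v \<le> q) \<Longrightarrow>
       (\<And>u v. (u, v) \<in> D \<Longrightarrow> \<exists>(p, q)\<in>I. p \<le> u \<and> v \<le> q) \<Longrightarrow>
       incr (\<lambda>x. x) I - incr (\<lambda>x. x) D < \<delta> \<Longrightarrow> \<bar>incr f I - incr f D\<bar> < \<epsilon>"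
      using abs_cont_gap[of p q f \<epsilon>] \<epsilon>(1) by metis
    define N where "N = {t. \<not> f differentiable (at t)} \<union> {t. \<not> \<bar>deriv f t\<bar> \<le> B}"
    have N: "negligible N" unfolding N_def
      using loc_abs_cont_AE_differentiable[OF f] B
      by (intro negligible_Un) (auto simp: negligible_iff_null_sets eventually_ae_filter null_sets_completion_subset intro: null_sets_completion_subset)
    define E where "E = {p<..<q} - N"
    have E: "E \<in> lmeasurable" "measure lebesgue E = q - p" "E \<subseteq> {p<..<q}"
      using N \<open>p < q\<close> unfolding E_def
      by (auto simp: negligible_imp_measurable fmeasurable_Diff negligible_imp_sets measure_Diff_null_set negligible_iff_null_sets[symmetric])
    have slopes: "\<exists>u v. u < t \<and> t < v \<and> v - u < e \<and> \<bar>f v - f u\<bar> \<le> (B + \<epsilon>) * (v - u)"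
      if t: "t \<in> E" "e > 0" for t e
    proof -
      have dt: "(f has_field_derivative deriv f t) (at t)" and Bt: "\<bar>deriv f t\<bar> \<le> B"
        using t by (auto simp: E_def N_def DERIV_deriv_iff_real_differentiable)
      obtain d where d: "d > 0" "\<And>s. \<bar>s - t\<bar> < d \<Longrightarrow> \<bar>f s - f t - deriv f t * (s - t)\<bar> \<le> \<epsilon> * \<bar>s - t\<bar>"
        using dt[unfolded has_field_derivative_def has_derivative_at_alt, THEN conjunct2, rule_format, OF \<epsilon>(1)]
        by (auto simp: )
      define h where "h = min d e / 3"
      have h: "h > 0" "h < d" "2 * h < e" using d(1) t(2) by (auto simp: h_def min_def)
      have "\<bar>f (t + h) - f t - deriv f t * h\<bar> \<le> \<epsilon> * h" "\<bar>f (t - h) - f t - deriv f t * (- h)\<bar> \<le> \<epsilon> * h"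
        using d(2)[of "t + h"] d(2)[of "t - h"] h by auto
      moreover have "\<bar>deriv f t * h\<bar> \<le> B * h" using Bt h by (simp add: abs_mult)
      ultimately have "\<bar>f (t + h) - f (t - h)\<bar> \<le> (B + \<epsilon>) * ((t + h) - (t - h))"
        by (simp add: algebra_simps abs_le_iff)
      then show ?thesis
        using h by (intro exI[of _ "t - h"] exI[of _ "t + h"]) auto
    qed
    obtain D where D: "nonoverlapping D" "\<And>u v. (u, v) \<in> D \<Longrightarrow> {u..v} \<subseteq> {p<..<q} \<and> \<bar>f v - f u\<bar> \<le> (B + \<epsilon>) * (v - u)"
      "measure lebesgue (E - (\<Union>(u, v)\<in>D. {u<..<v})) < \<delta>"
    proof (rule Vitali_finite_real[OF E(1) open_greaterThanLessThan E(3) \<delta>(1) slopes])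
      fix D assume "nonoverlapping D" "\<And>u v. (u, v) \<in> D \<Longrightarrow> {u..v} \<subseteq> {p<..<q} \<and> \<bar>f v - f u\<bar> \<le> (B + \<epsilon>) * (v - u)"
        "measure lebesgue (E - (\<Union>(u, v)\<in>D. {u<..<v})) < \<delta>"
      then show thesis by (rule that)
    qed
    have D': "\<bar>f v - f u\<bar> \<le> (B + \<epsilon>) * (v - u)" if "(u, v) \<in> D" for u v using D(2)[OF that] by blast
    note m = measure_nonoverlapping[OF D(1)]
    have I: "nonoverlapping {(p, q)}" using \<open>p < q\<close> by (auto simp: nonoverlapping_def disjoint_family_on_def)
    have in_pq: "p \<le> u \<and> v \<le> q" if "(u, v) \<in> D" for u v
      using intervals_within[of D p q] D(2) nonoverlappingD(2)[OF D(1)] that by blast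
    have "measure lebesgue E \<le> measure lebesgue ((E - (\<Union>(u, v)\<in>D. {u<..<v})) \<union> (\<Union>(u, v)\<in>D. {u<..<v}))"
      using E m by (intro measure_mono_fmeasurable) (auto intro: fmeasurableD)
    also have "\<dots> \<le> measure lebesgue (E - (\<Union>(u, v)\<in>D. {u<..<v})) + incr (\<lambda>x. x) D"
      unfolding m(2)[symmetric] using E m(1) by (intro measure_Un_le) (auto intro: fmeasurableD)
    finally have s: "q - p - incr (\<lambda>x. x) D < \<delta>" using D(3) E(2) by simp
    have "(\<Union>(u, v)\<in>D. {u<..<v}) \<subseteq> {p<..<q}" by (rule Union_intervals_subset) (use D(2) in blast)
    from measure_mono_fmeasurable[OF this fmeasurableD[OF m(1)]] have s': "incr (\<lambda>x. x) D \<le> q - p"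
      using m(2) \<open>p < q\<close> by simp
    have "\<bar>incr f {(p, q)} - incr f D\<bar> < \<epsilon>"
      by (rule \<delta>(2)[OF I D(1)]) (use in_pq s in auto)
    moreover have "incr f D \<le> (B + \<epsilon>) * incr (\<lambda>x. x) D"
      by (rule incr_le[OF D(1)]) (use D' abs_le_D1 in blast)
    moreover have "incr (\<lambda>x. - f x) D \<le> (B + \<epsilon>) * incr (\<lambda>x. x) D"
      by (rule incr_le[OF D(1)]) (use D' in \<open>fastforce dest: abs_le_D2\<close>)
    moreover have "(B + \<epsilon>) * incr (\<lambda>x. x) D \<le> (B + \<epsilon>) * (q - p)"
    proof (rule mult_left_mono[OF s'])
      \<comment> \<open>The almost everywhere bound holds at some point at least, which forces
        \<open>0 \<le> B\<close>.\<close>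
      have "\<exists>t. \<bar>deriv f t\<bar> \<le> B" by (rule eventually_happens'[OF _ B]) (simp add: ae_filter_eq_bot_iff)
      then show "0 \<le> B + \<epsilon>" using \<epsilon>(1) by fastforce
    qed
    ultimately have "\<bar>f q - f p\<bar> \<le> (B + \<epsilon>) * (q - p) + \<epsilon>"
      unfolding incr_uminus by auto
    then show "\<bar>f q - f p\<bar> \<le> B * (q - p) + \<epsilon>'" using \<epsilon>(2) by (simp add: algebra_simps)
  qed
  consider "p < q" | "p = q" | "q < p" by linarith
  then show ?thesis using main[of p q] main[of q p] by cases (auto simp: abs_minus_commute)
qed

lemma borel_measurable_lebesgue_spike:
  fixes f g :: "real \<Rightarrow> real"
  assumes g: "g \<in> borel_measurable lebesgue" and N: "negligible {t. g t \<noteq> f t}"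
  shows "f \<in> borel_measurable lebesgue"
proof (rule measurableI)
  fix A :: "real set" assume A: "A \<in> sets borel"
  let ?N = "{t. g t \<noteq> f t}"
  have eq: "(g -` A - ?N) \<union> (f -` A \<inter> ?N) = f -` A" by auto
  have "g -` A \<in> sets lebesgue" using measurable_sets[OF g A] by simp
  moreover have "?N \<in> sets lebesgue" "f -` A \<inter> ?N \<in> sets lebesgue"
    using N by (auto intro!: negligible_imp_sets intro: negligible_subset)
  ultimately have "(g -` A - ?N) \<union> (f -` A \<inter> ?N) \<in> sets lebesgue" by (intro sets.Un sets.Diff)
  then show "f -` A \<inter> space lebesgue \<in> sets lebesgue" unfolding eq by simp
qed simp

text \<open>Off a null set the derivative is the limit of difference quotients along
  \<open>1 / (n + 1)\<close>; completeness of Lebesgue measure absorbs the values of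
  \<open>deriv\<close> on that null set.\<close>

lemma loc_abs_cont_deriv_measurable:
  assumes f: "loc_abs_cont f"
  shows "deriv f \<in> borel_measurable lebesgue"
proof -
  define g where "g n t = (f (t + inverse (real (Suc n))) - f t) / inverse (real (Suc n))" for n t
  have cont: "continuous_on UNIV f" using loc_abs_cont_isCont[OF f] continuous_at_imp_continuous_on by blast
  have "(\<lambda>t. f (t + inverse (real (Suc n)))) \<in> borel_measurable borel" for n
    by (intro borel_measurable_continuous_onI continuous_on_compose2[OF cont] continuous_intros) auto
  then have "g n \<in> borel_measurable borel" for n
    unfolding g_def using borel_measurable_continuous_onI[OF cont] by measurable
  then have lim: "(\<lambda>t. lim (\<lambda>n. g n t)) \<in> borel_measurable borel" by (rule borel_measurable_lim_metric)
  have eq: "lim (\<lambda>n. g n t) = deriv f t" if "f differentiable (at t)" for t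
  proof (rule limI)
    have "(f has_field_derivative deriv f t) (at t)" using that by (simp add: DERIV_deriv_iff_real_differentiable)
    then have "((\<lambda>h. (f (t + h) - f t) / h) \<longlongrightarrow> deriv f t) (at 0)" by (simp add: DERIV_def)
    moreover have "filterlim (\<lambda>n. inverse (real (Suc n))) (at 0) sequentially"
      unfolding filterlim_at using LIMSEQ_inverse_real_of_nat by auto
    ultimately show "(\<lambda>n. g n t) \<longlonglongrightarrow> deriv f t" unfolding g_def by (rule filterlim_compose)
  qed
  have "(\<lambda>t. lim (\<lambda>n. g n t)) \<in> borel_measurable lebesgue" using lim by (simp add: measurable_completion)
  moreover have "negligible {t. lim (\<lambda>n. g n t) \<noteq> deriv f t}"
    by (rule negligible_subset[OF loc_abs_cont_AE_differentiable[OF f]]) (use eq in auto)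
  ultimately show ?thesis by (rule borel_measurable_lebesgue_spike)
qed

section \<open>Sign changes and comparison waves\<close>

text \<open>Sign changes on a circle of length \<open>P\<close>: the sequence closes up, so for a
  \<open>P\<close>-periodic \<open>g\<close> only even \<open>N\<close> can occur. The factor
  \<sigma> leaves the initial sign open.\<close>

definition alternates :: "real \<Rightarrow> nat \<Rightarrow> (real \<Rightarrow> real) \<Rightarrow> bool" where
  "alternates P N g \<longleftrightarrow> (\<exists>\<sigma>\<in>{1, -1}. \<exists>t::nat \<Rightarrow> real. (\<forall>i<N. t i < t (Suc i)) \<and> t N = t 0 + P \<and>
     (\<forall>i\<le>N. \<sigma> * (-1) ^ i * g (t i) > 0))"

text \<open>\<open>H\<close> is half the period. The normalisation puts a zero of the rising branch
  at the origin and a maximum at \<open>H / 2\<close>.\<close>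

definition wave :: "real \<Rightarrow> (real \<Rightarrow> real) \<Rightarrow> bool" where
  "wave H \<phi> \<longleftrightarrow> H > 0 \<and> (\<forall>t. \<phi> (t + H) = - \<phi> t) \<and> (\<forall>t. \<phi> (- t) = - \<phi> t) \<and> continuous_on UNIV \<phi> \<and>
     (\<forall>s t. - H / 2 \<le> s \<longrightarrow> s \<le> t \<longrightarrow> t \<le> H / 2 \<longrightarrow> \<phi> s \<le> \<phi> t) \<and> 0 < \<phi> (H / 2)"

text \<open>Plateaus are permitted at the two extreme values and nowhere else, so \<phi> can be
  inverted between them.\<close>

definition strict_wave :: "real \<Rightarrow> (real \<Rightarrow> real) \<Rightarrow> bool" where
  "strict_wave H \<phi> \<longleftrightarrow> wave H \<phi> \<and> (\<forall>s t. - H / 2 \<le> s \<longrightarrow> s < t \<longrightarrow> t \<le> H / 2 \<longrightarrow>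
     \<phi> s < \<phi> (H / 2) \<longrightarrow> - \<phi> (H / 2) < \<phi> t \<longrightarrow> \<phi> s < \<phi> t)"

text \<open>No translate of \<open>y\<close> overtakes \<phi> on its rising half period. The falling
  half period is covered by the same property of \<open>- y\<close>, since translation by
  \<open>H\<close> changes the sign of \<phi>.\<close>

definition crossing_free :: "real \<Rightarrow> (real \<Rightarrow> real) \<Rightarrow> (real \<Rightarrow> real) \<Rightarrow> bool" where
  "crossing_free H \<phi> y \<longleftrightarrow> (\<forall>\<tau> s t. - H / 2 \<le> s \<longrightarrow> s < t \<longrightarrow> t \<le> H / 2 \<longrightarrow> y (s + \<tau>) < \<phi> s \<longrightarrow> y (t + \<tau>) \<le> \<phi> t)"

text \<open>Between consecutive points of opposite sign the mean value theorem gives a point where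
  \<open>g'\<close> has the sign of the increment. The \<open>N\<close> points found are closed up
  by translating the first of them by \<open>P\<close>; its sign fits because \<open>N\<close> is
  even.\<close>

lemma alternates_deriv:
  assumes N: "even N" "N > 0" and d: "\<And>t. (g has_real_derivative g' t) (at t)"
    and per: "\<And>t. g' (t + P) = g' t" and alt: "alternates P N g"
  shows "alternates P N g'"
proof -
  obtain \<sigma> t where \<sigma>: "\<sigma> \<in> {1, -1}" and t: "\<And>i. i < N \<Longrightarrow> t i < t (Suc i)" "t N = t 0 + P"
      "\<And>i. i \<le> N \<Longrightarrow> \<sigma> * (-1) ^ i * g (t i) > 0"
    using alt unfolding alternates_def by blast
  have "\<exists>s. t i < s \<and> s < t (Suc i) \<and> g (t (Suc i)) - g (t i) = (t (Suc i) - t i) * g' s" if "i < N" for i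
    using MVT2[OF t(1)[OF that], of g g'] d by blast
  then obtain s where s: "\<And>i. i < N \<Longrightarrow> t i < s i" "\<And>i. i < N \<Longrightarrow> s i < t (Suc i)"
    "\<And>i. i < N \<Longrightarrow> g (t (Suc i)) - g (t i) = (t (Suc i) - t i) * g' (s i)" by metis
  have sign: "(- \<sigma>) * (-1) ^ i * g' (s i) > 0" if "i < N" for i
  proof -
    have "\<sigma> * (-1) ^ i * g (t i) > 0" "\<sigma> * (-1) ^ Suc i * g (t (Suc i)) > 0" using t(3) that by (auto simp del: power_Suc)
    then have "\<sigma> * (-1) ^ i * (g (t (Suc i)) - g (t i)) < 0" by (simp add: algebra_simps)
    then have "(t (Suc i) - t i) * (\<sigma> * (-1) ^ i * g' (s i)) < 0" using s(3)[OF that] by (simp add: mult_ac)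
    then show ?thesis using t(1)[OF that] by (simp add: mult_less_0_iff)
  qed
  define s' where "s' i = (if i < N then s i else s 0 + P)" for i
  show ?thesis unfolding alternates_def
  proof (intro bexI[of _ "- \<sigma>"] exI[of _ s'] conjI allI impI)
    show "- \<sigma> \<in> {1, -1}" using \<sigma> by auto
    show "s' N = s' 0 + P" using N by (simp add: s'_def)
    fix i
    show "s' i < s' (Suc i)" if "i < N"
    proof (cases "Suc i < N")
      case True
      then show ?thesis using s(2)[of i] s(1)[of "Suc i"] by (simp add: s'_def)
    next
      case False
      then have "Suc i = N" using that by simp
      then show ?thesis using s(2)[OF that] s(1)[OF N(2)] t(2) that by (simp add: s'_def)
    qed
    show "- \<sigma> * (- 1) ^ i * g' (s' i) > 0" if "i \<le> N"
    proof (cases "i < N")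
      case True
      then show ?thesis using sign by (simp add: s'_def)
    next
      case False
      then have "i = N" using that by simp
      then show ?thesis using sign[OF N(2)] N per by (simp add: s'_def)
    qed
  qed
qed

lemma antiperiodic_int:
  fixes \<phi> :: "real \<Rightarrow> real"
  assumes "\<And>t. \<phi> (t + H) = - \<phi> t"
  shows "\<phi> (t + of_int j * H) = (if even j then \<phi> t else - \<phi> t)"
proof (induction j rule: int_induct[where k = 0])
  case base
  then show ?case by simp
next
  case (step1 i)
  have "\<phi> (t + of_int (i + 1) * H) = \<phi> ((t + of_int i * H) + H)" by (simp add: algebra_simps)
  then show ?case using step1 assms by auto
next
  case (step2 i)
  have "\<phi> (t + of_int i * H) = \<phi> ((t + of_int (i - 1) * H) + H)" by (simp add: algebra_simps)
  then show ?case using step2 assms[of "t + of_int (i - 1) * H"] by (auto split: if_splits)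
qed

text \<open>Each half period of \<open>\<phi>\<close> carries at most one sign change of \<open>y - \<phi>\<close>. Numbering the runs of
  constant sign consecutively, an alternating sequence strictly increases this number, which grows
  by exactly \<open>2 q\<close> over \<open>q\<close> periods.\<close>

lemma crossing_free_not_alternates:
  assumes "H > 0" and anti: "\<And>t. \<phi> (t + H) = - \<phi> t"
    and cf: "crossing_free H \<phi> y" "crossing_free H \<phi> (\<lambda>t. - y t)"
    and per: "\<And>t. y (t + 2 * real q * H) = y t" and "N > 2 * q"
  shows "\<not> alternates (2 * real q * H) N (\<lambda>t. y t - \<phi> (t - \<tau>))"
proof
  define D where "D t = y t - \<phi> (t - \<tau>)" for t
  define c where "c t = \<lfloor>(t - \<tau> + H / 2) / H\<rfloor>" for t
  \<comment> \<open>In a half period with even index \<open>D\<close> cannot pass from negative to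
    positive, in one with odd index not from positive to negative. The last run of one half period
    has the sign of the first run of the next, and the two receive the same number.\<close>
  define k where "k t = c t + (if (D t > 0) = even (c t) then 0 else 1)" for t
  assume "alternates (2 * real q * H) N (\<lambda>t. y t - \<phi> (t - \<tau>))"
  then obtain \<sigma> t where \<sigma>: "\<sigma> \<in> {1, -1}" and t: "\<And>i. i < N \<Longrightarrow> t i < t (Suc i)" "t N = t 0 + 2 * real q * H"
      "\<And>i. i \<le> N \<Longrightarrow> \<sigma> * (-1) ^ i * D (t i) > 0"
    unfolding alternates_def D_def by blast
  have c_bounds: "- H / 2 \<le> t - \<tau> - of_int (c t) * H" "t - \<tau> - of_int (c t) * H < H / 2" for t
  proof -
    have "of_int (c t) \<le> (t - \<tau> + H / 2) / H" "(t - \<tau> + H / 2) / H < of_int (c t) + 1"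
      unfolding c_def by linarith+
    then have "of_int (c t) * H \<le> t - \<tau> + H / 2" "t - \<tau> + H / 2 < (of_int (c t) + 1) * H"
      using \<open>H > 0\<close> by (simp_all add: pos_le_divide_eq pos_divide_less_eq)
    then show "- H / 2 \<le> t - \<tau> - of_int (c t) * H" "t - \<tau> - of_int (c t) * H < H / 2"
      by (simp_all add: algebra_simps)
  qed
  have c_mono: "c s \<le> c t" if "s \<le> t" for s t
    unfolding c_def using that \<open>H > 0\<close> by (intro floor_mono divide_right_mono) auto
  have Dval: "D t = y (w + (\<tau> + of_int (c t) * H)) - (if even (c t) then \<phi> w else - \<phi> w)"
    if "w = t - \<tau> - of_int (c t) * H" for t w
    using antiperiodic_int[of \<phi> H w "c t", OF anti] that by (simp add: D_def)
  have k_less: "k s < k t" if st: "s < t" "D s * D t < 0" for s t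
  proof -
    have nz: "D s \<noteq> 0" "D t \<noteq> 0" "(D s > 0) \<noteq> (D t > 0)" using st(2) by (auto simp: mult_less_0_iff)
    have par: "even (k s) \<noteq> even (k t)" using nz by (auto simp: k_def)
    have "k s \<le> k t"
    proof (cases "c s = c t")
      case False
      then have "c s < c t" using c_mono[of s t] st(1) by simp
      then show ?thesis by (auto simp: k_def)
    next
      case True
      let ?j = "c t" and ?u = "s - \<tau> - of_int (c t) * H" and ?w = "t - \<tau> - of_int (c t) * H"
      have uw: "- H / 2 \<le> ?u" "?u < ?w" "?w \<le> H / 2"
        using c_bounds[of s] c_bounds[of t] True st(1) by auto
      have Ds: "D s = y (?u + (\<tau> + of_int ?j * H)) - (if even ?j then \<phi> ?u else - \<phi> ?u)"
        using Dval[of ?u s] True by simp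
      have Dt: "D t = y (?w + (\<tau> + of_int ?j * H)) - (if even ?j then \<phi> ?w else - \<phi> ?w)"
        using Dval[of ?w t] by simp
      show ?thesis
      proof (rule ccontr)
        assume "\<not> k s \<le> k t"
        then have k: "(D s > 0) \<noteq> even ?j" "(D t > 0) = even ?j" using True by (auto simp: k_def split: if_splits)
        show False
        proof (cases "even ?j")
          case ev: True
          then have "D s < 0" "D t > 0" using k nz by auto
          then show False
            using cf(1)[unfolded crossing_free_def, rule_format, OF uw, of "\<tau> + of_int ?j * H"] Ds Dt ev by auto
        next
          case od: False
          then have "D s > 0" "D t < 0" using k nz by auto
          then show False
            using cf(2)[unfolded crossing_free_def, rule_format, OF uw, of "\<tau> + of_int ?j * H"] Ds Dt od by auto
        qed
      qed
    qed
    then show ?thesis using par by (cases "k s = k t") auto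
  qed
  have "k (t 0) + int i \<le> k (t i)" if "i \<le> N" for i
    using that
  proof (induction i)
    case (Suc i)
    have "0 < \<sigma> * (-1) ^ i * D (t i)" "0 < \<sigma> * (-1) ^ Suc i * D (t (Suc i))" using t(3) Suc.prems by (auto simp del: power_Suc)
    then have "0 < (\<sigma> * (-1) ^ i * D (t i)) * (\<sigma> * (-1) ^ Suc i * D (t (Suc i)))" by (rule mult_pos_pos)
    also have "\<dots> = (\<sigma> * \<sigma>) * ((-1) ^ i * (-1) ^ i) * - (D (t i) * D (t (Suc i)))" by (simp add: mult_ac)
    also have "\<dots> = - (D (t i) * D (t (Suc i)))" using \<sigma> by (auto simp flip: power_add)
    finally have "k (t i) < k (t (Suc i))" using k_less[OF t(1)] Suc.prems by auto
    then show ?case using Suc by simp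
  qed simp
  then have "k (t 0) + int N \<le> k (t N)" by simp
  moreover have "k (t N) = k (t 0) + 2 * int q"
  proof -
    have "(t N - \<tau> + H / 2) / H = (t 0 - \<tau> + H / 2) / H + of_int (2 * int q)"
      using t(2) \<open>H > 0\<close> by (simp add: field_simps)
    then have "c (t N) = c (t 0) + 2 * int q" unfolding c_def by (metis floor_add_int)
    moreover have "D (t N) = D (t 0)"
      using t(2) per[of "t 0"] antiperiodic_int[of \<phi> H "t 0 - \<tau>" "2 * int q", OF anti] by (simp add: D_def algebra_simps)
    ultimately show ?thesis by (simp add: k_def)
  qed
  ultimately show False using \<open>N > 2 * q\<close> by simp
qed

text \<open>Since \<open>y\<close> stays strictly between the extreme values of \<phi>, the
  difference changes sign between any two neighbouring extrema of the wave, \<open>2 * q\<close>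
  times in all. A crossing in the wrong direction adds two more changes.\<close>

lemma not_crossing_free_alternates:
  assumes "H > 0" and anti: "\<And>t. \<phi> (t + H) = - \<phi> t" and odd: "\<And>t. \<phi> (- t) = - \<phi> t"
    and small: "\<And>t. \<bar>y t\<bar> < \<phi> (H / 2)" and "q \<ge> 1" and ncf: "\<not> crossing_free H \<phi> y"
  shows "\<exists>\<tau>. alternates (2 * real q * H) (2 * q + 2) (\<lambda>t. y t - \<phi> (t - \<tau>))"
proof -
  obtain \<tau> u w where uw: "- H / 2 \<le> u" "u < w" "w \<le> H / 2" "y (u + \<tau>) < \<phi> u" "y (w + \<tau>) > \<phi> w"
    using ncf unfolding crossing_free_def by (auto simp: not_le)
  have neg: "\<phi> (- H / 2) = - \<phi> (H / 2)" using odd[of "H / 2"] by simp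
  have u: "- H / 2 < u" using uw(1,4) small[of "u + \<tau>"] neg by (cases "u = - H / 2") auto
  have w: "w < H / 2" using uw(3,5) small[of "w + \<tau>"] by (cases "w = H / 2") auto
  \<comment> \<open>Index 0 is a minimum of the translated wave, 1 and 2 are the wrong crossing, 3
    is the next maximum \<open>\<tau> + H / 2\<close>, and from there on minima and maxima
    alternate.\<close>
  define t where "t i = (if i = 0 then \<tau> - H / 2 else if i = 1 then u + \<tau> else if i = 2 then w + \<tau>
     else \<tau> - H / 2 + (real i - 2) * H)" for i :: nat
  show ?thesis unfolding alternates_def
  proof (intro exI[of _ \<tau>] bexI[of _ 1] exI[of _ t] conjI allI impI)
    show "t (2 * q + 2) = t 0 + 2 * real q * H" using \<open>q \<ge> 1\<close> by (simp add: t_def)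
    fix i :: nat
    consider "i = 0" | "i = 1" | "i = 2" | j where "i = j + 3" by (metis add.commute add_2_eq_Suc' le_Suc_ex numeral_3_eq_3 One_nat_def Suc_1 less_Suc0 less_Suc_eq not_less)
    then show "t i < t (Suc i)"
    proof cases
      case 2
      then show ?thesis using uw by (simp add: t_def numeral_2_eq_2)
    qed (use u uw w \<open>H > 0\<close> in \<open>auto simp: t_def algebra_simps\<close>)
    consider "i = 0" | "i = 1" | "i = 2" | j where "i = j + 3" by (metis add.commute add_2_eq_Suc' le_Suc_ex numeral_3_eq_3 One_nat_def Suc_1 less_Suc0 less_Suc_eq not_less)
    then show "1 * (- 1) ^ i * (y (t i) - \<phi> (t i - \<tau>)) > 0"
    proof cases
      case 1
      then show ?thesis using small[of "\<tau> - H / 2"] neg by (auto simp: t_def)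
    next
      case 2
      then show ?thesis using uw by (auto simp: t_def)
    next
      case 3
      then show ?thesis using uw by (auto simp: t_def)
    next
      case (4 j)
      then have "t i - \<tau> = - H / 2 + of_int (int j + 1) * H" by (simp add: t_def)
      then have "\<phi> (t i - \<tau>) = (if even j then \<phi> (H / 2) else - \<phi> (H / 2))"
        using antiperiodic_int[of \<phi> H "- H / 2" "int j + 1", OF anti] neg by simp
      then show ?thesis using 4 small[of "t i"] by (auto simp: abs_less_iff)
    qed
  qed simp
qed

text \<open>A wrong crossing at order \<open>m + d\<close> gives \<open>2 * q + 2\<close> sign
  changes, which differentiation carries down to order \<open>m\<close>, where more than
  \<open>2 * q\<close> are impossible. The waves are recentred at each order, so a differentiation
  moves the translation by \<open>H / 2\<close>; hence the induction only claims that some \<tau>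
  exists.\<close>

lemma crossing_free_lift:
  fixes Y \<Phi> :: "nat \<Rightarrow> real \<Rightarrow> real"
  assumes "H > 0" "q \<ge> 1"
    and anti: "\<And>n t. n \<ge> m \<Longrightarrow> \<Phi> n (t + H) = - \<Phi> n t" and odd: "\<And>n t. n \<ge> m \<Longrightarrow> \<Phi> n (- t) = - \<Phi> n t"
    and d\<Phi>: "\<And>n t. n \<ge> m \<Longrightarrow> (\<Phi> (Suc n) has_real_derivative \<Phi> n (t + H / 2)) (at t)"
    and dY: "\<And>k t. k < d \<Longrightarrow> (Y k has_real_derivative Y (Suc k) t) (at t)"
    and per: "\<And>k t. k \<le> d \<Longrightarrow> Y k (t + 2 * real q * H) = Y k t"
    and cf: "crossing_free H (\<Phi> m) (Y d)" "crossing_free H (\<Phi> m) (\<lambda>t. - Y d t)"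
    and small: "\<And>t. \<bar>Y 0 t\<bar> < \<Phi> (m + d) (H / 2)"
  shows "crossing_free H (\<Phi> (m + d)) (Y 0)"
proof (rule ccontr)
  assume ncf: "\<not> ?thesis"
  let ?P = "2 * real q * H"
  have "\<exists>\<tau>. alternates ?P (2 * q + 2) (\<lambda>t. Y k t - \<Phi> (m + d - k) (t - \<tau>))" if "k \<le> d" for k
    using that
  proof (induction k)
    case 0
    then show ?case
      using not_crossing_free_alternates[OF \<open>H > 0\<close> anti odd small \<open>q \<ge> 1\<close> ncf] by simp
  next
    case (Suc k)
    then obtain \<tau> where \<tau>: "alternates ?P (2 * q + 2) (\<lambda>t. Y k t - \<Phi> (m + d - k) (t - \<tau>))" by auto
    have e: "m + d - k = Suc (m + d - Suc k)" "m + d - Suc k \<ge> m" using Suc.prems by auto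
    have "alternates ?P (2 * q + 2) (\<lambda>t. Y (Suc k) t - \<Phi> (m + d - Suc k) (t - (\<tau> - H / 2)))"
    proof (rule alternates_deriv[OF _ _ _ _ \<tau>,
          where g' = "\<lambda>t. Y (Suc k) t - \<Phi> (m + d - Suc k) (t - (\<tau> - H / 2))"])
      show "((\<lambda>t. Y k t - \<Phi> (m + d - k) (t - \<tau>)) has_real_derivative
          Y (Suc k) t - \<Phi> (m + d - Suc k) (t - (\<tau> - H / 2))) (at t)" for t
        unfolding e(1) using dY[of k t] Suc.prems DERIV_shift[of "\<Phi> (Suc (m + d - Suc k))" _ t "- \<tau>"] d\<Phi>[OF e(2), of "t - \<tau>"]
        by (intro DERIV_diff) (auto simp: algebra_simps)
      have "\<Phi> (m + d - Suc k) (t + ?P) = \<Phi> (m + d - Suc k) t" for t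
        using antiperiodic_int[of "\<Phi> (m + d - Suc k)" H t "2 * int q", OF anti[OF e(2)]] by (simp add: algebra_simps)
      from this[of "t - (\<tau> - H / 2)" for t] per[OF Suc.prems]
      show "Y (Suc k) (t + ?P) - \<Phi> (m + d - Suc k) (t + ?P - (\<tau> - H / 2)) =
         Y (Suc k) t - \<Phi> (m + d - Suc k) (t - (\<tau> - H / 2))" for t
        by (simp add: algebra_simps)
    qed auto
    then show ?case by blast
  qed
  from this[of d] obtain \<tau> where "alternates ?P (2 * q + 2) (\<lambda>t. Y d t - \<Phi> m (t - \<tau>))" by auto
  moreover have "\<not> alternates ?P (2 * q + 2) (\<lambda>t. Y d t - \<Phi> m (t - \<tau>))"
    by (rule crossing_free_not_alternates[OF \<open>H > 0\<close> anti cf per]) auto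
  ultimately show False by blast
qed

text \<open>Strictly between its extreme values \<phi> rises at least as fast as \<open>y\<close>
  can; at the extreme values the bound on \<open>y\<close> decides.\<close>

lemma crossing_free_level1:
  assumes rng: "\<And>s. - H / 2 \<le> s \<Longrightarrow> s \<le> H / 2 \<Longrightarrow> \<bar>\<phi> s\<bar> \<le> A"
    and slope: "\<And>s t. - H / 2 \<le> s \<Longrightarrow> s < t \<Longrightarrow> t \<le> H / 2 \<Longrightarrow> - A < \<phi> s \<Longrightarrow> \<phi> t < A \<Longrightarrow> B * (t - s) \<le> \<phi> t - \<phi> s"
    and y: "\<And>t. \<bar>y t\<bar> \<le> A" "\<And>s t. \<bar>y t - y s\<bar> \<le> B * \<bar>t - s\<bar>"
  shows "crossing_free H \<phi> y"
  unfolding crossing_free_def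
proof (intro allI impI)
  fix \<tau> s t assume st: "- H / 2 \<le> s" "s < t" "t \<le> H / 2" "y (s + \<tau>) < \<phi> s"
  have "- A < \<phi> s" using y(1)[of "s + \<tau>"] st(4) by auto
  show "y (t + \<tau>) \<le> \<phi> t"
  proof (cases "\<phi> t < A")
    case True
    have "y (t + \<tau>) - y (s + \<tau>) \<le> B * (t - s)" using y(2)[of "t + \<tau>" "s + \<tau>"] st by auto
    also have "\<dots> \<le> \<phi> t - \<phi> s" using slope st True \<open>- A < \<phi> s\<close> by auto
    finally show ?thesis using st by simp
  next
    case False
    then show ?thesis using y(1)[of "t + \<tau>"] by auto
  qed
qed

text \<open>On the rising half period \<open>y - \<phi>\<close> is concave, then nonincreasing, then convex, and it is
  nonnegative at the left end and nonpositive at the right end; so it cannot pass from negative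
  to positive.\<close>

lemma crossing_free_level2:
  assumes h: "0 \<le> h0" "h0 \<le> h1" "h1 \<le> H / 2"
    and flat: "\<And>s. - H / 2 \<le> s \<Longrightarrow> s \<le> - h1 \<Longrightarrow> \<phi> s = - M" "\<And>s. h1 \<le> s \<Longrightarrow> s \<le> H / 2 \<Longrightarrow> \<phi> s = M"
    and d\<phi>: "\<And>t. (\<phi> has_real_derivative E t) (at t)"
    and slope: "\<And>s t. - h1 \<le> s \<Longrightarrow> s \<le> t \<Longrightarrow> t \<le> - h0 \<Longrightarrow> B * (t - s) \<le> E t - E s"
      "\<And>s t. h0 \<le> s \<Longrightarrow> s \<le> t \<Longrightarrow> t \<le> h1 \<Longrightarrow> B * (t - s) \<le> E s - E t"
    and dy: "\<And>t. (y has_real_derivative z t) (at t)"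
    and y: "\<And>t. \<bar>y t\<bar> \<le> M" and z: "\<And>s t. \<bar>z t - z s\<bar> \<le> B * \<bar>t - s\<bar>"
      "\<And>s t. - h0 < s \<Longrightarrow> s < h0 \<Longrightarrow> \<bar>z t\<bar> \<le> E s"
  shows "crossing_free H \<phi> y"
  unfolding crossing_free_def
proof (intro allI impI)
  fix \<tau> s t assume st: "- H / 2 \<le> s" "s < t" "t \<le> H / 2" "y (s + \<tau>) < \<phi> s"
  show "y (t + \<tau>) \<le> \<phi> t"
  proof (rule ccontr)
    assume "\<not> ?thesis"
    then have t: "y (t + \<tau>) > \<phi> t" by simp
    have "\<not> s \<le> - h1" using flat(1)[of s] st y[of "s + \<tau>"] by auto
    moreover have "\<not> t \<ge> h1" using flat(2)[of t] st t y[of "t + \<tau>"] by auto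
    ultimately have b: "- h1 < s" "t < h1" by auto
    define D where "D u = y (u + \<tau>) - \<phi> u" for u
    define D' where "D' u = z (u + \<tau>) - E u" for u
    have dD: "(D has_real_derivative D' u) (at u)" for u
      unfolding D_def D'_def using DERIV_shift[of y "z (u + \<tau>)" u \<tau>] dy d\<phi> by (intro DERIV_diff) auto
    have D: "D (- h1) \<ge> 0" "D s < 0" "D t > 0" "D h1 \<le> 0"
      using flat(1)[of "- h1"] flat(2)[of h1] h b st t y[of "- h1 + \<tau>"] y[of "h1 + \<tau>"] by (auto simp: D_def abs_le_iff)
    \<comment> \<open>Three mean value points at which \<open>D'\<close> is negative, positive,
      negative. The position of the middle one decides the contradiction: \<open>D'\<close> is
      nonincreasing on the left part, nonpositive in the middle and nondecreasing on the right
      part.\<close>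
    obtain u1 where u1: "- h1 < u1" "u1 < s" "D s - D (- h1) = (s - - h1) * D' u1"
      using MVT2[OF b(1), of D D'] dD by blast
    then have "(s - - h1) * D' u1 < 0" using D by linarith
    then have u1: "- h1 < u1" "u1 < s" "D' u1 < 0" using b(1) u1(1,2) by (auto simp: mult_less_0_iff)
    obtain u2 where u2: "s < u2" "u2 < t" "D t - D s = (t - s) * D' u2"
      using MVT2[OF st(2), of D D'] dD by blast
    then have "0 < (t - s) * D' u2" using D by linarith
    then have u2: "s < u2" "u2 < t" "D' u2 > 0" using st(2) u2(1,2) by (auto simp: zero_less_mult_iff)
    obtain u3 where u3: "t < u3" "u3 < h1" "D h1 - D t = (h1 - t) * D' u3"
      using MVT2[OF b(2), of D D'] dD by blast
    then have "(h1 - t) * D' u3 < 0" using D by linarith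
    then have u3: "t < u3" "u3 < h1" "D' u3 < 0" using b(2) u3(1,2) by (auto simp: mult_less_0_iff)
    consider "u2 \<le> - h0" | "- h0 < u2" "u2 < h0" | "h0 \<le> u2" by linarith
    then show False
    proof cases
      case 1
      have "z (u2 + \<tau>) - z (u1 + \<tau>) \<le> B * (u2 - u1)" using z(1)[of "u2 + \<tau>" "u1 + \<tau>"] u1 u2 by auto
      also have "\<dots> \<le> E u2 - E u1" using slope(1)[of u1 u2] u1 u2 1 by auto
      finally show False using u1 u2 by (simp add: D'_def)
    next
      case 2
      then show False using z(2)[of u2 "u2 + \<tau>"] u2 by (auto simp: D'_def)
    next
      case 3
      have "z (u2 + \<tau>) - z (u3 + \<tau>) \<le> B * (u3 - u2)" using z(1)[of "u2 + \<tau>" "u3 + \<tau>"] u3 u2 by auto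
      also have "\<dots> \<le> E u2 - E u3" using slope(2)[of u2 u3] u3 u2 3 by auto
      finally show False using u3 u2 by (simp add: D'_def)
    qed
  qed
qed

text \<open>The parameter is \<open>y\<close> followed by the inverse of the rising branch of
  \<phi>. If it gained more than \<open>t - s\<close> between \<open>s\<close> and \<open>t\<close>,
  some translate of \<phi> would lie above \<open>y\<close> at \<open>s\<close> and below
  \<open>y\<close> at \<open>t\<close>, which is a forbidden crossing; \<open>- y\<close> gives the
  bound from the other side.\<close>

lemma crossing_free_Lipschitz_parameter:
  assumes sw: "strict_wave H \<phi>" and small: "\<And>t. \<bar>y t\<bar> < \<phi> (H / 2)"
    and cf: "crossing_free H \<phi> y" "crossing_free H \<phi> (\<lambda>t. - y t)"
  obtains v where "\<And>s. - H / 2 < v s" "\<And>s. v s < H / 2" "\<And>s. \<phi> (v s) = y s" "\<And>s t. \<bar>v t - v s\<bar> \<le> \<bar>t - s\<bar>"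
proof -
  have H: "H > 0" and odd: "\<And>t. \<phi> (- t) = - \<phi> t" and cont: "continuous_on UNIV \<phi>"
    and mono: "\<And>s t. - H / 2 \<le> s \<Longrightarrow> s \<le> t \<Longrightarrow> t \<le> H / 2 \<Longrightarrow> \<phi> s \<le> \<phi> t"
    and strict: "\<And>s t. - H / 2 \<le> s \<Longrightarrow> s < t \<Longrightarrow> t \<le> H / 2 \<Longrightarrow> \<phi> s < \<phi> (H / 2) \<Longrightarrow> - \<phi> (H / 2) < \<phi> t \<Longrightarrow> \<phi> s < \<phi> t"
    using sw unfolding strict_wave_def wave_def by auto
  have neg: "\<phi> (- H / 2) = - \<phi> (H / 2)" using odd[of "H / 2"] by simp
  have "\<exists>w. - H / 2 < w \<and> w < H / 2 \<and> \<phi> w = z" if "\<bar>z\<bar> < \<phi> (H / 2)" for z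
  proof -
    have "\<exists>w. - H / 2 \<le> w \<and> w \<le> H / 2 \<and> \<phi> w = z"
      using that neg H by (intro IVT') (auto intro: continuous_on_subset[OF cont])
    then obtain w where w: "- H / 2 \<le> w" "w \<le> H / 2" "\<phi> w = z" by blast
    moreover have "w \<noteq> - H / 2" "w \<noteq> H / 2" using w that neg by auto
    ultimately show ?thesis by (intro exI[of _ w]) auto
  qed
  then obtain v0 where v0: "\<And>z. \<bar>z\<bar> < \<phi> (H / 2) \<Longrightarrow> - H / 2 < v0 z \<and> v0 z < H / 2 \<and> \<phi> (v0 z) = z" by metis
  \<comment> \<open>Oddness of the inverse branch lets the estimate for \<open>- y\<close> be read
    as one for \<open>y\<close>.\<close>
  have inj: "v0 (- z) = - v0 z" if "\<bar>z\<bar> < \<phi> (H / 2)" for z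
  proof -
    have *: "- H / 2 < v0 z" "v0 z < H / 2" "\<phi> (v0 z) = z" "- H / 2 < v0 (- z)" "v0 (- z) < H / 2" "\<phi> (v0 (- z)) = - z"
      using v0[of z] v0[of "- z"] that by auto
    have "\<phi> (- v0 z) = - z" using * odd by simp
    then show ?thesis
      using strict[of "- v0 z" "v0 (- z)"] strict[of "v0 (- z)" "- v0 z"] * that
      by (cases "- v0 z" "v0 (- z)" rule: linorder_cases) (auto simp: abs_less_iff)
  qed
  have up: "v0 (g t) - v0 (g s) \<le> t - s" if g: "crossing_free H \<phi> g" "\<And>t. \<bar>g t\<bar> < \<phi> (H / 2)" and "s < t" for g s t
  proof (rule ccontr)
    assume neg: "\<not> ?thesis"
    define w where "w = v0 (g s)" define w' where "w' = v0 (g t)"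
    have w: "- H / 2 < w" "w < H / 2" "\<phi> w = g s" and w': "- H / 2 < w'" "w' < H / 2" "\<phi> w' = g t"
      using v0[OF g(2)[of s]] v0[OF g(2)[of t]] by (auto simp: w_def w'_def)
    \<comment> \<open>Half of the surplus: sliding the branch by \<delta> leaves room for a strict
      inequality at both ends.\<close>
    define \<delta> where "\<delta> = (w' - w - (t - s)) / 2"
    have \<delta>: "\<delta> > 0" "w + \<delta> + (t - s) < w'" using neg by (auto simp: \<delta>_def w_def w'_def field_simps)
    have order: "- H / 2 \<le> w + \<delta>" "w + \<delta> < w + \<delta> + (t - s)" "w + \<delta> + (t - s) \<le> H / 2" using \<delta> w w' \<open>s < t\<close> by auto
    have "\<phi> w < \<phi> (w + \<delta>)"
    proof (rule strict)
      show "- \<phi> (H / 2) < \<phi> (w + \<delta>)" using mono[of w "w + \<delta>"] order \<delta> w g(2)[of s] by (auto simp: abs_less_iff)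
      show "\<phi> w < \<phi> (H / 2)" using w g(2)[of s] by (auto simp: abs_less_iff)
    qed (use w \<delta> order in auto)
    moreover have "\<phi> (w + \<delta> + (t - s)) < \<phi> w'"
    proof (rule strict)
      show "- \<phi> (H / 2) < \<phi> w'" using w' g(2)[of t] by (auto simp: abs_less_iff)
      show "\<phi> (w + \<delta> + (t - s)) < \<phi> (H / 2)" using mono[of "w + \<delta> + (t - s)" w'] order \<delta> w' g(2)[of t] by (auto simp: abs_less_iff)
    qed (use w' \<delta> order in auto)
    ultimately show False
      using g(1)[unfolded crossing_free_def, rule_format, OF order, of "s - (w + \<delta>)"] w w' by (auto simp: algebra_simps)
  qed
  have lip: "\<bar>v0 (y t) - v0 (y s)\<bar> \<le> \<bar>t - s\<bar>" for s t
  proof -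
    have "\<bar>v0 (y t) - v0 (y s)\<bar> \<le> t - s" if "s < t" for s t
      using up[OF cf(1) small that] up[OF cf(2) _ that] small inj[OF small] by (auto simp: abs_le_iff)
    from this[of s t] this[of t s] show ?thesis by (cases s t rule: linorder_cases) auto
  qed
  show thesis using that[of "\<lambda>s. v0 (y s)"] v0[OF small] lip by blast
qed

section \<open>Construction of waves from one half period and by integration\<close>

lemma antiperiodic_reduce:
  fixes t H :: real
  assumes "H > 0"
  obtains w j where "t = w + of_int j * H" "- H / 2 \<le> w" "w < H / 2"
proof
  define j where "j = \<lfloor>t / H + 1 / 2\<rfloor>"
  show "t = (t - of_int j * H) + of_int j * H" by simp
  have "of_int j \<le> t / H + 1 / 2" "t / H + 1 / 2 < of_int j + 1" unfolding j_def by linarith+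
  then have *: "of_int j * H \<le> (t / H + 1 / 2) * H" "(t / H + 1 / 2) * H < (of_int j + 1) * H"
    using assms by (simp_all only: mult_right_mono mult_strict_right_mono less_imp_le)
  have e: "(t / H + 1 / 2) * H = t + H / 2" using assms by (simp add: field_simps)
  show "- H / 2 \<le> t - of_int j * H" "t - of_int j * H < H / 2" using *[unfolded e] by (simp_all add: algebra_simps)
qed

text \<open>Two adjacent half periods glue to continuity on an open interval of length
  \<open>2 * H\<close>; a translation by a multiple of \<open>H\<close> brings every point into it,
  junctions included.\<close>

lemma antiperiodic_continuous:
  fixes \<phi> :: "real \<Rightarrow> real"
  assumes "H > 0" and anti: "\<And>t. \<phi> (t + H) = - \<phi> t" and cont: "continuous_on {- H / 2..H / 2} \<phi>"
  shows "continuous_on UNIV \<phi>"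
proof -
  have shifted: "continuous_on {H / 2..3 * H / 2} \<phi>"
  proof -
    have "continuous_on {H / 2..3 * H / 2} (\<lambda>t. - \<phi> (t - H))"
      by (intro continuous_intros continuous_on_compose2[OF cont]) auto
    moreover have "- \<phi> (t - H) = \<phi> t" for t using anti[of "t - H"] by simp
    ultimately show ?thesis by simp
  qed
  have "continuous_on ({- H / 2..H / 2} \<union> {H / 2..3 * H / 2}) \<phi>"
    using cont shifted by (intro continuous_on_closed_Un) auto
  then have c: "continuous_on {- H / 2<..<3 * H / 2} \<phi>" by (rule continuous_on_subset) auto
  have "isCont \<phi> t" for t
  proof -
    obtain w j where w: "t + H / 2 = w + of_int j * H" "- H / 2 \<le> w" "w < H / 2"
      using antiperiodic_reduce[OF \<open>H > 0\<close>] by blast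
    obtain w' j' where w': "t = w' + of_int j' * H" "- H / 2 < w'" "w' < 3 * H / 2"
    proof (cases "w = 0")
      case True
      show ?thesis by (rule that[of "H / 2" "j - 1"]) (use True w \<open>H > 0\<close> in \<open>auto simp: algebra_simps\<close>)
    next
      case False
      show ?thesis
      proof (cases "w > 0")
        case True
        show ?thesis by (rule that[of "w - H / 2" j]) (use True w \<open>H > 0\<close> in \<open>auto simp: algebra_simps\<close>)
      next
        case F: False
        show ?thesis by (rule that[of "w + H / 2" "j - 1"]) (use F w \<open>H > 0\<close> in \<open>auto simp: algebra_simps\<close>)
      qed
    qed
    have eq: "\<phi> = (\<lambda>s. (if even j' then 1 else - 1) * \<phi> (s - of_int j' * H))"
    proof
      fix s show "\<phi> s = (if even j' then 1 else - 1) * \<phi> (s - of_int j' * H)"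
        using antiperiodic_int[of \<phi> H "s - of_int j' * H" j', OF anti] by auto
    qed
    have "isCont \<phi> (t - of_int j' * H)"
      using c w' by (intro continuous_on_interior[OF c]) (auto simp: interior_open)
    then have "isCont (\<lambda>s. (if even j' then 1 else - 1) * \<phi> (s - of_int j' * H)) t"
      by (intro continuous_intros isCont_o2[where g = \<phi> and f = "\<lambda>s. s - of_int j' * H"])
    then show ?thesis using eq by simp
  qed
  then show ?thesis by (simp add: continuous_at_imp_continuous_on)
qed

lemma waveI:
  assumes "H > 0" "\<And>t. \<phi> (t + H) = - \<phi> t" "continuous_on {- H / 2..H / 2} \<phi>"
    "\<And>t. \<bar>t\<bar> \<le> H / 2 \<Longrightarrow> \<phi> (- t) = - \<phi> t" "\<And>s t. - H / 2 \<le> s \<Longrightarrow> s \<le> t \<Longrightarrow> t \<le> H / 2 \<Longrightarrow> \<phi> s \<le> \<phi> t" "0 < \<phi> (H / 2)"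
  shows "wave H \<phi>"
proof -
  have "\<phi> (- t) = - \<phi> t" for t
  proof -
    obtain w j where w: "t = w + of_int j * H" "- H / 2 \<le> w" "w < H / 2" using antiperiodic_reduce[OF \<open>H > 0\<close>] by blast
    have "\<phi> (- t) = \<phi> (- w + of_int (- j) * H)" using w(1) by (simp add: algebra_simps)
    also have "\<dots> = (if even j then \<phi> (- w) else - \<phi> (- w))"
      using antiperiodic_int[of \<phi> H "- w" "- j"] assms(2) by simp
    also have "\<dots> = - (if even j then \<phi> w else - \<phi> w)" using assms(4)[of w] w by auto
    also have "\<dots> = - \<phi> t" using antiperiodic_int[of \<phi> H w j] assms(2) w(1) by simp
    finally show ?thesis .
  qed
  then show ?thesis unfolding wave_def using assms antiperiodic_continuous[OF assms(1-3)] by blast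
qed

lemma waveD:
  assumes "wave H \<phi>"
  shows "H > 0" "\<phi> (t + H) = - \<phi> t" "\<phi> (- t) = - \<phi> t" "continuous_on UNIV \<phi>"
    "- H / 2 \<le> s \<Longrightarrow> s \<le> t \<Longrightarrow> t \<le> H / 2 \<Longrightarrow> \<phi> s \<le> \<phi> t" "0 < \<phi> (H / 2)"
    "\<phi> (H / 2 - t) = \<phi> (H / 2 + t)" "0 \<le> t \<Longrightarrow> t \<le> H \<Longrightarrow> 0 \<le> \<phi> t" "\<phi> 0 = 0"
    "\<phi> (- (H / 2)) = - \<phi> (H / 2)" "\<bar>\<phi> t\<bar> \<le> \<phi> (H / 2)"
proof -
  show H: "H > 0" and anti: "\<And>t. \<phi> (t + H) = - \<phi> t" and odd: "\<And>t. \<phi> (- t) = - \<phi> t" and "continuous_on UNIV \<phi>"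
    and mono: "\<And>s t. - H / 2 \<le> s \<Longrightarrow> s \<le> t \<Longrightarrow> t \<le> H / 2 \<Longrightarrow> \<phi> s \<le> \<phi> t" and "0 < \<phi> (H / 2)"
    using assms unfolding wave_def by blast+
  show even: "\<phi> (H / 2 - t) = \<phi> (H / 2 + t)" for t
    using anti[of "t - H / 2"] odd[of "H / 2 - t"] by (simp add: algebra_simps)
  show zero: "\<phi> 0 = 0" using odd[of 0] by simp
  show "0 \<le> \<phi> t" if "0 \<le> t" "t \<le> H"
  proof (cases "t \<le> H / 2")
    case True
    then show ?thesis using mono[of 0 t] zero that by simp
  next
    case False
    then have "0 \<le> \<phi> (H - t)" using mono[of 0 "H - t"] zero that by simp
    moreover have "H / 2 - (t - H / 2) = H - t" "H / 2 + (t - H / 2) = t" by simp_all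
    ultimately show ?thesis using even[of "t - H / 2"] by simp
  qed
  show neg: "\<phi> (- (H / 2)) = - \<phi> (H / 2)" using odd by simp
  obtain w j where w: "t = w + of_int j * H" "- H / 2 \<le> w" "w < H / 2" using antiperiodic_reduce[OF H] by blast
  have "\<bar>\<phi> t\<bar> = \<bar>\<phi> w\<bar>" using antiperiodic_int[of \<phi> H w j] anti w(1) by simp
  then show "\<bar>\<phi> t\<bar> \<le> \<phi> (H / 2)" using mono[of "- H / 2" w] mono[of w "H / 2"] w neg H by auto
qed

lemma interval_integral_has_derivative:
  fixes f :: "real \<Rightarrow> real"
  assumes "continuous_on UNIV f"
  shows "((\<lambda>t. LBINT s=0..t. f s) has_real_derivative f t) (at t)"
proof -
  let ?a = "- \<bar>t\<bar> - 1" and ?b = "\<bar>t\<bar> + 1"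
  have "((\<lambda>u. LBINT y=ereal 0..ereal u. f y) has_vector_derivative f t) (at t within {?a..?b})"
    by (rule interval_integral_FTC2) (auto intro: continuous_on_subset[OF assms])
  then have "((\<lambda>u. LBINT y=ereal 0..ereal u. f y) has_vector_derivative f t) (at t within {?a<..<?b})"
    by (rule has_vector_derivative_within_subset) auto
  moreover have "at t within {?a<..<?b} = at t" by (rule at_within_open) auto
  ultimately show ?thesis by (simp add: has_real_derivative_iff_has_vector_derivative zero_ereal_def)
qed

lemma periodic_integral_has_derivative:
  assumes "continuous_on UNIV f"
  shows "(periodic_integral P f has_real_derivative f t) (at t)"
proof -
  have "periodic_integral P f = (\<lambda>t. (LBINT s=0..t. f s) - (LBINT \<tau>=0..P. (LBINT s=0..\<tau>. f s)) / P)"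
    by (auto simp: periodic_integral_def)
  then show ?thesis using DERIV_diff[OF interval_integral_has_derivative[OF assms, of t] DERIV_const] by simp
qed

text \<open>The sum of \<open>?F (t + H)\<close> and \<open>?F t\<close> has derivative 0, so it is
  a constant \<open>K\<close>. Integrated over a half period it gives \<open>K * H\<close> as the
  integral of \<open>?F\<close> over a full period, and the zero-mean normalisation makes this
  0.\<close>

lemma periodic_integral_antiperiodic:
  assumes "H > 0" and cont: "continuous_on UNIV f" and anti: "\<And>t. f (t + H) = - f t"
  shows "periodic_integral (2 * H) f (t + H) = - periodic_integral (2 * H) f t"
proof -
  let ?F = "periodic_integral (2 * H) f"
  have dF: "(?F has_real_derivative f t) (at t)" for t by (rule periodic_integral_has_derivative[OF cont])
  have cF: "continuous_on UNIV ?F" using dF by (meson DERIV_continuous continuous_at_imp_continuous_on)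
  have "((\<lambda>t. ?F (t + H) + ?F t) has_real_derivative 0) (at t)" for t
    using DERIV_add[OF DERIV_shift[THEN iffD1, OF dF[of "t + H"]] dF[of t]] anti[of t] by simp
  then have K: "?F (t + H) + ?F t = ?F (0 + H) + ?F 0" for t
    using DERIV_isconst_all[of "\<lambda>t. ?F (t + H) + ?F t"] by blast
  define K where "K = ?F (0 + H) + ?F 0"
  define Q where "Q t = (LBINT s=0..t. ?F s)" for t :: real
  have dQ: "(Q has_real_derivative ?F t) (at t)" for t
    unfolding Q_def by (rule interval_integral_has_derivative[OF cF])
  have "((\<lambda>t. Q (t + H) + Q t - K * t) has_real_derivative (?F (t + H) + ?F t) - K * 1) (at t)" for t
    using DERIV_shift[THEN iffD1, OF dQ[of "t + H"]] dQ[of t] by (intro derivative_intros) auto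
  then have "((\<lambda>t. Q (t + H) + Q t - K * t) has_real_derivative 0) (at t)" for t
    using K by (simp add: K_def)
  from DERIV_isconst_all[rule_format, OF this, of H 0] have "Q (H + H) - Q 0 = K * H" by simp
  moreover have "Q 0 = 0" by (simp add: Q_def zero_ereal_def)
  moreover have "Q (H + H) = 0"
  proof -
    have c: "continuous_on UNIV (\<lambda>\<tau>::real. LBINT s=0..\<tau>. f s)"
      using interval_integral_has_derivative[OF cont] by (meson DERIV_continuous continuous_at_imp_continuous_on)
    have int: "interval_lebesgue_integrable lborel (ereal 0) (ereal (2 * H)) (\<lambda>\<tau>::real. LBINT s=0..\<tau>. f s)"
      by (rule interval_integrable_continuous_on) (use \<open>H > 0\<close> continuous_on_subset[OF c] in auto)
    have "Q (2 * H) = (LBINT \<tau>=ereal 0..ereal (2 * H). (LBINT s=0..\<tau>. f s) - (LBINT \<tau>=0..2 * H. (LBINT s=0..\<tau>. f s)) / (2 * H))"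
      by (simp add: Q_def periodic_integral_def zero_ereal_def)
    also have "\<dots> = (LBINT \<tau>=ereal 0..ereal (2 * H). (LBINT s=0..\<tau>. f s)) -
       (LBINT \<tau>=ereal 0..ereal (2 * H). (LBINT \<tau>=0..2 * H. (LBINT s=0..\<tau>. f s)) / (2 * H))"
      by (intro interval_lebesgue_integral_diff int) auto
    also have "(LBINT \<tau>=ereal 0..ereal (2 * H). (LBINT \<tau>=0..2 * H. (LBINT s=0..\<tau>. f s)) / (2 * H)) =
       (LBINT \<tau>=ereal 0..ereal (2 * H). (LBINT s=0..\<tau>. f s))"
      using \<open>H > 0\<close> by (simp add: zero_ereal_def)
    finally have "Q (2 * H) = 0" by simp
    then show ?thesis by (simp only: mult_2)
  qed
  ultimately have "K = 0" using \<open>H > 0\<close> by simp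
  then show ?thesis using K[of t] by (simp add: K_def)
qed

lemma constant_on_of_deriv_zero:
  fixes F :: "real \<Rightarrow> real"
  assumes "\<And>t. (F has_real_derivative F' t) (at t)" "s \<le> t" "\<And>u. s \<le> u \<Longrightarrow> u \<le> t \<Longrightarrow> F' u = 0"
  shows "F s = F t"
proof (cases "s = t")
  case False
  then have "s < t" using assms(2) by simp
  then have "\<exists>z>s. z < t \<and> F t - F s = (t - s) * F' z" by (rule MVT2) (rule assms(1))
  then obtain z where "s < z" "z < t" "F t - F s = (t - s) * F' z" by blast
  then show ?thesis using assms(3)[of z] by simp
qed simp

text \<open>The derivative \<open>g (w + H / 2)\<close> is a nonnegative arch on
  \<open>[-H/2, H/2]\<close>, rising up to 0 and falling after it. Where \<open>F\<close> is
  constant the arch vanishes, and then it vanishes from there out to one end of the half period; so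
  \<open>F\<close> already has its extreme value there.\<close>

lemma strict_wave_primitive:
  assumes g: "wave H g" and dF: "\<And>w. (F has_real_derivative g (w + H / 2)) (at w)"
    and anti: "\<And>t. F (t + H) = - F t"
  shows "strict_wave H F"
proof -
  note g = waveD[OF g]
  have "H > 0" by (rule g(1))
  have F_neg: "F (- (H / 2)) = - F (H / 2)" using anti[of "- (H / 2)"] by simp
  have nonneg: "0 \<le> g (w + H / 2)" if "- H / 2 \<le> w" "w \<le> H / 2" for w using that g(8)[of "w + H / 2"] by auto
  have mono: "F s \<le> F t" if "- H / 2 \<le> s" "s \<le> t" "t \<le> H / 2" for s t
  proof (rule DERIV_nonneg_imp_nondecreasing[OF that(2)])
    fix w assume "s \<le> w" "w \<le> t"
    then show "\<exists>y. (F has_real_derivative y) (at w) \<and> 0 \<le> y"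
      using dF[of w] nonneg[of w] that by (intro exI[of _ "g (w + H / 2)"]) auto
  qed
  have odd: "F (- w) = - F w" for w
  proof -
    have "((\<lambda>w. F w + F (- w)) has_real_derivative 0) (at w)" for w
    proof -
      have "((\<lambda>w. F (- w)) has_real_derivative g (- w + H / 2) * - 1) (at w)"
        by (rule DERIV_chain2[OF dF]) (auto intro!: derivative_eq_intros)
      from DERIV_add[OF dF[of w] this] show ?thesis using g(7)[of w] by (simp add: algebra_simps)
    qed
    then have "F w + F (- w) = F (H / 2) + F (- (H / 2))"
      using DERIV_isconst_all[of "\<lambda>w. F w + F (- w)"] by blast
    then show ?thesis using F_neg by simp
  qed
  have pos: "F (H / 2) > 0"
  proof (rule ccontr)
    assume "\<not> ?thesis"
    then have "F (H / 2) \<le> F (- (H / 2))" using F_neg by simp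
    then have eq: "F w = F (- (H / 2))" if "- (H / 2) < w" "w < H / 2" for w
      using mono[of "- (H / 2)" w] mono[of w "H / 2"] that by auto
    have "F 0 = F w" if "\<bar>0 - w\<bar> < H / 2" for w
      using eq[of 0] eq[of w] that \<open>H > 0\<close> by (simp add: abs_less_iff)
    then have "g (0 + H / 2) = 0" using DERIV_local_const[OF dF[of 0], of "H / 2"] \<open>H > 0\<close> by simp
    then show False using g(6) by simp
  qed
  have strict: "F s < F t" if st: "- H / 2 \<le> s" "s < t" "t \<le> H / 2" "F s < F (H / 2)" "- F (H / 2) < F t" for s t
  proof (rule ccontr)
    assume "\<not> F s < F t"
    then have eq: "F s = F t" using mono[of s t] st by simp
    have const: "F w = F s" if "s \<le> w" "w \<le> t" for w
    proof -
      have "F s \<le> F w" "F w \<le> F t" by (rule mono; use st(1,3) that in linarith)+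
      then show ?thesis using eq by linarith
    qed
    define u where "u = (s + t) / 2"
    have u: "s < u" "u < t" using st by (auto simp: u_def)
    have "F u = F w" if "\<bar>u - w\<bar> < (t - s) / 2" for w
    proof -
      have "u - w < (t - s) / 2" "- (u - w) < (t - s) / 2" using that unfolding abs_less_iff by blast+
      then have "s \<le> w" "w \<le> t" unfolding u_def by (simp_all add: field_simps)
      then show ?thesis using const[of w] const[of u] u by simp
    qed
    then have gu: "g (u + H / 2) = 0" using DERIV_local_const[OF dF[of u], of "(t - s) / 2"] st(2) by simp
    show False
    proof (cases "u \<le> 0")
      case True
      have "g (w + H / 2) = 0" if "- (H / 2) \<le> w" "w \<le> u" for w
      proof -
        have "g (w + H / 2) \<le> g (u + H / 2)" by (rule g(5)) (use that True \<open>H > 0\<close> in auto)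
        moreover have "0 \<le> g (w + H / 2)" by (rule nonneg) (use that True \<open>H > 0\<close> in auto)
        ultimately show ?thesis using gu by linarith
      qed
      then have "F (- (H / 2)) = F u" using st u by (intro constant_on_of_deriv_zero[OF dF]) auto
      then show False using const[of u] u F_neg st eq by simp
    next
      case False
      have "g (w + H / 2) = 0" if "u \<le> w" "w \<le> H / 2" for w
      proof -
        have "g (H / 2 - w) \<le> g (H / 2 - u)" by (rule g(5)) (use that False \<open>H > 0\<close> in auto)
        moreover have "0 \<le> g (w + H / 2)" by (rule nonneg) (use that False \<open>H > 0\<close> in auto)
        moreover have "g (H / 2 - w) = g (w + H / 2)" "g (H / 2 - u) = g (u + H / 2)"
          using g(7)[of w] g(7)[of u] by (simp_all add: add.commute)
        ultimately show ?thesis using gu by linarith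
      qed
      then have "F u = F (H / 2)" using st u by (intro constant_on_of_deriv_zero[OF dF]) auto
      then show False using const[of u] u st by simp
    qed
  qed
  have "continuous_on UNIV F" using dF by (meson DERIV_continuous continuous_at_imp_continuous_on)
  then show ?thesis unfolding strict_wave_def wave_def
    using \<open>H > 0\<close> anti odd mono pos strict by blast
qed

lemma wave_scale:
  assumes "wave T \<phi>" "\<rho> > 0" "C > 0"
  shows "wave (\<rho> * T) (\<lambda>w. C * \<phi> (w / \<rho>))"
proof -
  note w = waveD[OF assms(1)]
  have "(t + \<rho> * T) / \<rho> = t / \<rho> + T" for t using assms(2) by (simp add: field_simps)
  moreover have "(\<rho> * T) / 2 / \<rho> = T / 2" using assms(2) by simp
  moreover have "continuous_on UNIV (\<lambda>w. C * \<phi> (w / \<rho>))"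
    using assms(2) by (intro continuous_intros continuous_on_compose2[OF w(4)]) auto
  moreover have "\<phi> (s / \<rho>) \<le> \<phi> (t / \<rho>)" if "- (\<rho> * T) / 2 \<le> s" "s \<le> t" "t \<le> \<rho> * T / 2" for s t
    using that assms(2) by (intro w(5)) (auto simp: field_simps)
  ultimately show ?thesis unfolding wave_def using assms w by auto
qed

lemma strict_wave_scale:
  assumes "strict_wave T \<phi>" "\<rho> > 0" "C > 0"
  shows "strict_wave (\<rho> * T) (\<lambda>w. C * \<phi> (w / \<rho>))"
  unfolding strict_wave_def
proof (intro conjI allI impI)
  show "wave (\<rho> * T) (\<lambda>w. C * \<phi> (w / \<rho>))"
    using assms wave_scale unfolding strict_wave_def by blast
  have e: "(\<rho> * T) / 2 / \<rho> = T / 2" using assms(2) by simp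
  fix s t assume st: "- (\<rho> * T) / 2 \<le> s" "s < t" "t \<le> \<rho> * T / 2"
     "C * \<phi> (s / \<rho>) < C * \<phi> (\<rho> * T / 2 / \<rho>)" "- (C * \<phi> (\<rho> * T / 2 / \<rho>)) < C * \<phi> (t / \<rho>)"
  have "- T / 2 \<le> s / \<rho>" "s / \<rho> < t / \<rho>" "t / \<rho> \<le> T / 2" using st(1-3) assms(2) by (simp_all add: field_simps)
  moreover have "\<phi> (s / \<rho>) < \<phi> (T / 2)" using st(4) assms(3) unfolding e by simp
  moreover have "C * (- \<phi> (T / 2)) < C * \<phi> (t / \<rho>)" using st(5) unfolding e by simp
  then have "- \<phi> (T / 2) < \<phi> (t / \<rho>)" using assms(3) by (simp only: mult_less_cancel_left_pos)
  ultimately have "\<phi> (s / \<rho>) < \<phi> (t / \<rho>)" using assms(1) unfolding strict_wave_def by blast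
  then show "C * \<phi> (s / \<rho>) < C * \<phi> (t / \<rho>)" using assms(3) by simp
qed

section \<open>The periodic integrals of the trapezoidal wave\<close>

lemma psi1_ge0:
  assumes "a1 \<ge> 0" "a2 \<ge> 0" "0 \<le> t" "t \<le> a1 + a2 + 2"
  shows "psi1 a1 a2 t = psi1_base a1 a2 t"
proof -
  have "\<lfloor>t / (2 * (a1 + a2 + 2))\<rfloor> = 0" using assms by (simp add: floor_eq_iff field_simps)
  then show ?thesis using assms by (simp add: psi1_def Let_def)
qed

lemma psi1_antiperiodic:
  assumes "a1 \<ge> 0" "a2 \<ge> 0"
  shows "psi1 a1 a2 (t + (a1 + a2 + 2)) = - psi1 a1 a2 t"
proof -
  define T where "T = a1 + a2 + 2"
  have T: "T > 0" using assms by (simp add: T_def)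
  have base: "psi1_base a1 a2 0 = 0" "psi1_base a1 a2 T = 0" using assms by (auto simp: psi1_base_def T_def)
  define n where "n = \<lfloor>t / (2 * T)\<rfloor>"
  define s where "s = t - 2 * T * of_int n"
  have "of_int n \<le> t / (2 * T)" "t / (2 * T) < of_int n + 1" unfolding n_def by linarith+
  then have s: "0 \<le> s" "s < 2 * T" using T by (simp_all add: s_def field_simps)
  have val: "psi1 a1 a2 t = (if s \<le> T then psi1_base a1 a2 s else - psi1_base a1 a2 (s - T))"
    by (simp add: psi1_def Let_def s_def n_def T_def)
  show ?thesis
  proof (cases "s < T")
    case True
    have "\<lfloor>(t + T) / (2 * T)\<rfloor> = n"
      using s True T by (simp add: floor_eq_iff s_def field_simps)
    then have "psi1 a1 a2 (t + T) = (if s + T \<le> T then psi1_base a1 a2 (s + T) else - psi1_base a1 a2 s)"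
      by (simp add: psi1_def Let_def s_def flip: T_def) (simp add: algebra_simps)
    then show ?thesis using True s(1) val base by (auto simp: T_def[symmetric])
  next
    case False
    have "\<lfloor>(t + T) / (2 * T)\<rfloor> = n + 1"
      using s False T by (simp add: floor_eq_iff s_def field_simps)
    then have "psi1 a1 a2 (t + T) = (if s - T \<le> T then psi1_base a1 a2 (s - T) else - psi1_base a1 a2 (s - T - T))"
      by (simp add: psi1_def Let_def s_def flip: T_def) (simp add: algebra_simps)
    then show ?thesis using False s val base by (auto simp: T_def[symmetric] not_less dest: antisym)
  qed
qed

text \<open>\<open>psi n\<close> recentred so that it is odd and increases on \<open>[-T/2, T/2]\<close>, where \<open>T = a1 + a2 + 2\<close>.\<close>

definition psi_centered :: "nat \<Rightarrow> real \<Rightarrow> real \<Rightarrow> real \<Rightarrow> real" where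
  "psi_centered n a1 a2 w = psi n a1 a2 (a1 / 2 + (real n - 1) * ((a1 + a2 + 2) / 2) + w)"

text \<open>The zero plateau of length \<open>a1\<close> is centred at the origin, and the two
  clamps are the ramps on either side of it. Left of \<open>- a1 / 2\<close> antiperiodicity leads
  back to the defining piece.\<close>

lemma psi_centered_1:
  assumes "a1 \<ge> 0" "a2 \<ge> 0" "- (a1 + a2 + 2) / 2 \<le> w" "w \<le> (a1 + a2 + 2) / 2"
  shows "psi_centered 1 a1 a2 w = max 0 (min 1 (w - a1 / 2)) - max 0 (min 1 (- w - a1 / 2))"
proof -
  have p: "psi_centered 1 a1 a2 w = psi1 a1 a2 (a1 / 2 + w)" by (simp add: psi_centered_def psi_def)
  show ?thesis
  proof (cases "0 \<le> a1 / 2 + w")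
    case True
    then have "psi1 a1 a2 (a1 / 2 + w) = psi1_base a1 a2 (a1 / 2 + w)"
      using assms by (intro psi1_ge0) (auto simp: field_simps)
    then show ?thesis unfolding p using assms True by (auto simp: psi1_base_def max_def min_def field_simps)
  next
    case False
    have "psi1 a1 a2 (a1 / 2 + w) = - psi1 a1 a2 (a1 / 2 + w + (a1 + a2 + 2))"
      using psi1_antiperiodic[OF assms(1,2), of "a1 / 2 + w"] by simp
    also have "psi1 a1 a2 (a1 / 2 + w + (a1 + a2 + 2)) = psi1_base a1 a2 (a1 / 2 + w + (a1 + a2 + 2))"
      using assms False by (intro psi1_ge0) (auto simp: field_simps)
    finally show ?thesis unfolding p using assms False by (auto simp: psi1_base_def max_def min_def field_simps)
  qed
qed

lemma psi_Suc: "n \<ge> 1 \<Longrightarrow> psi (Suc n) a1 a2 = periodic_integral (2 * (a1 + a2 + 2)) (psi n a1 a2)"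
  by (cases n) (auto simp: psi_def)

lemma wave_psi_centered_1:
  assumes "a1 \<ge> 0" "a2 \<ge> 0"
  shows "wave (a1 + a2 + 2) (psi_centered 1 a1 a2)"
proof (rule waveI)
  let ?T = "a1 + a2 + 2"
  let ?f = "\<lambda>w. max 0 (min 1 (w - a1 / 2)) - max 0 (min 1 (- w - a1 / 2)) :: real"
  have eq: "psi_centered 1 a1 a2 w = ?f w" if "w \<in> {- ?T / 2..?T / 2}" for w
    using psi_centered_1[OF assms] that by auto
  show "?T > 0" using assms by simp
  show "psi_centered 1 a1 a2 (t + ?T) = - psi_centered 1 a1 a2 t" for t
    using psi1_antiperiodic[OF assms, of "a1 / 2 + t"] by (simp add: psi_centered_def psi_def add_ac)
  have "continuous_on {- ?T / 2..?T / 2} ?f" by (intro continuous_intros)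
  then show "continuous_on {- ?T / 2..?T / 2} (psi_centered 1 a1 a2)"
    by (rule continuous_on_eq) (rule eq[symmetric])
  show "psi_centered 1 a1 a2 (- t) = - psi_centered 1 a1 a2 t" if "\<bar>t\<bar> \<le> ?T / 2" for t
  proof -
    have "t \<in> {- ?T / 2..?T / 2}" "- t \<in> {- ?T / 2..?T / 2}" using that by (auto simp: abs_le_iff)
    then show ?thesis by (simp only: eq)
  qed
  show "psi_centered 1 a1 a2 s \<le> psi_centered 1 a1 a2 t" if "- ?T / 2 \<le> s" "s \<le> t" "t \<le> ?T / 2" for s t
  proof -
    have "s \<in> {- ?T / 2..?T / 2}" "t \<in> {- ?T / 2..?T / 2}" using that by auto
    moreover have "max 0 (min 1 (s - a1 / 2)) \<le> max 0 (min 1 (t - a1 / 2))"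
      "max 0 (min 1 (- t - a1 / 2)) \<le> max 0 (min 1 (- s - a1 / 2))"
      using that(2) by (auto simp: max_def min_def)
    then have "?f s \<le> ?f t" by linarith
    ultimately show ?thesis by (simp only: eq)
  qed
  have "?T / 2 \<in> {- ?T / 2..?T / 2}" using assms by auto
  then have "psi_centered 1 a1 a2 (?T / 2) = ?f (?T / 2)" by (rule eq)
  also have "\<dots> = 1"
  proof -
    have *: "1 \<le> ?T / 2 - a1 / 2" "- (?T / 2) - a1 / 2 \<le> 0" using assms by (simp_all add: field_simps)
    have "min 1 (?T / 2 - a1 / 2) = 1" "max 0 (min 1 (- (?T / 2) - a1 / 2)) = 0"
      by (rule min_absorb1[OF *(1)], rule max_absorb1[OF min.coboundedI2[OF *(2)]])
    then show ?thesis by simp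
  qed
  finally show "0 < psi_centered 1 a1 a2 (?T / 2)" by simp
qed

lemma psi_of_centered:
  "psi n a1 a2 t = psi_centered n a1 a2 (t - (a1 / 2 + (real n - 1) * ((a1 + a2 + 2) / 2)))"
  by (simp add: psi_centered_def)

text \<open>A primitive rises fastest where its derivative is largest, and there it passes through
  0: this is a quarter period after the zero of the rising branch of the derivative, whence the
  shift \<open>(a1 + a2 + 2) / 2\<close>.\<close>

lemma psi_centered_Suc:
  assumes "a1 \<ge> 0" "a2 \<ge> 0" "n \<ge> 1" and w: "wave (a1 + a2 + 2) (psi_centered n a1 a2)"
  shows "(psi (Suc n) a1 a2 has_real_derivative psi n a1 a2 t) (at t)"
    and "(psi_centered (Suc n) a1 a2 has_real_derivative psi_centered n a1 a2 (t + (a1 + a2 + 2) / 2)) (at t)"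
    and "strict_wave (a1 + a2 + 2) (psi_centered (Suc n) a1 a2)"
proof -
  let ?T = "a1 + a2 + 2" and ?c = "\<lambda>n. a1 / 2 + (real n - 1) * ((a1 + a2 + 2) / 2)"
  note w' = waveD[OF w]
  have cont: "continuous_on UNIV (psi n a1 a2)"
    unfolding psi_of_centered[abs_def] by (intro continuous_on_compose2[OF w'(4)] continuous_intros) auto
  have anti: "psi n a1 a2 (t + ?T) = - psi n a1 a2 t" for t
    unfolding psi_of_centered[of n a1 a2] using w'(2)[of "t - ?c n"] by (simp add: algebra_simps)
  show d: "(psi (Suc n) a1 a2 has_real_derivative psi n a1 a2 t) (at t)" for t
    unfolding psi_Suc[OF \<open>n \<ge> 1\<close>] by (rule periodic_integral_has_derivative[OF cont])
  have anti': "psi (Suc n) a1 a2 (t + ?T) = - psi (Suc n) a1 a2 t" for t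
    unfolding psi_Suc[OF \<open>n \<ge> 1\<close>] by (rule periodic_integral_antiperiodic[where f = "psi n a1 a2", OF w'(1) cont anti])
  have cc: "psi_centered (Suc n) a1 a2 = (\<lambda>w. psi (Suc n) a1 a2 (?c (Suc n) + w))"
    by (auto simp: psi_centered_def)
  show d': "(psi_centered (Suc n) a1 a2 has_real_derivative psi_centered n a1 a2 (t + ?T / 2)) (at t)" for t
  proof -
    have "?c (Suc n) + t = ?c n + (t + ?T / 2)" by (simp add: field_simps)
    then have "psi n a1 a2 (?c (Suc n) + t) = psi_centered n a1 a2 (t + ?T / 2)" by (simp only: psi_centered_def)
    moreover have "((\<lambda>w. psi (Suc n) a1 a2 (?c (Suc n) + w)) has_real_derivative psi n a1 a2 (?c (Suc n) + t) * 1) (at t)"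
      by (rule DERIV_chain2[where f = "psi (Suc n) a1 a2" and g = "\<lambda>w. ?c (Suc n) + w", OF d]) (auto intro!: derivative_eq_intros)
    ultimately show ?thesis unfolding cc by simp
  qed
  show "strict_wave ?T (psi_centered (Suc n) a1 a2)"
  proof (rule strict_wave_primitive[OF w d'])
    show "psi_centered (Suc n) a1 a2 (t + ?T) = - psi_centered (Suc n) a1 a2 t" for t
      using anti'[of "?c (Suc n) + t"] by (simp only: psi_centered_def add.assoc)
  qed
qed

lemma wave_psi_centered:
  assumes "a1 \<ge> 0" "a2 \<ge> 0" "n \<ge> 1"
  shows "wave (a1 + a2 + 2) (psi_centered n a1 a2)"
  using \<open>n \<ge> 1\<close>
proof (induction n rule: dec_induct)
  case base
  then show ?case using wave_psi_centered_1[OF assms(1,2)] by simp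
next
  case (step n)
  then show ?case using psi_centered_Suc(3)[OF assms(1,2) step(1) step(3)] by (simp add: strict_wave_def)
qed

text \<open>Integration removes a plateau at height 0, so strictness is automatic from order 2 on.
  At order 1 this plateau has length \<open>a1\<close> and must be absent.\<close>

lemma strict_wave_psi_centered:
  assumes "a1 \<ge> 0" "a2 \<ge> 0" "n \<ge> 2 \<or> n = 1 \<and> a1 = 0"
  shows "strict_wave (a1 + a2 + 2) (psi_centered n a1 a2)"
  using assms(3)
proof
  assume "n \<ge> 2"
  then obtain m where "n = Suc m" "m \<ge> 1" by (cases n) auto
  then show ?thesis using psi_centered_Suc(3)[OF assms(1,2)] wave_psi_centered[OF assms(1,2)] by auto
next
  assume n: "n = 1 \<and> a1 = 0"
  have "psi_centered 1 0 a2 s < psi_centered 1 0 a2 t"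
    if st: "- (0 + a2 + 2) / 2 \<le> s" "s < t" "t \<le> (0 + a2 + 2) / 2"
      "psi_centered 1 0 a2 s < psi_centered 1 0 a2 ((0 + a2 + 2) / 2)"
      "- psi_centered 1 0 a2 ((0 + a2 + 2) / 2) < psi_centered 1 0 a2 t" for s t
  proof -
    have top: "psi_centered 1 0 a2 ((0 + a2 + 2) / 2) = 1"
      using psi_centered_1[of 0 a2 "(0 + a2 + 2) / 2"] assms(2) by (auto simp: max_def min_def)
    have clamp: "psi_centered 1 0 a2 u = max (- 1) (min 1 u)" if "u = s \<or> u = t" for u
    proof -
      have "psi_centered 1 0 a2 u = max 0 (min 1 (u - 0 / 2)) - max 0 (min 1 (- u - 0 / 2))"
        by (rule psi_centered_1) (use st(1-3) that assms(2) in auto)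
      then show ?thesis by (auto simp: max_def min_def)
    qed
    have "max (- 1) (min 1 s) < (1::real)" "- 1 < max (- 1) (min 1 t)"
      using st(4,5) clamp unfolding top by auto
    then have "max (- 1) (min 1 s) < max (- 1) (min 1 t)" using st(2) by auto
    then show ?thesis using clamp by simp
  qed
  then show ?thesis using n wave_psi_centered_1[OF assms(1,2)] unfolding strict_wave_def by auto
qed

text \<open>With \<open>B = \<bar>b\<bar>\<close> and
  \<open>\<rho> = \<lambda> / (2 * (a1 + a2 + 2))\<close> this is \<open>Psi\<close> of order
  \<open>n\<close> and period \<lambda>, up to sign and translation. The factor
  \<open>\<rho> ^ n\<close> keeps the family closed under differentiation for fixed \<open>B\<close>
  and \<rho>.\<close>

definition comparison_wave :: "real \<Rightarrow> real \<Rightarrow> real \<Rightarrow> real \<Rightarrow> nat \<Rightarrow> real \<Rightarrow> real" where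
  "comparison_wave a1 a2 B \<rho> n w = B * \<rho> ^ n * psi_centered n a1 a2 (w / \<rho>)"

lemma comparison_wave_scaled: "comparison_wave a1 a2 B \<rho> n = (\<lambda>w. (B * \<rho> ^ n) * psi_centered n a1 a2 (w / \<rho>))"
  by (auto simp: comparison_wave_def)

context
  fixes a1 a2 B \<rho> :: real
  assumes a: "a1 \<ge> 0" "a2 \<ge> 0" and B: "B > 0" and \<rho>: "\<rho> > 0"
begin

private abbreviation "H \<equiv> \<rho> * (a1 + a2 + 2)"
private abbreviation "G \<equiv> comparison_wave a1 a2 B \<rho>"

lemma wave_comparison: "n \<ge> 1 \<Longrightarrow> wave H (G n)"
  unfolding comparison_wave_scaled using a B \<rho> by (intro wave_scale wave_psi_centered) auto

lemma strict_wave_comparison: "n \<ge> 2 \<or> n = 1 \<and> a1 = 0 \<Longrightarrow> strict_wave H (G n)"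
  unfolding comparison_wave_scaled using a B \<rho> by (intro strict_wave_scale strict_wave_psi_centered) auto

lemma comparison_wave_deriv:
  assumes "n \<ge> 1"
  shows "(G (Suc n) has_real_derivative G n (t + H / 2)) (at t)"
proof -
  have "((\<lambda>w. psi_centered (Suc n) a1 a2 (w / \<rho>)) has_real_derivative
      psi_centered n a1 a2 (t / \<rho> + (a1 + a2 + 2) / 2) * (1 / \<rho>)) (at t)"
    using \<rho> by (intro DERIV_chain2[OF psi_centered_Suc(2)[OF a assms wave_psi_centered[OF a assms]]])
      (auto intro!: derivative_eq_intros)
  from DERIV_cmult[OF this, of "B * \<rho> ^ Suc n"]
  have "(G (Suc n) has_real_derivative B * \<rho> ^ n * psi_centered n a1 a2 (t / \<rho> + (a1 + a2 + 2) / 2)) (at t)"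
    unfolding comparison_wave_scaled using \<rho> by (simp add: mult_ac)
  moreover have "t / \<rho> + (a1 + a2 + 2) / 2 = (t + H / 2) / \<rho>" using \<rho> by (simp add: field_simps)
  ultimately show ?thesis by (simp add: comparison_wave_def)
qed

lemma comparison_wave_1:
  assumes "- H / 2 \<le> w" "w \<le> H / 2"
  shows "G 1 w = B * (max 0 (min \<rho> (w - \<rho> * a1 / 2)) - max 0 (min \<rho> (- w - \<rho> * a1 / 2)))"
proof -
  have pull: "\<rho> * max 0 (min 1 z) = max 0 (min \<rho> (\<rho> * z))" for z
    using \<rho> by (auto simp: max_def min_def zero_le_mult_iff mult_le_cancel_left1)
  have "- (a1 + a2 + 2) / 2 \<le> w / \<rho>" "w / \<rho> \<le> (a1 + a2 + 2) / 2" using assms \<rho> by (simp_all add: field_simps)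
  note p = psi_centered_1[OF a this]
  have "G 1 w = B * (\<rho> * psi_centered 1 a1 a2 (w / \<rho>))" by (simp add: comparison_wave_def)
  then have "G 1 w = B * (\<rho> * max 0 (min 1 (w / \<rho> - a1 / 2)) - \<rho> * max 0 (min 1 (- (w / \<rho>) - a1 / 2)))"
    by (simp only: p right_diff_distrib)
  moreover have "\<rho> * (w / \<rho> - a1 / 2) = w - \<rho> * a1 / 2" "\<rho> * (- (w / \<rho>) - a1 / 2) = - w - \<rho> * a1 / 2"
    using \<rho> by (simp_all add: field_simps)
  ultimately show ?thesis by (simp only: pull)
qed

lemma comparison_wave_1_top: "G 1 (H / 2) = B * \<rho>"
proof -
  have "0 \<le> \<rho> * a2" "0 \<le> \<rho> * a1" using a \<rho> by auto
  moreover have "H / 2 - \<rho> * a1 / 2 = \<rho> * a2 / 2 + \<rho>" "- (H / 2) - \<rho> * a1 / 2 = - (\<rho> * a1) - \<rho> * a2 / 2 - \<rho>"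
    by (simp_all add: field_simps)
  ultimately have *: "min \<rho> (H / 2 - \<rho> * a1 / 2) = \<rho>" "max 0 (min \<rho> (- (H / 2) - \<rho> * a1 / 2)) = 0" "max 0 \<rho> = \<rho>"
    using \<rho> by (simp_all add: min_def max_def)
  have "- H / 2 \<le> H / 2" using a \<rho> by simp
  from comparison_wave_1[OF this order_refl] show ?thesis by (simp only: * diff_0_right)
qed

text \<open>The positive arch of the order 1 wave seen from the middle of its top, about which it is
  even: a trapezoid whose top has half-width \<open>\<rho> * a2 / 2\<close>. It is the derivative of
  the order 2 wave.\<close>

lemma comparison_wave_1_shift:
  assumes "\<bar>w\<bar> \<le> H / 2"
  shows "G 1 (w + H / 2) = B * max 0 (min \<rho> (\<rho> * (a2 / 2 + 1) - \<bar>w\<bar>))"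
proof -
  note w = waveD[OF wave_comparison[OF order_refl]]
  have "G 1 (w + H / 2) = G 1 (H / 2 - \<bar>w\<bar>)"
    using w(7)[of "\<bar>w\<bar>"] by (cases "w \<ge> 0") (auto simp: add.commute)
  also have "\<dots> = B * max 0 (min \<rho> (\<rho> * (a2 / 2 + 1) - \<bar>w\<bar>))"
  proof -
    have "0 \<le> \<rho> * a1" using a \<rho> by simp
    then have "max 0 (min \<rho> (- (H / 2 - \<bar>w\<bar>) - \<rho> * a1 / 2)) = 0" using assms by (auto simp: max_def min_def)
    moreover have "H / 2 - \<bar>w\<bar> - \<rho> * a1 / 2 = \<rho> * (a2 / 2 + 1) - \<bar>w\<bar>" by (simp add: algebra_simps add_divide_distrib)
    moreover have "- H / 2 \<le> H / 2 - \<bar>w\<bar>" "H / 2 - \<bar>w\<bar> \<le> H / 2" using assms by auto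
    from comparison_wave_1[OF this] have "G 1 (H / 2 - \<bar>w\<bar>) =
      B * (max 0 (min \<rho> (H / 2 - \<bar>w\<bar> - \<rho> * a1 / 2)) - max 0 (min \<rho> (- (H / 2 - \<bar>w\<bar>) - \<rho> * a1 / 2)))" .
    ultimately show ?thesis by (simp only: diff_0_right)
  qed
  finally show ?thesis .
qed

text \<open>For \<open>a1 = 0\<close> the rising branch is a line of slope \<open>B\<close> cut off
  at heights \<open>- B * \<rho>\<close> and \<open>B * \<rho>\<close>, so away from the extreme
  values its slope equals the Lipschitz constant of \<open>y\<close>.\<close>

lemma crossing_free_comparison_1:
  assumes "a1 = 0" and y: "\<And>t. \<bar>y t\<bar> \<le> G 1 (H / 2)" "\<And>s t. \<bar>y t - y s\<bar> \<le> B * \<bar>t - s\<bar>"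
  shows "crossing_free H (G 1) y"
proof (rule crossing_free_level1[OF _ _ y])
  note w = waveD[OF wave_comparison[OF order_refl]]
  show "\<bar>G 1 s\<bar> \<le> G 1 (H / 2)" for s using w(11) .
  fix s t assume st: "- H / 2 \<le> s" "s < t" "t \<le> H / 2" "- G 1 (H / 2) < G 1 s" "G 1 t < G 1 (H / 2)"
  have G1: "G 1 w = B * (max 0 (min \<rho> w) - max 0 (min \<rho> (- w)))" if "- H / 2 \<le> w" "w \<le> H / 2" for w
    using comparison_wave_1[OF that] by (simp only: \<open>a1 = 0\<close> mult_zero_right div_0 diff_0_right)
  have "s \<le> H / 2" "- H / 2 \<le> t" using st(1-3) by linarith+
  note s = G1[OF st(1) this(1)] and t = G1[OF this(2) st(3)]
  have "B * (- \<rho>) < B * (max 0 (min \<rho> s) - max 0 (min \<rho> (- s)))"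
    "B * (max 0 (min \<rho> t) - max 0 (min \<rho> (- t))) < B * \<rho>"
    using st(4,5) unfolding comparison_wave_1_top s t by (simp_all only: mult_minus_right)
  then have "- \<rho> < max 0 (min \<rho> s) - max 0 (min \<rho> (- s))" "max 0 (min \<rho> t) - max 0 (min \<rho> (- t)) < \<rho>"
    using B by (simp_all only: mult_less_cancel_left_pos)
  then have "- \<rho> < s" "t < \<rho>" using \<rho> by linarith+
  then have "max 0 (min \<rho> s) - max 0 (min \<rho> (- s)) = s" "max 0 (min \<rho> t) - max 0 (min \<rho> (- t)) = t"
    using \<open>s < t\<close> \<rho> by (auto simp: max_def min_def)
  then have "G 1 s = B * s" "G 1 t = B * t" unfolding s t by simp_all
  then show "B * (t - s) \<le> G 1 t - G 1 s" by (simp only: right_diff_distrib)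
qed

text \<open>\<open>\<rho> * (a2 / 2)\<close> and \<open>\<rho> * (a2 / 2 + 1)\<close> are the
  half-widths of the top and of the base of the trapezoidal arch that is the derivative of
  \<open>G 2\<close>. On the sides of the arch its slope competes with the Lipschitz constant of
  \<open>z\<close>; over the top, which is a point for \<open>a2 = 0\<close>, the bound on
  \<open>z\<close> takes over.\<close>

lemma crossing_free_comparison_2:
  assumes dy: "\<And>t. (y has_real_derivative z t) (at t)"
    and y: "\<And>t. \<bar>y t\<bar> \<le> G 2 (H / 2)" and z: "\<And>s t. \<bar>z t - z s\<bar> \<le> B * \<bar>t - s\<bar>"
    and plateau: "a2 = 0 \<or> (\<forall>t. \<bar>z t\<bar> \<le> G 1 (H / 2))"
  shows "crossing_free H (G 2) y"
proof (rule crossing_free_level2[where ?h0.0 = "\<rho> * (a2 / 2)" and ?h1.0 = "\<rho> * (a2 / 2 + 1)" and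
      E = "\<lambda>w. G 1 (w + H / 2)" and M = "G 2 (H / 2)", OF _ _ _ _ _ _ _ _ dy y z])
  let ?h0 = "\<rho> * (a2 / 2)" and ?h1 = "\<rho> * (a2 / 2 + 1)"
  have "2 \<ge> (1::nat)" by simp
  note w2 = waveD[OF wave_comparison[OF this]]
  have h: "0 \<le> ?h0" "?h1 = ?h0 + \<rho>" "?h1 \<le> H / 2" using a \<rho> by (auto simp: algebra_simps)
  show "0 \<le> ?h0" "?h0 \<le> ?h1" "?h1 \<le> H / 2" using h \<rho> by auto
  have d: "(G 2 has_real_derivative G 1 (t + H / 2)) (at t)" for t
    using comparison_wave_deriv[of 1 t] by (simp add: numeral_2_eq_2)
  then show "(G 2 has_real_derivative G 1 (t + H / 2)) (at t)" for t .
  have E: "G 1 (w + H / 2) = B * max 0 (min \<rho> (?h1 - \<bar>w\<bar>))" if "\<bar>w\<bar> \<le> H / 2" for w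
    using comparison_wave_1_shift[OF that] .
  show "G 2 s = - G 2 (H / 2)" if "- H / 2 \<le> s" "s \<le> - ?h1" for s
  proof -
    have "G 2 (- (H / 2)) = G 2 s"
    proof (rule constant_on_of_deriv_zero[OF d])
      fix u assume u: "- (H / 2) \<le> u" "u \<le> s"
      then have "\<bar>u\<bar> \<le> H / 2" "?h1 - \<bar>u\<bar> \<le> 0" using that h \<rho> by auto
      then show "G 1 (u + H / 2) = 0" using E by (simp add: max_def min_def)
    qed (use that in simp)
    then show ?thesis using w2(10) by simp
  qed
  show "G 2 s = G 2 (H / 2)" if "?h1 \<le> s" "s \<le> H / 2" for s
  proof (rule constant_on_of_deriv_zero[OF d])
    fix u assume u: "s \<le> u" "u \<le> H / 2"
    then have "\<bar>u\<bar> \<le> H / 2" "?h1 - \<bar>u\<bar> \<le> 0" using that h \<rho> by auto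
    then show "G 1 (u + H / 2) = 0" using E by (simp add: max_def min_def)
  qed (use that in simp)
  show "B * (t - s) \<le> G 1 (t + H / 2) - G 1 (s + H / 2)" if "- ?h1 \<le> s" "s \<le> t" "t \<le> - ?h0" for s t
  proof -
    have "\<bar>s\<bar> \<le> H / 2" "\<bar>t\<bar> \<le> H / 2" "0 \<le> ?h1 - \<bar>s\<bar>" "?h1 - \<bar>s\<bar> \<le> \<rho>" "0 \<le> ?h1 - \<bar>t\<bar>" "?h1 - \<bar>t\<bar> \<le> \<rho>" "\<bar>s\<bar> = - s" "\<bar>t\<bar> = - t"
      using that h \<rho> by auto
    note b = this
    have "G 1 (s + H / 2) = B * (?h1 + s)" "G 1 (t + H / 2) = B * (?h1 + t)"
      using E[OF b(1)] E[OF b(2)] by (simp_all only: max_absorb2[OF b(3)] min_absorb2[OF b(4)] max_absorb2[OF b(5)] min_absorb2[OF b(6)])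
        (simp_all only: b(7,8) diff_minus_eq_add)
    then show ?thesis by (simp only: right_diff_distrib distrib_left)
  qed
  show "B * (t - s) \<le> G 1 (s + H / 2) - G 1 (t + H / 2)" if "?h0 \<le> s" "s \<le> t" "t \<le> ?h1" for s t
  proof -
    have "\<bar>s\<bar> \<le> H / 2" "\<bar>t\<bar> \<le> H / 2" "0 \<le> ?h1 - \<bar>s\<bar>" "?h1 - \<bar>s\<bar> \<le> \<rho>" "0 \<le> ?h1 - \<bar>t\<bar>" "?h1 - \<bar>t\<bar> \<le> \<rho>" "\<bar>s\<bar> = s" "\<bar>t\<bar> = t"
      using that h \<rho> by auto
    note b = this
    have "G 1 (s + H / 2) = B * (?h1 - s)" "G 1 (t + H / 2) = B * (?h1 - t)"
      using E[OF b(1)] E[OF b(2)] by (simp_all only: max_absorb2[OF b(3)] min_absorb2[OF b(4)] max_absorb2[OF b(5)] min_absorb2[OF b(6)])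
        (simp_all only: b(7,8))
    then show ?thesis by (simp only: right_diff_distrib)
  qed
  show "\<bar>z t\<bar> \<le> G 1 (s + H / 2)" if "- ?h0 < s" "s < ?h0" for s t
  proof -
    have "a2 \<noteq> 0" using that by auto
    moreover have "\<bar>s\<bar> \<le> H / 2" "?h1 - \<bar>s\<bar> \<ge> \<rho>" using that h \<rho> by auto
    then have "G 1 (s + H / 2) = B * \<rho>" using E[of s] \<rho> by (simp add: max_def min_def)
    ultimately show ?thesis using plateau comparison_wave_1_top by auto
  qed
qed

end

section \<open>Excess integrals between zeros\<close>

lemma nn_integral_layer_cake:
  fixes F :: "real \<Rightarrow> real"
  assumes [measurable]: "F \<in> borel_measurable borel"
  shows "(\<integral>\<^sup>+x. ennreal (F x) \<partial>lborel) = (\<integral>\<^sup>+y. indicator {0..} y * emeasure lborel {x. F x > y} \<partial>lborel)"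
proof -
  have inner: "ennreal (F x) = (\<integral>\<^sup>+y. indicator {(x, y). 0 \<le> y \<and> y < F x} (x, y) \<partial>lborel)" for x
  proof -
    have "(\<integral>\<^sup>+y. indicator {(x, y). 0 \<le> y \<and> y < F x} (x, y) \<partial>lborel) = (\<integral>\<^sup>+y. indicator {0..<F x} y \<partial>lborel)"
      by (intro nn_integral_cong) (auto simp: indicator_def)
    also have "\<dots> = ennreal (F x)" by (cases "0 \<le> F x") (auto simp: ennreal_neg)
    finally show ?thesis by simp
  qed
  have m: "(\<lambda>p. indicator {(x, y). 0 \<le> y \<and> y < F x} p :: ennreal) \<in> borel_measurable (lborel \<Otimes>\<^sub>M lborel)"
  proof (rule borel_measurable_indicator)
    have "{p \<in> space (lborel \<Otimes>\<^sub>M lborel). 0 \<le> snd p \<and> snd p < F (fst p)} \<in> sets (lborel \<Otimes>\<^sub>M lborel)" by measurable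
    moreover have "{p \<in> space (lborel \<Otimes>\<^sub>M lborel). 0 \<le> snd p \<and> snd p < F (fst p)} = {(x, y). 0 \<le> y \<and> y < F x}"
      by (auto simp: space_pair_measure)
    ultimately show "{(x, y). 0 \<le> y \<and> y < F x} \<in> sets (lborel \<Otimes>\<^sub>M lborel)" by simp
  qed
  have "(\<integral>\<^sup>+x. ennreal (F x) \<partial>lborel) =
      (\<integral>\<^sup>+x. (\<integral>\<^sup>+y. indicator {(x, y). 0 \<le> y \<and> y < F x} (x, y) \<partial>lborel) \<partial>lborel)"
    using inner by simp
  also have "\<dots> = (\<integral>\<^sup>+y. (\<integral>\<^sup>+x. indicator {(x, y). 0 \<le> y \<and> y < F x} (x, y) \<partial>lborel) \<partial>lborel)"
    by (rule lborel_pair.Fubini[OF m, symmetric])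
  also have "\<dots> = (\<integral>\<^sup>+y. indicator {0..} y * emeasure lborel {x. F x > y} \<partial>lborel)"
  proof (rule nn_integral_cong)
    fix y :: real
    have "{x. F x > y} \<in> sets lborel" by simp
    moreover have "(\<integral>\<^sup>+x. indicator {(x, y). 0 \<le> y \<and> y < F x} (x, y) \<partial>lborel) =
        (\<integral>\<^sup>+x. indicator {0..} y * indicator {x. F x > y} x \<partial>lborel)"
      by (intro nn_integral_cong) (auto simp: indicator_def)
    ultimately show "(\<integral>\<^sup>+x. indicator {(x, y). 0 \<le> y \<and> y < F x} (x, y) \<partial>lborel) =
        indicator {0..} y * emeasure lborel {x. F x > y}"
      by (simp add: nn_integral_cmult)
  qed
  finally show ?thesis .
qed

text \<open>The constant \<open>C\<close> is 2 when a function is compared with one flank of a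
  symmetric bump, and 1 for equimeasurable functions.\<close>

lemma nn_integral_le_of_distribution:
  fixes F G :: "real \<Rightarrow> real"
  assumes F: "F \<in> borel_measurable borel" and G: "G \<in> borel_measurable borel"
    and le: "\<And>y. y \<ge> 0 \<Longrightarrow> emeasure lborel {x. F x > y} \<le> C * emeasure lborel {x. G x > y}"
  shows "(\<integral>\<^sup>+x. ennreal (F x) \<partial>lborel) \<le> C * (\<integral>\<^sup>+x. ennreal (G x) \<partial>lborel)"
proof -
  have m: "(\<lambda>y. indicator {0..} y * emeasure lborel {x. G x > y}) \<in> borel_measurable lborel"
  proof -
    note [measurable] = G
    have "{p \<in> space (lborel \<Otimes>\<^sub>M lborel). fst p < G (snd p)} \<in> sets (lborel \<Otimes>\<^sub>M lborel)" by measurable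
    from lborel.measurable_emeasure_Pair[OF this]
    have "(\<lambda>y. emeasure lborel {x. G x > y}) \<in> borel_measurable lborel"
      by (simp add: space_pair_measure vimage_def)
    then show ?thesis by simp
  qed
  have "(\<integral>\<^sup>+x. ennreal (F x) \<partial>lborel) \<le> (\<integral>\<^sup>+y. C * (indicator {0..} y * emeasure lborel {x. G x > y}) \<partial>lborel)"
    unfolding nn_integral_layer_cake[OF F] using le by (intro nn_integral_mono) (auto simp: indicator_def)
  also have "\<dots> = C * (\<integral>\<^sup>+x. ennreal (G x) \<partial>lborel)"
    unfolding nn_integral_layer_cake[OF G] by (rule nn_integral_cmult[OF m])
  finally show ?thesis .
qed

section \<open>Level sets of 1-Lipschitz functions and excess integrals\<close>

lemma Lipschitz1_continuous:
  fixes v :: "real \<Rightarrow> real"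
  assumes "\<And>s t. \<bar>v t - v s\<bar> \<le> \<bar>t - s\<bar>"
  shows "continuous_on A v"
  unfolding continuous_on_iff dist_real_def using assms by (meson le_less_trans)

lemma compact_sublevel:
  fixes f :: "real \<Rightarrow> real"
  assumes "continuous_on {a..b} f"
  shows "compact {s\<in>{a..b}. f s \<le> c}"
proof -
  have "closed {s\<in>{a..b}. f s \<le> c}"
    by (intro continuous_on_closed_Collect_le assms continuous_on_const) auto
  moreover have "bounded {s\<in>{a..b}. f s \<le> c}" by (rule bounded_subset[of "{a..b}"]) auto
  ultimately show ?thesis by (simp add: compact_eq_bounded_closed)
qed

text \<open>Take the last time \<open>p\<close> at which \<open>v\<close> is at most
  \<open>c\<close> and the first later time \<open>q\<close> at which it is at least
  \<open>w\<close>; the Lipschitz bound makes the climb last at least \<open>w - c\<close>.\<close>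

lemma crossing_interval:
  fixes v :: "real \<Rightarrow> real"
  assumes lip: "\<And>s t. \<bar>v t - v s\<bar> \<le> \<bar>t - s\<bar>" and "a \<le> b" "v a \<le> c" "c < w" "w \<le> v b"
  shows "\<exists>p q. a \<le> p \<and> p \<le> q \<and> q \<le> b \<and> w - c \<le> q - p \<and> (\<forall>s. p < s \<longrightarrow> s < q \<longrightarrow> c < v s \<and> v s < w)"
proof -
  have cont: "continuous_on A v" for A by (rule Lipschitz1_continuous[OF lip])
  define A where "A = {s\<in>{a..b}. v s \<le> c}"
  have "compact A" unfolding A_def
    by (rule compact_sublevel[OF cont])
  moreover have "a \<in> A" using assms by (auto simp: A_def)
  ultimately obtain p where p: "p \<in> A" "\<And>s. s \<in> A \<Longrightarrow> s \<le> p" using compact_attains_sup[of A] by auto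
  define B where "B = {s\<in>{p..b}. - v s \<le> - w}"
  have "compact B" unfolding B_def
    by (intro compact_sublevel continuous_intros cont)
  moreover have "b \<in> B" using assms p by (auto simp: B_def A_def)
  ultimately obtain q where q: "q \<in> B" "\<And>s. s \<in> B \<Longrightarrow> q \<le> s" using compact_attains_inf[of B] by auto
  show ?thesis
  proof (rule exI[of _ p], rule exI[of _ q], intro conjI allI impI)
    show "a \<le> p" "p \<le> q" "q \<le> b" using p q by (auto simp: A_def B_def)
    have "w - c \<le> v q - v p" using p q by (auto simp: A_def B_def)
    then show "w - c \<le> q - p" using lip[of q p] \<open>p \<le> q\<close> by simp
    fix s assume s: "p < s" "s < q"
    then have "s \<notin> A" "s \<notin> B" using p(2)[of s] q(2)[of s] by auto
    then show "c < v s" "v s < w" using s \<open>a \<le> p\<close> \<open>q \<le> b\<close> by (auto simp: A_def B_def)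
  qed
qed


text \<open>Left of \<open>s0\<close> the function climbs from \<open>c\<close> to \<open>w\<close>,
  and right of \<open>s0\<close> it descends again. Each passage spends a time of at least
  \<open>w - c\<close> strictly between the two levels. The descent is treated as a climb of the
  reflected function.\<close>

lemma level_set_shrinks:
  fixes v :: "real \<Rightarrow> real"
  assumes lip: "\<And>s t. \<bar>v t - v s\<bar> \<le> \<bar>t - s\<bar>" and ab: "v \<alpha> \<le> c" "v \<beta> \<le> c"
    and cw: "c \<le> w" and s0: "s0 \<in> {\<alpha>..\<beta>}" "v s0 > w"
  shows "measure lborel {s\<in>{\<alpha>..\<beta>}. v s > w} + 2 * (w - c) \<le> measure lborel {s\<in>{\<alpha>..\<beta>}. v s > c}"
proof (cases "c = w")
  case False
  then have "c < w" using cw by simp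
  have cont: "continuous_on A v" for A by (rule Lipschitz1_continuous[OF lip])
  have [measurable]: "v \<in> borel_measurable borel" using cont by (rule borel_measurable_continuous_onI)
  obtain p q where pq: "\<alpha> \<le> p" "p \<le> q" "q \<le> s0" "w - c \<le> q - p" "\<And>s. p < s \<Longrightarrow> s < q \<Longrightarrow> c < v s \<and> v s < w"
  proof -
    have "\<alpha> \<le> s0" "w \<le> v s0" using s0 by auto
    from crossing_interval[of v, OF lip this(1) ab(1) \<open>c < w\<close> this(2)]
    obtain p q where *: "\<alpha> \<le> p \<and> p \<le> q \<and> q \<le> s0 \<and> w - c \<le> q - p \<and> (\<forall>s. p < s \<longrightarrow> s < q \<longrightarrow> c < v s \<and> v s < w)"
      by (elim exE)
    show thesis by (rule that[of p q]) (simp_all add: *)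
  qed
  define v' where "v' s = v (- s)" for s
  have lip': "\<bar>v' t - v' s\<bar> \<le> \<bar>t - s\<bar>" for s t unfolding v'_def using lip[of "- t" "- s"] by simp
  obtain p' q' where pq': "- \<beta> \<le> p'" "p' \<le> q'" "q' \<le> - s0" "w - c \<le> q' - p'"
      "\<And>s. p' < s \<Longrightarrow> s < q' \<Longrightarrow> c < v' s \<and> v' s < w"
  proof -
    have "- \<beta> \<le> - s0" "w \<le> v' (- s0)" "v' (- \<beta>) \<le> c" using s0 ab by (auto simp: v'_def)
    from crossing_interval[of v', OF lip' this(1) this(3) \<open>c < w\<close> this(2)]
    obtain p' q' where *: "- \<beta> \<le> p' \<and> p' \<le> q' \<and> q' \<le> - s0 \<and> w - c \<le> q' - p' \<and> (\<forall>s. p' < s \<longrightarrow> s < q' \<longrightarrow> c < v' s \<and> v' s < w)"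
      by (elim exE)
    show thesis by (rule that[of p' q']) (simp_all add: *)
  qed
  let ?A = "{s\<in>{\<alpha>..\<beta>}. v s > w}" and ?I = "{p<..<q}" and ?J = "{- q'<..<- p'}"
  have fin: "S \<in> fmeasurable lborel" if "S \<in> sets borel" "S \<subseteq> {\<alpha>..\<beta>}" for S
  proof (rule fmeasurableI2[OF _ that(2)])
    have "\<alpha> \<le> \<beta>" using s0 by auto
    then show "{\<alpha>..\<beta>} \<in> fmeasurable lborel" by (intro fmeasurableI) simp_all
  qed (use that in simp)
  have sub: "?A \<union> (?I \<union> ?J) \<subseteq> {s\<in>{\<alpha>..\<beta>}. v s > c}"
  proof
    fix s assume "s \<in> ?A \<union> (?I \<union> ?J)"
    then consider "s \<in> ?A" | "s \<in> ?I" | "s \<in> ?J" by blast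
    then show "s \<in> {s\<in>{\<alpha>..\<beta>}. v s > c}"
    proof cases
      case 1
      then show ?thesis using \<open>c < w\<close> by auto
    next
      case 2
      then show ?thesis using pq(1-4) s0 pq(5)[of s] by auto
    next
      case 3
      then show ?thesis using pq'(1-4) s0 pq'(5)[of "- s"] by (auto simp: v'_def)
    qed
  qed
  have disj: "?A \<inter> (?I \<union> ?J) = {}" "?I \<inter> ?J = {}"
  proof -
    have "v s < w" if "s \<in> ?I" for s using pq(5)[of s] that by auto
    moreover have "v s < w" if "s \<in> ?J" for s using pq'(5)[of "- s"] that by (auto simp: v'_def)
    ultimately show "?A \<inter> (?I \<union> ?J) = {}" by fastforce
    show "?I \<inter> ?J = {}" using pq(3) pq'(3) by auto
  qed
  have IJ: "?I \<in> fmeasurable lborel" "?J \<in> fmeasurable lborel" "?A \<in> fmeasurable lborel"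
  proof -
    have "?I \<subseteq> {\<alpha>..\<beta>}" "?J \<subseteq> {\<alpha>..\<beta>}" using pq(1-4) pq'(1-4) s0 by auto
    then show "?I \<in> fmeasurable lborel" "?J \<in> fmeasurable lborel" using fin by auto
    show "?A \<in> fmeasurable lborel" by (rule fin) auto
  qed
  have U: "?I \<union> ?J \<in> fmeasurable lborel" using IJ by auto
  have "measure lborel (?A \<union> (?I \<union> ?J)) = measure lborel ?A + measure lborel (?I \<union> ?J)"
    by (rule measure_Union[OF fmeasurableD2[OF IJ(3), folded infinity_ennreal_def] fmeasurableD2[OF U, folded infinity_ennreal_def] fmeasurableD[OF IJ(3)] fmeasurableD[OF U] disj(1)])
  also have "measure lborel (?I \<union> ?J) = measure lborel ?I + measure lborel ?J"
    by (rule measure_Union[OF fmeasurableD2[OF IJ(1), folded infinity_ennreal_def] fmeasurableD2[OF IJ(2), folded infinity_ennreal_def] fmeasurableD[OF IJ(1)] fmeasurableD[OF IJ(2)] disj(2)])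
  also have "measure lborel ?I + measure lborel ?J = (q - p) + (q' - p')" using pq(1-4) pq'(1-4) by simp
  finally have "measure lborel (?A \<union> (?I \<union> ?J)) = measure lborel ?A + ((q - p) + (q' - p'))" .
  moreover have "measure lborel (?A \<union> (?I \<union> ?J)) \<le> measure lborel {s\<in>{\<alpha>..\<beta>}. v s > c}"
    by (rule measure_mono_fmeasurable[OF sub fmeasurableD fin]) (use IJ in auto)
  ultimately have "measure lborel ?A + ((q - p) + (q' - p')) \<le> measure lborel {s\<in>{\<alpha>..\<beta>}. v s > c}" by linarith
  then show ?thesis using pq(4) pq'(4) by simp
qed simp

text \<open>The parts before and after \<mu> are both compared with the value
  \<open>h \<mu>\<close>; this is the monotonicity of initial averages.\<close>

lemma initial_average_le:
  fixes h :: "real \<Rightarrow> real"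
  assumes cont: "continuous_on {0..M} h" and mono: "\<And>s t. 0 \<le> s \<Longrightarrow> s \<le> t \<Longrightarrow> t \<le> M \<Longrightarrow> h s \<le> h t"
    and \<mu>: "0 \<le> \<mu>" "\<mu> \<le> M"
  shows "M * integral {0..\<mu>} h \<le> \<mu> * integral {0..M} h"
proof -
  have int: "h integrable_on {a..b}" if "0 \<le> a" "b \<le> M" for a b
    using that by (intro integrable_continuous_real continuous_on_subset[OF cont]) auto
  have split: "integral {0..M} h = integral {0..\<mu>} h + integral {\<mu>..M} h"
    using \<mu> int[of 0 M] by (simp add: Henstock_Kurzweil_Integration.integral_combine)
  have "integral {0..\<mu>} h \<le> integral {0..\<mu>} (\<lambda>_. h \<mu>)"
    using \<mu> by (intro integral_le int mono) auto
  then have 1: "integral {0..\<mu>} h \<le> \<mu> * h \<mu>" using \<mu> by simp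
  have "integral {\<mu>..M} (\<lambda>_. h \<mu>) \<le> integral {\<mu>..M} h"
    using \<mu> by (intro integral_le int mono) auto
  then have 2: "(M - \<mu>) * h \<mu> \<le> integral {\<mu>..M} h" using \<mu> by simp
  have "(M - \<mu>) * integral {0..\<mu>} h \<le> (M - \<mu>) * (\<mu> * h \<mu>)" using 1 \<mu> by (intro mult_left_mono) auto
  also have "\<dots> = \<mu> * ((M - \<mu>) * h \<mu>)" by simp
  also have "\<dots> \<le> \<mu> * integral {\<mu>..M} h" using 2 \<mu> by (intro mult_left_mono) auto
  finally show ?thesis unfolding split by (simp add: algebra_simps)
qed

lemma integral_eq_nn_integral:
  fixes f :: "real \<Rightarrow> real"
  assumes "continuous_on {a..b} f" "\<And>s. s \<in> {a..b} \<Longrightarrow> 0 \<le> f s"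
  shows "(\<integral>\<^sup>+s\<in>{a..b}. ennreal (f s) \<partial>lborel) = ennreal (integral {a..b} f)"
    "(\<integral>\<^sup>+s. ennreal (indicator {a..b} s * f s) \<partial>lborel) = ennreal (integral {a..b} f)"
proof -
  have hi: "(f has_integral integral {a..b} f) {a..b}"
    by (intro integrable_integral integrable_continuous_real assms)
  have m: "f \<in> borel_measurable (restrict_space borel {a..b})" by (rule borel_measurable_continuous_on_restrict[OF assms(1)])
  then have m': "(\<lambda>s. indicator {a..b} s * f s) \<in> borel_measurable borel"
    by (subst (asm) borel_measurable_restrict_space_iff) (auto simp: mult.commute)
  have "(\<integral>\<^sup>+s. ennreal (indicator {a..b} s * f s) \<partial>lborel) = ennreal (integral {a..b} f)"
  proof (rule nn_integral_has_integral_lborel)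
    show "(\<lambda>s. indicator {a..b} s * f s) \<in> borel_measurable borel" by (rule m')
    show "0 \<le> indicator {a..b} s * f s" for s using assms(2) by (auto simp: indicator_def)
    have "((\<lambda>s. if s \<in> {a..b} then f s else 0) has_integral integral {a..b} f) UNIV"
      using hi by (simp only: has_integral_restrict_UNIV)
    moreover have "(\<lambda>s. if s \<in> {a..b} then f s else 0) = (\<lambda>s. indicator {a..b} s * f s)" by (auto simp: indicator_def)
    ultimately show "((\<lambda>s. indicator {a..b} s * f s) has_integral integral {a..b} f) UNIV" by simp
  qed
  then show "(\<integral>\<^sup>+s. ennreal (indicator {a..b} s * f s) \<partial>lborel) = ennreal (integral {a..b} f)" .
  moreover have "(\<integral>\<^sup>+s\<in>{a..b}. ennreal (f s) \<partial>lborel) = (\<integral>\<^sup>+s. ennreal (indicator {a..b} s * f s) \<partial>lborel)"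
    by (intro nn_integral_cong) (auto simp: indicator_def)
  ultimately show "(\<integral>\<^sup>+s\<in>{a..b}. ennreal (f s) \<partial>lborel) = ennreal (integral {a..b} f)" by simp
qed

text \<open>The right-hand side belongs to the symmetric bump that climbs from \<open>c\<close> with
  slope 1 for a length \<open>m / 2\<close> and descends likewise. Above level \<open>w\<close> it
  has length \<open>m - 2 * (w - c)\<close>, the most that \<open>level_set_shrinks\<close> permits,
  so the distributions compare and the integrals follow.\<close>

lemma excess_integral_rearranged:
  fixes v f :: "real \<Rightarrow> real"
  assumes lip: "\<And>s t. \<bar>v t - v s\<bar> \<le> \<bar>t - s\<bar>" and ab: "v \<alpha> \<le> c" "v \<beta> \<le> c" and c: "0 \<le> c" "c \<le> L"
    and range: "\<And>s. \<bar>v s\<bar> \<le> L" and f: "continuous_on UNIV f"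
    and mono: "\<And>s t. - L \<le> s \<Longrightarrow> s \<le> t \<Longrightarrow> t \<le> L \<Longrightarrow> f s \<le> f t"
    and m: "m = measure lborel {s\<in>{\<alpha>..\<beta>}. v s > c}" "m \<le> 2 * (L - c)"
  shows "integral {\<alpha>..\<beta>} (\<lambda>s. max 0 (f (v s) - f c)) \<le> 2 * integral {0..m / 2} (\<lambda>\<sigma>. max 0 (f (c + \<sigma>) - f c))"
proof -
  define h where "h w = max 0 (f w - f c)" for w
  have contv: "continuous_on A v" for A by (rule Lipschitz1_continuous[OF lip])
  have conth: "continuous_on A h" for A
    unfolding h_def by (intro continuous_intros continuous_on_subset[OF f]) auto
  have conthv: "continuous_on A (\<lambda>s. h (v s))" for A
    by (rule continuous_on_compose2[OF conth[of UNIV] contv]) auto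
  have conthc: "continuous_on A (\<lambda>\<sigma>. h (c + \<sigma>))" for A
    by (rule continuous_on_compose2[OF conth[of UNIV]]) (auto intro!: continuous_intros)
  have hmono: "h s \<le> h t" if "- L \<le> s" "s \<le> t" "t \<le> L" for s t
    using mono[OF that] unfolding h_def by (intro max.mono) auto
  have [measurable]: "v \<in> borel_measurable borel" by (rule borel_measurable_continuous_onI[OF contv])
  have [measurable]: "(\<lambda>s. h (v s)) \<in> borel_measurable borel" by (rule borel_measurable_continuous_onI[OF conthv])
  have [measurable]: "(\<lambda>\<sigma>. h (c + \<sigma>)) \<in> borel_measurable borel" by (rule borel_measurable_continuous_onI[OF conthc])
  have m0: "m \<ge> 0" unfolding m(1) by simp
  have level: "emeasure lborel {s. indicator {\<alpha>..\<beta>} s * h (v s) > y} \<le> 2 * emeasure lborel {\<sigma>. indicator {0..m / 2} \<sigma> * h (c + \<sigma>) > y}"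
    if y: "y \<ge> 0" for y
  proof (cases "\<exists>s0\<in>{\<alpha>..\<beta>}. h (v s0) > y")
    case False
    then have "{s. indicator {\<alpha>..\<beta>} s * h (v s) > y} = {}" using y by (auto simp: indicator_def not_less)
    then show ?thesis by (simp only: emeasure_empty zero_le)
  next
    case True
    then obtain s0 where s0: "s0 \<in> {\<alpha>..\<beta>}" "h (v s0) > y" by blast
    \<comment> \<open>The largest point of \<open>B\<close> translates levels: by monotonicity of
      \<open>h\<close>, the excess passes \<open>y\<close> exactly where \<open>v\<close> passes
      \<open>w\<close>.\<close>
    define B where "B = {w\<in>{c..L}. h w \<le> y}"
    have "compact B" unfolding B_def by (rule compact_sublevel[OF conth])
    moreover have "c \<in> B" using c y by (simp add: B_def h_def)
    ultimately obtain w where w: "w \<in> B" "\<And>u. u \<in> B \<Longrightarrow> u \<le> w" using compact_attains_sup[of B] by auto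
    have wr: "c \<le> w" "w \<le> L" "h w \<le> y" using w(1) by (auto simp: B_def)
    have iff: "h u > y \<longleftrightarrow> u > w" if "\<bar>u\<bar> \<le> L" for u
    proof
      assume u: "h u > y"
      show "u > w"
      proof (rule ccontr)
        assume "\<not> u > w"
        then have "h u \<le> h w" using that wr by (intro hmono) auto
        then show False using u wr by simp
      qed
    next
      assume u: "u > w"
      then have "u \<notin> B" using w(2)[of u] by auto
      then show "h u > y" using u wr that by (auto simp: B_def)
    qed
    have e1: "{s. indicator {\<alpha>..\<beta>} s * h (v s) > y} = {s\<in>{\<alpha>..\<beta>}. v s > w}"
    proof (intro set_eqI)
      fix s show "s \<in> {s. indicator {\<alpha>..\<beta>} s * h (v s) > y} \<longleftrightarrow> s \<in> {s\<in>{\<alpha>..\<beta>}. v s > w}"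
        using iff[OF range[of s]] y by (cases "s \<in> {\<alpha>..\<beta>}") (simp_all del: atLeastAtMost_iff)
    qed
    have "v s0 > w" using iff[OF range[of s0]] s0 by simp
    from level_set_shrinks[of v, OF lip ab wr(1) s0(1) this]
    have shr: "measure lborel {s\<in>{\<alpha>..\<beta>}. v s > w} + 2 * (w - c) \<le> m" unfolding m(1) .
    have e2: "{\<sigma>. indicator {0..m / 2} \<sigma> * h (c + \<sigma>) > y} = {w - c<..m / 2}"
    proof (intro set_eqI)
      fix \<sigma>
      have "\<bar>c + \<sigma>\<bar> \<le> L" if "\<sigma> \<in> {0..m / 2}" using that c m(2) by auto
      from iff[OF this] show "\<sigma> \<in> {\<sigma>. indicator {0..m / 2} \<sigma> * h (c + \<sigma>) > y} \<longleftrightarrow> \<sigma> \<in> {w - c<..m / 2}"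
        using wr y by (cases "\<sigma> \<in> {0..m / 2}") auto
    qed
    have fin: "{s\<in>{\<alpha>..\<beta>}. v s > w} \<in> fmeasurable lborel"
    proof (rule fmeasurableI2)
      show "{\<alpha>..\<beta>} \<in> fmeasurable lborel" using s0 by (intro fmeasurableI) auto
    qed auto
    have "0 \<le> measure lborel {s\<in>{\<alpha>..\<beta>}. v s > w}" by simp
    from add_increasing[OF this order_refl, of "2 * (w - c)"] shr have "2 * (w - c) \<le> m" by (rule order_trans)
    then have mw: "w - c \<le> m / 2" by simp
    have "emeasure lborel {s\<in>{\<alpha>..\<beta>}. v s > w} = ennreal (measure lborel {s\<in>{\<alpha>..\<beta>}. v s > w})"
      by (rule emeasure_eq_measure2[OF fin])
    also have "\<dots> \<le> ennreal (2 * (m / 2 - (w - c)))" using shr by (intro ennreal_leI) simp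
    also have "\<dots> = 2 * ennreal (m / 2 - (w - c))" by (subst ennreal_mult) (use mw in simp_all)
    also have "ennreal (m / 2 - (w - c)) = emeasure lborel {w - c<..m / 2}" using mw by simp
    finally show ?thesis unfolding e1 e2 .
  qed
  have "ennreal (integral {\<alpha>..\<beta>} (\<lambda>s. h (v s))) = (\<integral>\<^sup>+s. ennreal (indicator {\<alpha>..\<beta>} s * h (v s)) \<partial>lborel)"
    by (rule integral_eq_nn_integral(2)[symmetric, OF conthv]) (simp add: h_def)
  also have "\<dots> \<le> 2 * (\<integral>\<^sup>+\<sigma>. ennreal (indicator {0..m / 2} \<sigma> * h (c + \<sigma>)) \<partial>lborel)"
    by (rule nn_integral_le_of_distribution[OF _ _ level]) measurable
  also have "(\<integral>\<^sup>+\<sigma>. ennreal (indicator {0..m / 2} \<sigma> * h (c + \<sigma>)) \<partial>lborel) = ennreal (integral {0..m / 2} (\<lambda>\<sigma>. h (c + \<sigma>)))"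
    by (rule integral_eq_nn_integral(2)[OF conthc]) (simp add: h_def)
  also have "2 * \<dots> = ennreal (2 * integral {0..m / 2} (\<lambda>\<sigma>. h (c + \<sigma>)))"
    using Henstock_Kurzweil_Integration.integral_nonneg[OF integrable_continuous_real[OF conthc[of "{0..m / 2}"]]]
    by (simp add: ennreal_mult h_def)
  finally have "integral {\<alpha>..\<beta>} (\<lambda>s. h (v s)) \<le> 2 * integral {0..m / 2} (\<lambda>\<sigma>. h (c + \<sigma>))"
    using Henstock_Kurzweil_Integration.integral_nonneg[OF integrable_continuous_real[OF conthc[of "{0..m / 2}"]]]
    by (subst (asm) ennreal_le_iff) (auto simp: h_def)
  then show ?thesis by (simp only: h_def)
qed

text \<open>\<open>p\<close> and \<open>q\<close> are the outermost times with \<open>v\<close> at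
  least \<open>c\<close>. The Lipschitz bound keeps \<open>v\<close> above ramps of slope 1 and
  length \<open>c\<close>, one ending at \<open>p\<close> and one starting at \<open>q\<close>, each
  worth \<open>integral {0..c} f\<close>. Between them the truncation equals \<open>f c\<close> on a
  set of measure \<open>m\<close>.\<close>

lemma truncated_integral_lower_bound:
  fixes v f :: "real \<Rightarrow> real"
  assumes lip: "\<And>s t. \<bar>v t - v s\<bar> \<le> \<bar>t - s\<bar>" and ab: "v \<alpha> = 0" "v \<beta> = 0" and pos: "\<And>s. s \<in> {\<alpha>..\<beta>} \<Longrightarrow> 0 \<le> v s"
    and c: "0 < c" "c \<le> L" and range: "\<And>s. \<bar>v s\<bar> \<le> L" and f: "continuous_on UNIV f" and f0: "f 0 = 0"
    and mono: "\<And>s t. - L \<le> s \<Longrightarrow> s \<le> t \<Longrightarrow> t \<le> L \<Longrightarrow> f s \<le> f t"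
    and s0: "s0 \<in> {\<alpha>..\<beta>}" "v s0 > c" and m: "m = measure lborel {s\<in>{\<alpha>..\<beta>}. v s > c}"
  shows "2 * integral {0..c} f + f c * m \<le> integral {\<alpha>..\<beta>} (\<lambda>s. min (f (v s)) (f c))"
    and "m + 2 * c \<le> \<beta> - \<alpha>"
proof -
  have contv: "continuous_on A v" for A by (rule Lipschitz1_continuous[OF lip])
  have [measurable]: "v \<in> borel_measurable borel" by (rule borel_measurable_continuous_onI[OF contv])
  define A where "A = {s\<in>{\<alpha>..\<beta>}. - v s \<le> - c}"
  have cA: "compact A" unfolding A_def by (intro compact_sublevel continuous_intros contv)
  have "s0 \<in> A" using s0 by (simp add: A_def)
  then have neA: "A \<noteq> {}" by blast
  obtain p where p: "p \<in> A" "\<And>s. s \<in> A \<Longrightarrow> p \<le> s" using compact_attains_inf[OF cA neA] by blast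
  obtain q where q: "q \<in> A" "\<And>s. s \<in> A \<Longrightarrow> s \<le> q" using compact_attains_sup[OF cA neA] by blast
  have pq: "p \<le> q" using p q by blast
  have vp: "v p \<ge> c" "v q \<ge> c" "\<alpha> \<le> p" "q \<le> \<beta>" using p(1) q(1) by (auto simp: A_def)
  have ap: "\<alpha> \<le> p - c" using lip[of \<alpha> p] ab vp by auto
  have qb: "q + c \<le> \<beta>" using lip[of \<beta> q] ab vp by auto
  define E where "E = {s\<in>{\<alpha>..\<beta>}. v s > c}"
  have E: "E \<subseteq> {p..q}" using p(2) q(2) by (auto simp: E_def A_def)
  have [measurable]: "E \<in> sets borel" unfolding E_def by measurable
  have "m \<le> measure lborel {p..q}"
    unfolding m E_def[symmetric] using E pq by (intro measure_mono_fmeasurable fmeasurableI) auto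
  then have mq: "m \<le> q - p" using pq by simp
  then show "m + 2 * c \<le> \<beta> - \<alpha>" using ap qb by simp
  define g where "g s = min (f (v s)) (f c)" for s
  have contfv: "continuous_on A (\<lambda>s. f (v s))" for A by (rule continuous_on_compose2[OF f contv]) auto
  have contg: "continuous_on A g" for A unfolding g_def by (intro continuous_intros contfv)
  have ig: "g integrable_on {a..b}" for a b by (rule integrable_continuous_real[OF contg])
  have fc: "0 \<le> f c" using mono[of 0 c] c f0 by auto
  have g0: "0 \<le> g s" if "s \<in> {\<alpha>..\<beta>}" for s
    using mono[of 0 "v s"] pos[OF that] range[of s] f0 fc by (auto simp: g_def)
  have split: "integral {\<alpha>..\<beta>} g = integral {\<alpha>..p - c} g + integral {p - c..p} g + integral {p..q} g
      + integral {q..q + c} g + integral {q + c..\<beta>} g"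
  proof -
    have "integral {\<alpha>..\<beta>} g = integral {\<alpha>..p - c} g + integral {p - c..\<beta>} g"
      using ap pq qb c by (intro Henstock_Kurzweil_Integration.integral_combine[symmetric] ig) auto
    moreover have "integral {p - c..\<beta>} g = integral {p - c..p} g + integral {p..\<beta>} g"
      using ap pq qb c by (intro Henstock_Kurzweil_Integration.integral_combine[symmetric] ig) auto
    moreover have "integral {p..\<beta>} g = integral {p..q} g + integral {q..\<beta>} g"
      using ap pq qb c by (intro Henstock_Kurzweil_Integration.integral_combine[symmetric] ig) auto
    moreover have "integral {q..\<beta>} g = integral {q..q + c} g + integral {q + c..\<beta>} g"
      using ap pq qb c by (intro Henstock_Kurzweil_Integration.integral_combine[symmetric] ig) auto
    ultimately show ?thesis by linarith
  qed
  have n1: "0 \<le> integral {\<alpha>..p - c} g" "0 \<le> integral {q + c..\<beta>} g"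
    using ap pq qb c by (auto intro!: Henstock_Kurzweil_Integration.integral_nonneg ig g0)
  have f_int: "f integrable_on {a..b}" for a b by (intro integrable_continuous_real continuous_on_subset[OF f]) auto
  have left: "integral {0..c} f \<le> integral {p - c..p} g"
  proof -
    have "integral {0..c} f = integral {p - c..p} (\<lambda>s. f (s + (c - p)))"
      using integral_shift_real_ivl[of 0 "c - p" c f] by simp
    also have "\<dots> \<le> integral {p - c..p} g"
    proof (intro integral_le ig)
      show "(\<lambda>s. f (s + (c - p))) integrable_on {p - c..p}"
        by (intro integrable_continuous_real continuous_on_compose2[OF f]) (auto intro!: continuous_intros)
      fix s assume s: "s \<in> {p - c..p}"
      have "\<bar>v p - v s\<bar> \<le> p - s" using lip[of p s] s by simp
      then have "s + (c - p) \<le> v s" using vp(1) by linarith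
      moreover have "0 \<le> s + (c - p)" "s + (c - p) \<le> c" "v s \<le> L" using s range[of s] by simp_all
      ultimately have "f (s + (c - p)) \<le> f (v s)" "f (s + (c - p)) \<le> f c"
        by (intro mono; use c in linarith)+
      then show "f (s + (c - p)) \<le> g s" unfolding g_def by (rule min.boundedI)
    qed
    finally show ?thesis .
  qed
  have right: "integral {0..c} f \<le> integral {q..q + c} g"
  proof -
    have "integral {0..c} f = integral {- c..- 0} (\<lambda>s. f (- s))" by (rule Henstock_Kurzweil_Integration.integral_reflect_real[symmetric])
    also have "\<dots> = integral {q..q + c} (\<lambda>s. f (- (s + (- c - q))))"
      using integral_shift_real_ivl[of "- c" "- c - q" 0 "\<lambda>s. f (- s)"] by (simp add: add.commute)
    also have "\<dots> \<le> integral {q..q + c} g"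
    proof (intro integral_le ig)
      show "(\<lambda>s. f (- (s + (- c - q)))) integrable_on {q..q + c}"
        by (intro integrable_continuous_real continuous_on_compose2[OF f]) (auto intro!: continuous_intros)
      fix s assume s: "s \<in> {q..q + c}"
      have "\<bar>v q - v s\<bar> \<le> s - q" using lip[of q s] s by simp
      then have "- (s + (- c - q)) \<le> v s" using vp(2) by linarith
      moreover have "0 \<le> - (s + (- c - q))" "- (s + (- c - q)) \<le> c" "v s \<le> L" using s range[of s] by simp_all
      ultimately have "f (- (s + (- c - q))) \<le> f (v s)" "f (- (s + (- c - q))) \<le> f c"
        by (intro mono; use c in linarith)+
      then show "f (- (s + (- c - q))) \<le> g s" unfolding g_def by (rule min.boundedI)
    qed
    finally show ?thesis .
  qed
  have mid: "f c * m \<le> integral {p..q} g"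
  proof -
    have "ennreal (f c * m) = ennreal (f c) * emeasure lborel E"
    proof -
      have "{p..q} \<in> fmeasurable lborel" using pq by (intro fmeasurableI) simp_all
      then have "E \<in> fmeasurable lborel" by (rule fmeasurableI2[OF _ E]) simp
      then show ?thesis using fc unfolding m E_def[symmetric] by (simp add: ennreal_mult emeasure_eq_measure2)
    qed
    also have "\<dots> = (\<integral>\<^sup>+s. ennreal (f c) * indicator E s \<partial>lborel)" by (simp add: nn_integral_cmult_indicator)
    also have "\<dots> \<le> (\<integral>\<^sup>+s\<in>{p..q}. ennreal (g s) \<partial>lborel)"
    proof (rule nn_integral_mono)
      fix s
      show "ennreal (f c) * indicator E s \<le> ennreal (g s) * indicator {p..q} s"
      proof (cases "s \<in> E")
        case True
        then have "f c \<le> g s" using mono[of c "v s"] range[of s] c by (auto simp: g_def E_def)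
        moreover have "s \<in> {p..q}" using True E by blast
        ultimately show ?thesis using True by (simp add: ennreal_leI)
      qed simp
    qed
    also have "\<dots> = ennreal (integral {p..q} g)"
      using g0 vp by (intro integral_eq_nn_integral(1) contg) auto
    finally show ?thesis
      using Henstock_Kurzweil_Integration.integral_nonneg[OF ig, of p q] g0 vp by (subst (asm) ennreal_le_iff) auto
  qed
  show "2 * integral {0..c} f + f c * m \<le> integral {\<alpha>..\<beta>} (\<lambda>s. min (f (v s)) (f c))"
    using split n1 left right mid unfolding g_def by linarith
qed

text \<open>Two regimes. If the level set has length at most \<open>2 * (L - c)\<close>, it is
  rearranged into a symmetric bump and compared with the full quarter period through initial
  averages. If it is longer, the excess is the total integral, bounded by \<open>total\<close>,
  minus the truncated part. In both regimes the component also contains flanks of total length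
  \<open>2 * c\<close>, which enter the length on the right.\<close>

lemma component_excess:
  fixes v f :: "real \<Rightarrow> real"
  assumes lip: "\<And>s t. \<bar>v t - v s\<bar> \<le> \<bar>t - s\<bar>" and ab: "v \<alpha> = 0" "v \<beta> = 0" "\<alpha> \<le> \<beta>"
    and pos: "\<And>s. s \<in> {\<alpha>..\<beta>} \<Longrightarrow> 0 \<le> v s"
    and c: "0 < c" "c < L" and range: "\<And>s. \<bar>v s\<bar> \<le> L" and f: "continuous_on UNIV f" and f0: "f 0 = 0"
    and mono: "\<And>s t. - L \<le> s \<Longrightarrow> s \<le> t \<Longrightarrow> t \<le> L \<Longrightarrow> f s \<le> f t"
    and total: "integral {\<alpha>..\<beta>} (\<lambda>s. f (v s)) \<le> 2 * integral {0..L} f"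
  shows "L * integral {\<alpha>..\<beta>} (\<lambda>s. max 0 (f (v s) - f c)) \<le> (\<beta> - \<alpha>) * integral {c..L} (\<lambda>w. f w - f c)"
    (is "L * ?I \<le> _ * ?J")
proof -
  have contv: "continuous_on A v" for A by (rule Lipschitz1_continuous[OF lip])
  have contfv: "continuous_on A (\<lambda>s. f (v s))" for A by (rule continuous_on_compose2[OF f contv]) auto
  have contf: "continuous_on A f" for A using f by (rule continuous_on_subset) auto
  have f_int: "f integrable_on {a..b}" for a b by (rule integrable_continuous_real[OF contf])
  have J_eq: "?J = integral {c..L} f - (L - c) * f c"
    using c by (subst Henstock_Kurzweil_Integration.integral_diff) (auto intro: f_int)
  have J0: "0 \<le> ?J"
  proof (rule Henstock_Kurzweil_Integration.integral_nonneg)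
    show "(\<lambda>w. f w - f c) integrable_on {c..L}" by (intro integrable_diff f_int) auto
    show "0 \<le> f w - f c" if "w \<in> {c..L}" for w using mono[of c w] that c by auto
  qed
  show ?thesis
  proof (cases "\<exists>s0\<in>{\<alpha>..\<beta>}. v s0 > c")
    case False
    have "max 0 (f (v s) - f c) = 0" if "s \<in> {\<alpha>..\<beta>}" for s
    proof -
      have "v s \<le> c" using False that by (auto simp: not_less)
      then have "f (v s) \<le> f c" using range[of s] c by (intro mono) auto
      then show ?thesis by simp
    qed
    then have "?I = integral {\<alpha>..\<beta>} (\<lambda>s. 0)" by (rule Henstock_Kurzweil_Integration.integral_cong)
    then have "?I = 0" by simp
    then show ?thesis using J0 ab by simp
  next
    case True
    then obtain s0 where s0: "s0 \<in> {\<alpha>..\<beta>}" "v s0 > c" by blast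
    define m where "m = measure lborel {s\<in>{\<alpha>..\<beta>}. v s > c}"
    have low: "2 * integral {0..c} f + f c * m \<le> integral {\<alpha>..\<beta>} (\<lambda>s. min (f (v s)) (f c))" and len: "m + 2 * c \<le> \<beta> - \<alpha>"
      using truncated_integral_lower_bound[of v \<alpha> \<beta> c L f s0 m, OF lip ab(1,2) pos c(1) less_imp_le[OF c(2)] range f f0 mono s0 m_def] by blast+
    have m0: "0 \<le> m" by (simp add: m_def)
    have "L > 0" using c by simp
    show ?thesis
    proof (cases "m \<le> 2 * (L - c)")
      case True
      have I: "?I \<le> 2 * integral {0..m / 2} (\<lambda>\<sigma>. max 0 (f (c + \<sigma>) - f c))"
        using excess_integral_rearranged[of v \<alpha> c \<beta> L f m, OF lip _ _ _ _ range f mono m_def True] ab c by simp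
      have "(L - c) * integral {0..m / 2} (\<lambda>\<sigma>. max 0 (f (c + \<sigma>) - f c)) \<le>
          m / 2 * integral {0..L - c} (\<lambda>\<sigma>. max 0 (f (c + \<sigma>) - f c))"
      proof (rule initial_average_le)
        show "continuous_on {0..L - c} (\<lambda>\<sigma>. max 0 (f (c + \<sigma>) - f c))"
          by (intro continuous_intros continuous_on_compose2[OF f]) auto
        show "max 0 (f (c + s) - f c) \<le> max 0 (f (c + t) - f c)" if "0 \<le> s" "s \<le> t" "t \<le> L - c" for s t
        proof -
          have "f (c + s) \<le> f (c + t)" using that c by (intro mono) auto
          then show ?thesis by (intro max.mono) auto
        qed
      qed (use True m0 in auto)
      also have "integral {0..L - c} (\<lambda>\<sigma>. max 0 (f (c + \<sigma>) - f c)) = ?J"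
      proof -
        have "integral {0..L - c} (\<lambda>\<sigma>. max 0 (f (c + \<sigma>) - f c)) = integral {0..L - c} (\<lambda>\<sigma>. f (\<sigma> + c) - f c)"
        proof (rule Henstock_Kurzweil_Integration.integral_cong)
          fix \<sigma> assume "\<sigma> \<in> {0..L - c}"
          then have "f c \<le> f (c + \<sigma>)" using c by (intro mono) auto
          then show "max 0 (f (c + \<sigma>) - f c) = f (\<sigma> + c) - f c" by (simp add: add.commute)
        qed
        also have "\<dots> = ?J" using integral_shift_real_ivl[of c c L "\<lambda>w. f w - f c"] by simp
        finally show ?thesis .
      qed
      finally have K: "(L - c) * integral {0..m / 2} (\<lambda>\<sigma>. max 0 (f (c + \<sigma>) - f c)) \<le> m / 2 * ?J" .
      have "(L - c) * ?I \<le> (L - c) * (2 * integral {0..m / 2} (\<lambda>\<sigma>. max 0 (f (c + \<sigma>) - f c)))"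
        using I c by (intro mult_left_mono) auto
      also have "\<dots> = 2 * ((L - c) * integral {0..m / 2} (\<lambda>\<sigma>. max 0 (f (c + \<sigma>) - f c)))" by simp
      also have "\<dots> \<le> m * ?J" using K by simp
      finally have "(L - c) * ?I \<le> m * ?J" .
      then have "L * ((L - c) * ?I) \<le> L * (m * ?J)" using \<open>L > 0\<close> by (intro mult_left_mono) auto
      also have "\<dots> = (m * L) * ?J" by simp
      also have "\<dots> \<le> ((\<beta> - \<alpha>) * (L - c)) * ?J"
      proof (rule mult_right_mono[OF _ J0])
        \<comment> \<open>This is \<open>m * L \<le> (m + 2 * c) * (L - c)\<close> after expansion,
          with equality at \<open>m = 2 * (L - c)\<close>, the border between the two
          regimes.\<close>
        have "0 \<le> c * (2 * (L - c) - m)" using True c by (intro mult_nonneg_nonneg) auto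
        then have "m * L \<le> (m + 2 * c) * (L - c)" by (simp add: algebra_simps)
        also have "\<dots> \<le> (\<beta> - \<alpha>) * (L - c)" using len c by (intro mult_right_mono) auto
        finally show "m * L \<le> (\<beta> - \<alpha>) * (L - c)" .
      qed
      finally have "(L - c) * (L * ?I) \<le> (L - c) * ((\<beta> - \<alpha>) * ?J)" by (simp only: mult_ac)
      then show ?thesis using c by (simp only: mult_le_cancel_left_pos diff_gt_0_iff_gt)
    next
      case False
      have "?I = integral {\<alpha>..\<beta>} (\<lambda>s. f (v s) - min (f (v s)) (f c))"
        by (intro Henstock_Kurzweil_Integration.integral_cong) auto
      also have "\<dots> = integral {\<alpha>..\<beta>} (\<lambda>s. f (v s)) - integral {\<alpha>..\<beta>} (\<lambda>s. min (f (v s)) (f c))"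
        by (intro Henstock_Kurzweil_Integration.integral_diff integrable_continuous_real continuous_intros contfv)
      finally have I: "?I \<le> 2 * integral {0..L} f - (2 * integral {0..c} f + f c * m)" using total low by linarith
      have "integral {0..L} f = integral {0..c} f + integral {c..L} f"
        using c f_int by (intro Henstock_Kurzweil_Integration.integral_combine[symmetric]) auto
      moreover have "f c * (2 * (L - c)) \<le> f c * m"
        using False mono[of 0 c] c f0 by (intro mult_left_mono) auto
      ultimately have "?I \<le> 2 * ?J" using I unfolding J_eq by (simp add: algebra_simps)
      then have "L * ?I \<le> L * (2 * ?J)" using \<open>L > 0\<close> by (intro mult_left_mono) auto
      also have "\<dots> = (2 * L) * ?J" by simp
      also have "\<dots> \<le> (\<beta> - \<alpha>) * ?J" using False len J0 by (intro mult_right_mono) auto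
      finally show ?thesis .
    qed
  qed
qed

text \<open>The component ends at the nearest points on either side of \<open>s0\<close> where
  \<open>v\<close> is at most 0, and the Lipschitz bound makes \<open>v\<close> vanish there. Its
  length is at least \<open>c\<close> because \<open>v\<close> must climb above \<open>c\<close>;
  this is what lets the extraction of components terminate.\<close>

lemma nonneg_component:
  fixes v :: "real \<Rightarrow> real"
  assumes lip: "\<And>s t. \<bar>v t - v s\<bar> \<le> \<bar>t - s\<bar>" and ab: "v \<alpha> = 0" "v \<beta> = 0"
    and s0: "\<alpha> \<le> s0" "s0 \<le> \<beta>" "v s0 > c" "c > 0"
  shows "\<exists>\<alpha>' \<beta>'. \<alpha> \<le> \<alpha>' \<and> \<alpha>' + c \<le> \<beta>' \<and> \<beta>' \<le> \<beta> \<and> v \<alpha>' = 0 \<and> v \<beta>' = 0 \<and> (\<forall>s\<in>{\<alpha>'..\<beta>'}. 0 \<le> v s)"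
proof -
  have contv: "continuous_on A v" for A by (rule Lipschitz1_continuous[OF lip])
  define A where "A = {s\<in>{\<alpha>..s0}. v s \<le> 0}"
  define B where "B = {s\<in>{s0..\<beta>}. v s \<le> 0}"
  have cA: "compact A" "compact B" unfolding A_def B_def by (intro compact_sublevel contv)+
  have "\<alpha> \<in> A" "\<beta> \<in> B" using ab s0 by (auto simp: A_def B_def)
  then have ne: "A \<noteq> {}" "B \<noteq> {}" by blast+
  obtain p where p: "p \<in> A" "\<And>s. s \<in> A \<Longrightarrow> s \<le> p" using compact_attains_sup[OF cA(1) ne(1)] by blast
  obtain q where q: "q \<in> B" "\<And>s. s \<in> B \<Longrightarrow> q \<le> s" using compact_attains_inf[OF cA(2) ne(2)] by blast
  have pr: "\<alpha> \<le> p" "p \<le> s0" "v p \<le> 0" "s0 \<le> q" "q \<le> \<beta>" "v q \<le> 0" using p(1) q(1) by (auto simp: A_def B_def)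
  have "p \<noteq> s0" "q \<noteq> s0" using pr s0 by auto
  then have ps: "p < s0" "s0 < q" using pr by auto
  have inside: "0 < v s" if "p < s" "s < q" for s
  proof (rule ccontr)
    assume "\<not> 0 < v s"
    then have "s \<in> A \<or> s \<in> B" using that pr by (cases "s \<le> s0") (auto simp: A_def B_def)
    then show False using p(2)[of s] q(2)[of s] that by auto
  qed
  have vp: "v p = 0"
  proof (rule ccontr)
    assume "v p \<noteq> 0"
    \<comment> \<open>If \<open>v p\<close> were negative, the Lipschitz bound would keep
      \<open>v\<close> negative at \<open>p + d\<close>, where it is known to be positive.\<close>
    define d where "d = min (- v p) (s0 - p) / 2"
    have d: "d > 0" "d < - v p" "p + d < s0" using \<open>v p \<noteq> 0\<close> pr ps by (auto simp: d_def min_def field_simps)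
    have "\<bar>v (p + d) - v p\<bar> \<le> d" using lip[of "p + d" p] d by simp
    then have "v (p + d) < 0" using d by linarith
    then show False using inside[of "p + d"] d ps by simp
  qed
  have vq: "v q = 0"
  proof (rule ccontr)
    assume "v q \<noteq> 0"
    define d where "d = min (- v q) (q - s0) / 2"
    have d: "d > 0" "d < - v q" "s0 < q - d" using \<open>v q \<noteq> 0\<close> pr ps by (auto simp: d_def min_def field_simps)
    have "\<bar>v (q - d) - v q\<bar> \<le> d" using lip[of "q - d" q] d by simp
    then have "v (q - d) < 0" using d by linarith
    then show False using inside[of "q - d"] d ps by simp
  qed
  have "\<bar>v s0 - v p\<bar> \<le> s0 - p" using lip[of s0 p] ps by simp
  then have "p + c \<le> q" using vp s0 ps by linarith
  moreover have "\<forall>s\<in>{p..q}. 0 \<le> v s"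
  proof
    fix s assume "s \<in> {p..q}"
    then consider "s = p" | "s = q" | "p < s" "s < q" by fastforce
    then show "0 \<le> v s" using vp vq inside[of s] by cases auto
  qed
  ultimately show ?thesis using pr vp vq by - (rule exI[of _ p], rule exI[of _ q], simp)
qed

text \<open>There may be infinitely many zeros of \<open>v\<close>, but only components on which the
  modulus of \<open>v\<close> exceeds \<open>c\<close> carry excess, and each of those has length at
  least \<open>c\<close>. Removing one leaves two shorter intervals between zeros, so the induction
  measures length in multiples of \<open>c\<close>. The bound on \<open>X\<close> enters as twice
  that bound on the increment of \<open>X\<close> over a component.\<close>

lemma excess_between_zeros:
  fixes v f X :: "real \<Rightarrow> real"
  assumes lip: "\<And>s t. \<bar>v t - v s\<bar> \<le> \<bar>t - s\<bar>"
    and c: "0 < c" "c < L" and range: "\<And>s. \<bar>v s\<bar> \<le> L" and f: "continuous_on UNIV f" and odd: "\<And>w. f (- w) = - f w"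
    and mono: "\<And>s t. - L \<le> s \<Longrightarrow> s \<le> t \<Longrightarrow> t \<le> L \<Longrightarrow> f s \<le> f t"
    and dX: "\<And>s. (X has_real_derivative f (v s)) (at s)" and X: "\<And>s. \<bar>X s\<bar> \<le> integral {0..L} f"
    and ab: "v \<alpha> = 0" "v \<beta> = 0" "\<alpha> \<le> \<beta>"
  shows "L * integral {\<alpha>..\<beta>} (\<lambda>s. max 0 (\<bar>f (v s)\<bar> - f c)) \<le> (\<beta> - \<alpha>) * integral {c..L} (\<lambda>w. f w - f c)"
proof -
  have contv: "continuous_on A v" for A by (rule Lipschitz1_continuous[OF lip])
  have contfv: "continuous_on A (\<lambda>s. f (v s))" for A by (rule continuous_on_compose2[OF f contv]) auto
  have f0: "f 0 = 0" using odd[of 0] by simp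
  define h where "h s = max 0 (\<bar>f (v s)\<bar> - f c)" for s
  define J where "J = integral {c..L} (\<lambda>w. f w - f c)"
  have int: "h integrable_on {a..b}" for a b
    unfolding h_def by (intro integrable_continuous_real continuous_intros contfv)
  have FTC: "integral {a..b} (\<lambda>s. f (v s)) = X b - X a" if "a \<le> b" for a b
  proof (rule integral_unique, rule fundamental_theorem_of_calculus[OF that])
    fix s show "(X has_vector_derivative f (v s)) (at s within {a..b})"
      using dX[of s] by (simp add: has_real_derivative_iff_has_vector_derivative[symmetric] has_field_derivative_at_within)
  qed
  have comp: "L * integral {a..b} h \<le> (b - a) * J"
    if z: "v a = 0" "v b = 0" "a \<le> b" and sign: "(\<forall>s\<in>{a..b}. 0 \<le> v s) \<or> (\<forall>s\<in>{a..b}. 0 \<le> - v s)" for a b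
    using sign
  proof
    assume pos: "\<forall>s\<in>{a..b}. 0 \<le> v s"
    have "integral {a..b} h = integral {a..b} (\<lambda>s. max 0 (f (v s) - f c))"
    proof (rule Henstock_Kurzweil_Integration.integral_cong)
      fix s assume "s \<in> {a..b}"
      then have "0 \<le> f (v s)" using mono[of 0 "v s"] pos range[of s] f0 by auto
      then show "h s = max 0 (f (v s) - f c)" by (simp add: h_def)
    qed
    moreover have "integral {a..b} (\<lambda>s. f (v s)) \<le> 2 * integral {0..L} f"
      using FTC[OF z(3)] X[of a] X[of b] by simp
    ultimately show ?thesis unfolding J_def
      using component_excess[of v a b c L f, OF lip z _ c range f f0 mono] pos by simp
  next
    assume neg: "\<forall>s\<in>{a..b}. 0 \<le> - v s"
    define v' where "v' s = - v s" for s
    have v': "\<bar>v' t - v' s\<bar> \<le> \<bar>t - s\<bar>" "v' a = 0" "v' b = 0" "\<bar>v' s\<bar> \<le> L" for s t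
      using lip[of t s] z range[of s] by (auto simp: v'_def)
    have pos': "0 \<le> v' s" if "s \<in> {a..b}" for s using neg that by (auto simp: v'_def)
    have fv': "f (v' s) = - f (v s)" for s by (simp add: v'_def odd)
    have "integral {a..b} h = integral {a..b} (\<lambda>s. max 0 (f (v' s) - f c))"
    proof (rule Henstock_Kurzweil_Integration.integral_cong)
      fix s assume "s \<in> {a..b}"
      then have "0 \<le> f (v' s)" using mono[of 0 "v' s"] pos'[of s] v'(4)[of s] f0 by auto
      then show "h s = max 0 (f (v' s) - f c)" by (simp add: h_def fv')
    qed
    moreover have "integral {a..b} (\<lambda>s. f (v' s)) \<le> 2 * integral {0..L} f"
      using FTC[OF z(3)] X[of a] X[of b] by (simp add: fv')
    ultimately show ?thesis unfolding J_def
      using component_excess[of v' a b c L f, OF v'(1-3) z(3) pos' c v'(4) f f0 mono] by simp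
  qed
  have "L * integral {\<alpha>..\<beta>} h \<le> (\<beta> - \<alpha>) * J" if "\<beta> - \<alpha> \<le> real n * c" for n
    using ab that
  proof (induction n arbitrary: \<alpha> \<beta> rule: less_induct)
    case (less n)
    have small: ?case if no: "\<And>s. s \<in> {\<alpha>..\<beta>} \<Longrightarrow> \<bar>v s\<bar> \<le> c"
    proof -
      have "h s = 0" if "s \<in> {\<alpha>..\<beta>}" for s
      proof -
        have "f (v s) \<le> f c" "f (- v s) \<le> f c" using no[OF that] c by (auto intro!: mono)
        then show ?thesis using odd by (simp add: h_def abs_le_iff)
      qed
      then have "integral {\<alpha>..\<beta>} h = integral {\<alpha>..\<beta>} (\<lambda>s. 0)" by (rule Henstock_Kurzweil_Integration.integral_cong)
      moreover have "0 \<le> J" unfolding J_def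
      proof (rule Henstock_Kurzweil_Integration.integral_nonneg)
        show "(\<lambda>w. f w - f c) integrable_on {c..L}"
          by (intro integrable_continuous_real continuous_intros continuous_on_subset[OF f]) auto
        show "0 \<le> f w - f c" if "w \<in> {c..L}" for w using mono[of c w] that c by auto
      qed
      ultimately show ?thesis using less.prems(3) by simp
    qed
    show ?case
    proof (cases "\<exists>s0\<in>{\<alpha>..\<beta>}. \<bar>v s0\<bar> > c")
      case False
      then show ?thesis by (intro small) (auto simp: not_less)
    next
      case True
      then obtain s0 where s0: "\<alpha> \<le> s0" "s0 \<le> \<beta>" "\<bar>v s0\<bar> > c" by auto
      have "\<exists>p q. \<alpha> \<le> p \<and> p + c \<le> q \<and> q \<le> \<beta> \<and> v p = 0 \<and> v q = 0 \<and> ((\<forall>s\<in>{p..q}. 0 \<le> v s) \<or> (\<forall>s\<in>{p..q}. 0 \<le> - v s))"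
      proof (cases "v s0 > 0")
        case True
        then have "v s0 > c" using s0 by simp
        from nonneg_component[of v, OF lip less.prems(1,2) s0(1,2) this c(1)] show ?thesis by blast
      next
        case False
        define v' where "v' s = - v s" for s
        have v': "\<bar>v' t - v' s\<bar> \<le> \<bar>t - s\<bar>" "v' \<alpha> = 0" "v' \<beta> = 0" "v' s0 > c" for s t
          using lip[of t s] less.prems(1,2) s0(3) False by (auto simp: v'_def)
        from nonneg_component[of v', OF v'(1-3) s0(1,2) v'(4) c(1)] show ?thesis unfolding v'_def by auto
      qed
      then obtain p q where pq: "\<alpha> \<le> p" "p + c \<le> q" "q \<le> \<beta>" "v p = 0" "v q = 0"
        "(\<forall>s\<in>{p..q}. 0 \<le> v s) \<or> (\<forall>s\<in>{p..q}. 0 \<le> - v s)" by (elim exE conjE) (rule that)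
      have "n \<noteq> 0"
      proof
        assume "n = 0"
        then show False using less.prems(4) pq c by simp
      qed
      then obtain k where k: "n = Suc k" by (cases n) auto
      \<comment> \<open>The removed component uses up a length of at least \<open>c\<close>, so even
        the two remainders together fit into \<open>k\<close> multiples of \<open>c\<close>.\<close>
      have len: "(p - \<alpha>) + (\<beta> - q) \<le> real k * c" using less.prems(4) pq k by (simp add: algebra_simps)
      have IH1: "L * integral {\<alpha>..p} h \<le> (p - \<alpha>) * J"
        by (rule less.IH[of k]) (use k less.prems pq len in auto)
      have IH2: "L * integral {q..\<beta>} h \<le> (\<beta> - q) * J"
        by (rule less.IH[of k]) (use k less.prems pq len in auto)
      have mid: "L * integral {p..q} h \<le> (q - p) * J"
        using pq c by (intro comp) auto
      have "integral {\<alpha>..\<beta>} h = integral {\<alpha>..p} h + integral {p..\<beta>} h"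
        using pq c int by (intro Henstock_Kurzweil_Integration.integral_combine[symmetric]) auto
      moreover have "integral {p..\<beta>} h = integral {p..q} h + integral {q..\<beta>} h"
        using pq c int by (intro Henstock_Kurzweil_Integration.integral_combine[symmetric]) auto
      ultimately have "L * integral {\<alpha>..\<beta>} h = L * integral {\<alpha>..p} h + L * integral {p..q} h + L * integral {q..\<beta>} h"
        by (simp add: distrib_left)
      then have "L * integral {\<alpha>..\<beta>} h \<le> (p - \<alpha>) * J + (q - p) * J + (\<beta> - q) * J" using IH1 IH2 mid by linarith
      also have "\<dots> = (\<beta> - \<alpha>) * J" by (simp add: algebra_simps)
      finally show ?thesis .
    qed
  qed
  moreover obtain n :: nat where "(\<beta> - \<alpha>) / c \<le> real n" using real_arch_simple by blast
  then have "\<beta> - \<alpha> \<le> real n * c" using c by (simp add: pos_divide_le_eq)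
  ultimately show ?thesis unfolding h_def J_def by blast
qed

section \<open>Decreasing rearrangements\<close>

lemma decr_rearr_alt:
  assumes "f \<in> borel_measurable borel"
  shows "decr_rearr f u = Inf {ennreal y | y. 0 \<le> y \<and> emeasure lborel {s \<in> {0..1}. f s > y} \<le> ennreal u}"
proof -
  have "{s \<in> {0..1}. f s > y} \<in> sets lborel" for y using assms by measurable
  then show ?thesis unfolding decr_rearr_def by simp
qed

lemma decr_rearr_le:
  assumes "f \<in> borel_measurable borel" "0 \<le> y" "emeasure lborel {s \<in> {0..1}. f s > y} \<le> ennreal u"
  shows "decr_rearr f u \<le> ennreal y"
  unfolding decr_rearr_alt[OF assms(1)] using assms(2,3) by (intro Inf_lower) auto

lemma decr_rearr_antimono:
  assumes "u \<le> u'" shows "decr_rearr f u' \<le> decr_rearr f u"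
  unfolding decr_rearr_def by (intro Inf_superset_mono) (use order_trans[OF _ ennreal_leI[OF assms]] in blast)

text \<open>Rearrangement and distribution function are generalised inverses. For the strict
  inequality some room above \<open>z\<close> is required: the sets where \<open>f\<close> exceeds
  \<open>z + 1 / (n + 1)\<close> increase to the set where it exceeds \<open>z\<close>, so one of
  them already has measure above \<open>u\<close>.\<close>

lemma decr_rearr_gt_iff:
  assumes f: "f \<in> borel_measurable borel" and "0 \<le> z"
  shows "ennreal z < decr_rearr f u \<longleftrightarrow> ennreal u < emeasure lborel {s \<in> {0..1}. f s > z}"
proof
  assume "ennreal z < decr_rearr f u"
  then show "ennreal u < emeasure lborel {s \<in> {0..1}. f s > z}"
    using decr_rearr_le[OF assms] by (meson not_le)
next
  assume u: "ennreal u < emeasure lborel {s \<in> {0..1}. f s > z}"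
  let ?S = "\<lambda>n. {s \<in> {0..1}. f s > z + inverse (real (Suc n))}"
  have [measurable]: "f \<in> borel_measurable borel" by (rule f)
  have "(SUP n. emeasure lborel (?S n)) = emeasure lborel (\<Union>n. ?S n)"
  proof (rule SUP_emeasure_incseq)
    have "?S n \<in> sets borel" for n by measurable
    then show "range ?S \<subseteq> sets lborel" by auto
    show "incseq ?S"
    proof (rule incseq_SucI)
      fix n
      have "inverse (real (Suc (Suc n))) \<le> inverse (real (Suc n))" by (intro le_imp_inverse_le) auto
      then have "z + inverse (real (Suc (Suc n))) \<le> z + inverse (real (Suc n))" by (rule add_left_mono)
      from le_less_trans[OF this] show "?S n \<subseteq> ?S (Suc n)" by blast
    qed
  qed
  also have "(\<Union>n. ?S n) = {s \<in> {0..1}. f s > z}"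
  proof (intro equalityI subsetI)
    fix s assume "s \<in> (\<Union>n. ?S n)"
    then obtain n where n: "s \<in> ?S n" by blast
    have "z \<le> z + inverse (real (Suc n))" by simp
    from le_less_trans[OF this] n show "s \<in> {s \<in> {0..1}. f s > z}" by blast
  next
    fix s assume s: "s \<in> {s \<in> {0..1}. f s > z}"
    then obtain n where "inverse (real (Suc n)) < f s - z" using reals_Archimedean[of "f s - z"] by auto
    then have "s \<in> ?S n" using s by auto
    then show "s \<in> (\<Union>n. ?S n)" by blast
  qed
  finally have "ennreal u < (SUP n. emeasure lborel (?S n))" using u by (simp only:)
  then obtain n where n: "ennreal u < emeasure lborel (?S n)" unfolding less_SUP_iff by blast
  let ?z = "z + inverse (real (Suc n))"
  have "ennreal ?z \<le> decr_rearr f u" unfolding decr_rearr_alt[OF f]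
  proof (rule Inf_greatest)
    fix e assume "e \<in> {ennreal y | y. 0 \<le> y \<and> emeasure lborel {s \<in> {0..1}. f s > y} \<le> ennreal u}"
    then obtain y where y: "e = ennreal y" "0 \<le> y" "emeasure lborel {s \<in> {0..1}. f s > y} \<le> ennreal u" by blast
    have "?z \<le> y"
    proof (rule ccontr)
      assume "\<not> ?z \<le> y"
      then have "emeasure lborel (?S n) \<le> emeasure lborel {s \<in> {0..1}. f s > y}" by (intro emeasure_mono) auto
      then show False using n y(3) by auto
    qed
    then show "ennreal ?z \<le> e" unfolding y(1) by (rule ennreal_leI)
  qed
  moreover have "ennreal z < ennreal ?z" using \<open>0 \<le> z\<close> by (intro ennreal_lessI) (simp_all add: add_nonneg_pos del: of_nat_Suc)
  ultimately show "ennreal z < decr_rearr f u" by (rule less_le_trans[rotated])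
qed

lemma decr_rearr_bounded:
  assumes "f \<in> borel_measurable borel" "\<And>s. f s \<le> K" "0 \<le> K"
  shows "decr_rearr f u \<le> ennreal K"
proof (rule decr_rearr_le[OF assms(1,3)])
  have "{s \<in> {0..1}. f s > K} = {}" using assms(2) by (auto simp: not_less)
  then show "emeasure lborel {s \<in> {0..1}. f s > K} \<le> ennreal u" by (simp only: emeasure_empty zero_le)
qed

text \<open>Boundedness makes the rearrangement finite, so a real-valued representative
  \<open>R\<close> exists; the equivalence with the distribution function determines it.\<close>

lemma decr_rearr_real:
  assumes "f \<in> borel_measurable borel" "\<And>s. f s \<le> K" "0 \<le> K"
  shows "\<exists>R. (\<forall>u. decr_rearr f u = ennreal (R u)) \<and> (\<forall>u. 0 \<le> R u) \<and>
    (\<forall>z u. 0 \<le> z \<longrightarrow> (z < R u \<longleftrightarrow> ennreal u < emeasure lborel {s \<in> {0..1}. f s > z})) \<and>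
    (\<forall>u u'. u \<le> u' \<longrightarrow> R u' \<le> R u)"
proof -
  define R where "R u = enn2real (decr_rearr f u)" for u
  have "decr_rearr f u < top" for u using decr_rearr_bounded[OF assms, of u] by (rule le_less_trans) simp
  then have eq: "decr_rearr f u = ennreal (R u)" for u unfolding R_def by simp
  have R0: "0 \<le> R u" for u by (simp add: R_def)
  have iff: "z < R u \<longleftrightarrow> ennreal u < emeasure lborel {s \<in> {0..1}. f s > z}" if "0 \<le> z" for u z
    using decr_rearr_gt_iff[OF assms(1) that, of u] that unfolding eq by (simp add: ennreal_less_iff)
  have "R u' \<le> R u" if "u \<le> u'" for u u'
    using decr_rearr_antimono[OF that, of f] R0 unfolding eq by (simp add: ennreal_le_iff)
  then show ?thesis using eq R0 iff by (intro exI[of _ R] conjI allI impI)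
qed

lemma decr_rearr_scale_le:
  assumes "f \<in> borel_measurable borel" "\<And>s. f s \<le> K" "0 \<le> K" "C > 0"
  shows "decr_rearr (\<lambda>s. C * f s) u \<le> ennreal C * decr_rearr f u"
proof -
  obtain R where R': "\<forall>u. decr_rearr f u = ennreal (R u)" "\<forall>u. 0 \<le> R u"
    "\<forall>z u. 0 \<le> z \<longrightarrow> (z < R u \<longleftrightarrow> ennreal u < emeasure lborel {s \<in> {0..1}. f s > z})"
    using decr_rearr_real[OF assms(1-3)] by (elim exE conjE) (rule that)
  note R = R'[rule_format]
  have "\<not> R u < R u" by simp
  then have le: "emeasure lborel {s \<in> {0..1}. f s > R u} \<le> ennreal u" using R(3)[OF R(2)] by (simp only: not_less)
  have "{s \<in> {0..1}. C * f s > C * R u} = {s \<in> {0..1}. f s > R u}" using \<open>C > 0\<close> by simp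
  then have "decr_rearr (\<lambda>s. C * f s) u \<le> ennreal (C * R u)"
    using le assms(1,4) R(2)[of u] by (intro decr_rearr_le) auto
  then show ?thesis using assms(4) R(2)[of u] unfolding R(1) by (simp add: ennreal_mult)
qed

text \<open>On the half line a superlevel set of \<open>R\<close> is an interval starting at 0 whose
  length is the measure of the superlevel set of \<open>f\<close>. This gives measurability and
  equality of the two distributions at once; the comparison of distributions is then applied in both
  directions.\<close>

lemma excess_equimeasurable:
  fixes f R :: "real \<Rightarrow> real"
  assumes f: "f \<in> borel_measurable borel" and R0: "\<And>u. 0 \<le> R u"
    and R: "\<And>z u. 0 \<le> z \<Longrightarrow> z < R u \<longleftrightarrow> ennreal u < emeasure lborel {s \<in> {0..1}. f s > z}" and "0 \<le> y"
  shows "(\<lambda>u. indicator {0..} u * max 0 (R u - y)) \<in> borel_measurable borel"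
    and "(\<integral>\<^sup>+u. ennreal (indicator {0..} u * max 0 (R u - y)) \<partial>lborel) = (\<integral>\<^sup>+s. ennreal (indicator {0..1} s * max 0 (f s - y)) \<partial>lborel)"
proof -
  define P where "P u = indicator {0..} u * max 0 (R u - y)" for u
  define F where "F s = indicator {0..1} s * max 0 (f s - y)" for s
  define D where "D z = emeasure lborel {s \<in> {0..1}. f s > z}" for z
  have Dle: "D z \<le> 1" for z
  proof -
    have "D z \<le> emeasure lborel {0..1::real}" unfolding D_def by (rule emeasure_mono) auto
    then show ?thesis by simp
  qed
  have Pset: "{u. P u > z} = {0..<enn2real (D (y + z))}" if "0 \<le> z" for z
  proof (intro set_eqI)
    fix u
    have fin: "D (y + z) < top" using Dle[of "y + z"] by (rule le_less_trans) simp
    show "u \<in> {u. P u > z} \<longleftrightarrow> u \<in> {0..<enn2real (D (y + z))}"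
    proof (cases "0 \<le> u")
      case True
      then have "u \<in> {u. P u > z} \<longleftrightarrow> y + z < R u" using that by (auto simp: P_def)
      also have "\<dots> \<longleftrightarrow> ennreal u < D (y + z)" unfolding D_def using that \<open>0 \<le> y\<close> by (intro R) simp
      also have "\<dots> \<longleftrightarrow> ennreal u < ennreal (enn2real (D (y + z)))" using fin by simp
      also have "\<dots> \<longleftrightarrow> u < enn2real (D (y + z))" using True by (simp add: ennreal_less_iff)
      finally show ?thesis using True by simp
    next
      case False
      then show ?thesis using that by (simp add: P_def)
    qed
  qed
  have Fset: "{s. F s > z} = {s \<in> {0..1}. f s > y + z}" if "0 \<le> z" for z
  proof (intro set_eqI)
    fix s show "s \<in> {s. F s > z} \<longleftrightarrow> s \<in> {s \<in> {0..1}. f s > y + z}"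
      using that by (cases "s \<in> {0..1}") (auto simp: F_def)
  qed
  have eq: "emeasure lborel {u. P u > z} = emeasure lborel {s. F s > z}" if "0 \<le> z" for z
  proof -
    have fin: "D (y + z) < top" using Dle[of "y + z"] by (rule le_less_trans) simp
    have "emeasure lborel {u. P u > z} = ennreal (enn2real (D (y + z)))" unfolding Pset[OF that] by simp
    also have "\<dots> = D (y + z)" using fin by simp
    finally show ?thesis unfolding Fset[OF that] D_def .
  qed
  have Pm: "P \<in> borel_measurable borel"
  proof (rule borel_measurableI_greater)
    fix z
    show "{u \<in> space borel. z < P u} \<in> sets borel"
    proof (cases "0 \<le> z")
      case True
      then show ?thesis using Pset[OF True] by simp
    next
      case False
      have "0 \<le> P u" for u by (simp add: P_def)
      then have "{u \<in> space borel. z < P u} = UNIV" using False by (auto intro: less_le_trans[of z 0])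
      then show ?thesis by simp
    qed
  qed
  then show "(\<lambda>u. indicator {0..} u * max 0 (R u - y)) \<in> borel_measurable borel" unfolding P_def .
  have Fm: "F \<in> borel_measurable borel" unfolding F_def using f by measurable
  have "(\<integral>\<^sup>+u. ennreal (P u) \<partial>lborel) \<le> 1 * (\<integral>\<^sup>+s. ennreal (F s) \<partial>lborel)"
    using eq by (intro nn_integral_le_of_distribution Pm Fm) simp
  moreover have "(\<integral>\<^sup>+s. ennreal (F s) \<partial>lborel) \<le> 1 * (\<integral>\<^sup>+u. ennreal (P u) \<partial>lborel)"
    using eq by (intro nn_integral_le_of_distribution Pm Fm) simp
  ultimately show "(\<integral>\<^sup>+u. ennreal (indicator {0..} u * max 0 (R u - y)) \<partial>lborel) = (\<integral>\<^sup>+s. ennreal (indicator {0..1} s * max 0 (f s - y)) \<partial>lborel)"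
    unfolding P_def F_def by simp
qed

text \<open>The level is \<open>y = Rg t\<close>. Up to \<open>t\<close> the function
  \<open>Rg\<close> is at least \<open>y\<close> and afterwards at most \<open>y\<close>, so its
  integral over \<open>{0..t}\<close> is exactly \<open>t * y\<close> plus its whole excess over
  \<open>y\<close>. For \<open>Rf\<close> the same expression is an upper bound.\<close>

lemma decr_rearr_majorization:
  assumes f: "f \<in> borel_measurable borel" "\<And>s. f s \<le> K" and g: "g \<in> borel_measurable borel" "\<And>s. g s \<le> K" and "0 \<le> K"
    and le: "\<And>y. 0 \<le> y \<Longrightarrow> (\<integral>\<^sup>+s. ennreal (indicator {0..1} s * max 0 (f s - y)) \<partial>lborel) \<le>
        (\<integral>\<^sup>+s. ennreal (indicator {0..1} s * max 0 (g s - y)) \<partial>lborel)"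
    and "t > 0"
  shows "(\<integral>\<^sup>+u\<in>{0..t}. decr_rearr f u \<partial>lborel) \<le> (\<integral>\<^sup>+u\<in>{0..t}. decr_rearr g u \<partial>lborel)"
proof -
  obtain Rf where Rf': "\<forall>u. decr_rearr f u = ennreal (Rf u)" "\<forall>u. 0 \<le> Rf u"
    "\<forall>z u. 0 \<le> z \<longrightarrow> (z < Rf u \<longleftrightarrow> ennreal u < emeasure lborel {s \<in> {0..1}. f s > z})"
    using decr_rearr_real[OF f \<open>0 \<le> K\<close>] by (elim exE conjE) (rule that)
  note Rf = Rf'[rule_format]
  obtain Rg where Rg': "\<forall>u. decr_rearr g u = ennreal (Rg u)" "\<forall>u. 0 \<le> Rg u"
    "\<forall>z u. 0 \<le> z \<longrightarrow> (z < Rg u \<longleftrightarrow> ennreal u < emeasure lborel {s \<in> {0..1}. g s > z})" "\<forall>u u'. u \<le> u' \<longrightarrow> Rg u' \<le> Rg u"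
    using decr_rearr_real[OF g \<open>0 \<le> K\<close>] by (elim exE conjE) (rule that)
  note Rg = Rg'[rule_format]
  define y where "y = Rg t"
  have y0: "0 \<le> y" using Rg(2) by (simp add: y_def)
  note Ef = excess_equimeasurable[where f = f and R = Rf, OF f(1) Rf(2,3) y0]
  note Eg = excess_equimeasurable[where f = g and R = Rg, OF g(1) Rg(2,3) y0]
  let ?Pf = "\<lambda>u. ennreal (indicator {0..} u * max 0 (Rf u - y))" and ?Pg = "\<lambda>u. ennreal (indicator {0..} u * max 0 (Rg u - y))"
  have m: "?Pf \<in> borel_measurable lborel" "?Pg \<in> borel_measurable lborel" using Ef(1) Eg(1) by auto
  have "(\<integral>\<^sup>+u\<in>{0..t}. decr_rearr f u \<partial>lborel) \<le> (\<integral>\<^sup>+u. ennreal y * indicator {0..t} u + ?Pf u \<partial>lborel)"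
  proof (rule nn_integral_mono)
    fix u
    show "decr_rearr f u * indicator {0..t} u \<le> ennreal y * indicator {0..t} u + ?Pf u"
    proof (cases "u \<in> {0..t}")
      case True
      have "ennreal (Rf u) \<le> ennreal (y + max 0 (Rf u - y))" by (intro ennreal_leI) simp
      also have "\<dots> = ennreal y + ennreal (max 0 (Rf u - y))" using y0 by (intro ennreal_plus) auto
      finally show ?thesis using True by (simp add: Rf(1))
    qed simp
  qed
  also have "\<dots> = (\<integral>\<^sup>+u. ennreal y * indicator {0..t} u \<partial>lborel) + (\<integral>\<^sup>+u. ?Pf u \<partial>lborel)"
    using m by (intro nn_integral_add) auto
  also have "\<dots> \<le> (\<integral>\<^sup>+u. ennreal y * indicator {0..t} u \<partial>lborel) + (\<integral>\<^sup>+u. ?Pg u \<partial>lborel)"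
  proof (rule add_left_mono)
    have 1: "(\<integral>\<^sup>+u. ?Pf u \<partial>lborel) = (\<integral>\<^sup>+s. ennreal (indicator {0..1} s * max 0 (f s - y)) \<partial>lborel)" by (rule Ef(2))
    have 2: "(\<integral>\<^sup>+u. ?Pg u \<partial>lborel) = (\<integral>\<^sup>+s. ennreal (indicator {0..1} s * max 0 (g s - y)) \<partial>lborel)" by (rule Eg(2))
    show "(\<integral>\<^sup>+u. ?Pf u \<partial>lborel) \<le> (\<integral>\<^sup>+u. ?Pg u \<partial>lborel)" unfolding 1 2 by (rule le[OF y0])
  qed
  also have "\<dots> = (\<integral>\<^sup>+u. ennreal y * indicator {0..t} u + ?Pg u \<partial>lborel)"
    using m by (intro nn_integral_add[symmetric]) auto
  also have "\<dots> \<le> (\<integral>\<^sup>+u\<in>{0..t}. decr_rearr g u \<partial>lborel)"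
  proof (rule nn_integral_mono)
    fix u
    show "ennreal y * indicator {0..t} u + ?Pg u \<le> decr_rearr g u * indicator {0..t} u"
    proof (cases "u \<in> {0..t}")
      case True
      have "y \<le> Rg u" unfolding y_def using True by (intro Rg(4)) auto
      then have "ennreal (Rg u) = ennreal y + ennreal (max 0 (Rg u - y))"
        using y0 by (subst ennreal_plus[symmetric]) auto
      then show ?thesis using True by (simp add: Rg(1))
    next
      case False
      have "?Pg u = 0"
      proof (cases "0 \<le> u")
        case True
        then have "Rg u \<le> y" unfolding y_def using False by (intro Rg(4)) auto
        then show ?thesis by simp
      qed simp
      then show ?thesis using False by simp
    qed
  qed
  finally show ?thesis .
qed

section \<open>The comparison argument\<close>

lemma DERIV_bound_of_Lipschitz:
  fixes f :: "real \<Rightarrow> real"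
  assumes "(f has_real_derivative D) (at t)" "\<And>s t. \<bar>f t - f s\<bar> \<le> K * \<bar>t - s\<bar>"
  shows "\<bar>D\<bar> \<le> K"
proof (rule tendsto_upperbound)
  show "((\<lambda>h. \<bar>(f (t + h) - f t) / h\<bar>) \<longlongrightarrow> \<bar>D\<bar>) (at 0)"
    using assms(1) unfolding DERIV_def by (rule tendsto_rabs)
  have "\<bar>(f (t + h) - f t) / h\<bar> \<le> K" if "h \<noteq> 0" for h
    using assms(2)[of "t + h" t] that by (simp add: abs_divide pos_divide_le_eq)
  then show "\<forall>\<^sub>F h in at 0. \<bar>(f (t + h) - f t) / h\<bar> \<le> K" by (auto simp: eventually_at_filter)
qed simp

lemma Lipschitz_of_DERIV_bound:
  fixes f :: "real \<Rightarrow> real"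
  assumes d: "\<And>t. (f has_real_derivative f' t) (at t)" and b: "\<And>t. \<bar>f' t\<bar> \<le> K"
  shows "\<bar>f t - f s\<bar> \<le> K * \<bar>t - s\<bar>"
proof -
  have *: "\<bar>f t - f s\<bar> \<le> K * \<bar>t - s\<bar>" if "s < t" for s t
  proof -
    have "\<exists>z>s. z < t \<and> f t - f s = (t - s) * f' z" using that by (rule MVT2) (rule d)
    then obtain z where "f t - f s = (t - s) * f' z" by blast
    then show ?thesis using b[of z] that by (simp add: abs_mult mult.commute mult_right_mono)
  qed
  show ?thesis using *[of s t] *[of t s] by (cases s t rule: linorder_cases) (auto simp: abs_minus_commute)
qed

text \<open>Rationals above \<open>l\<close> accumulate at \<open>l\<close>; in this way estimates
  obtained on a common period reach the given, possibly irrational one.\<close>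

lemma le_of_rational_above:
  fixes f :: "real \<Rightarrow> real"
  assumes "isCont f l" "\<And>l'. l' \<in> \<rat> \<Longrightarrow> l < l' \<Longrightarrow> z \<le> f l'"
  shows "z \<le> f l"
proof (rule ccontr)
  assume "\<not> z \<le> f l"
  then have "z - f l > 0" by simp
  then obtain d where d: "d > 0" "\<And>l'. dist l' l < d \<Longrightarrow> dist (f l') (f l) < z - f l"
    using assms(1) unfolding continuous_at_eps_delta by blast
  obtain l' where l': "l' \<in> \<rat>" "l < l'" "l' < l + d" using Rats_dense_in_real[of l "l + d"] d(1) by auto
  then have "dist (f l') (f l) < z - f l" by (intro d(2)) (simp add: dist_real_def)
  then show False using assms(2)[OF l'(1,2)] by (simp add: dist_real_def)
qed

lemma comparison_wave_top:
  "\<rho> > 0 \<Longrightarrow> comparison_wave a1 a2 B \<rho> n (\<rho> * (a1 + a2 + 2) / 2) = B * \<rho> ^ n * psi_centered n a1 a2 ((a1 + a2 + 2) / 2)"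
  by (simp add: comparison_wave_def)

text \<open>The bound is the maximum of the comparison wave of order \<open>n\<close>, attained at half of its half period.\<close>

definition norm_bounded :: "real \<Rightarrow> real \<Rightarrow> real \<Rightarrow> real \<Rightarrow> nat \<Rightarrow> (real \<Rightarrow> real) \<Rightarrow> bool" where
  "norm_bounded a1 a2 B \<rho> n y \<longleftrightarrow> (\<forall>t. \<bar>y t\<bar> \<le> B * \<rho> ^ n * psi_centered n a1 a2 ((a1 + a2 + 2) / 2))"

lemma norm_bounded_mono:
  assumes "a1 \<ge> 0" "a2 \<ge> 0" "B > 0" "\<rho> > 0" "\<rho> \<le> \<rho>'" "n \<ge> 1" "norm_bounded a1 a2 B \<rho> n y"
  shows "norm_bounded a1 a2 B \<rho>' n y"
proof -
  have "psi_centered n a1 a2 ((a1 + a2 + 2) / 2) > 0" using waveD(6)[OF wave_psi_centered[OF assms(1,2,6)]] .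
  moreover have "\<rho> ^ n \<le> \<rho>' ^ n" using assms by (intro power_mono) auto
  ultimately have "B * \<rho> ^ n * psi_centered n a1 a2 ((a1 + a2 + 2) / 2) \<le> B * \<rho>' ^ n * psi_centered n a1 a2 ((a1 + a2 + 2) / 2)"
    using assms by (intro mult_right_mono mult_left_mono) auto
  then show ?thesis using assms(7) unfolding norm_bounded_def by (meson order_trans)
qed

text \<open>The hypotheses in a form that can be reused with \<open>x'\<close> in place of
  \<open>x\<close>: successive derivatives up to order \<open>n - 1\<close>, with a Lipschitz
  condition standing for the bound on the derivative of order \<open>n\<close>. \<open>cond\<close>
  says where the comparison starts: at the order 1 wave if \<open>a1 = 0\<close>, or at the order 2
  wave, where a bound on the next derivative is asked for if the arch has a plateau,
  \<open>a2 > 0\<close>.\<close>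

locale derivative_chain =
  fixes a1 a2 B \<rho> :: real and n :: nat and Y :: "nat \<Rightarrow> real \<Rightarrow> real"
  assumes a: "a1 \<ge> 0" "a2 \<ge> 0" and B: "B > 0" and \<rho>: "\<rho> > 0" and n: "n \<ge> 1"
    and dY: "\<And>k t. Suc k < n \<Longrightarrow> (Y k has_real_derivative Y (Suc k) t) (at t)"
    and per: "\<And>k t. k < n \<Longrightarrow> Y k (t + 1) = Y k t"
    and lip: "\<And>s t. \<bar>Y (n - 1) t - Y (n - 1) s\<bar> \<le> B * \<bar>t - s\<bar>"
    and cond: "(a1 = 0 \<and> norm_bounded a1 a2 B \<rho> 1 (Y (n - 1))) \<or>
      (n \<ge> 2 \<and> norm_bounded a1 a2 B \<rho> 2 (Y (n - 2)) \<and> (a2 = 0 \<or> norm_bounded a1 a2 B \<rho> 1 (Y (n - 1))))"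
    and bounded0: "norm_bounded a1 a2 B \<rho> n (Y 0)"
begin

lemma uminus: "derivative_chain a1 a2 B \<rho> n (\<lambda>k t. - Y k t)"
  using a B \<rho> n dY per lip cond bounded0
  by unfold_locales (auto intro!: DERIV_minus simp: norm_bounded_def abs_minus_commute)

text \<open>All norm bounds grow with \<rho> while the Lipschitz constant \<open>B\<close> stays the
  same, so the chain survives the passage to a rational period.\<close>

lemma enlarge:
  assumes "\<rho> \<le> \<rho>'" shows "derivative_chain a1 a2 B \<rho>' n Y"
proof -
  have m: "norm_bounded a1 a2 B \<rho>' k y" if "k \<ge> 1" "norm_bounded a1 a2 B \<rho> k y" for k y
    using norm_bounded_mono[OF a B \<rho> assms that] .
  have "(a1 = 0 \<and> norm_bounded a1 a2 B \<rho>' 1 (Y (n - 1))) \<or>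
      (n \<ge> 2 \<and> norm_bounded a1 a2 B \<rho>' 2 (Y (n - 2)) \<and> (a2 = 0 \<or> norm_bounded a1 a2 B \<rho>' 1 (Y (n - 1))))"
    using cond m[of 1] m[of 2] by auto
  then show ?thesis using a B \<rho> assms n dY per lip m[OF n bounded0] by unfold_locales auto
qed

text \<open>The comparison starts at order 1 or 2 according to \<open>cond\<close> and is lifted
  over the remaining \<open>n - 1\<close> or \<open>n - 2\<close> orders. The second assumption on
  \<open>q\<close> says that \<open>q\<close> periods of the wave have the integer length
  \<open>p\<close>, which is a period of \<open>Y\<close> too.\<close>

lemma crossing_free:
  assumes q: "q \<ge> 1" "2 * real q * (\<rho> * (a1 + a2 + 2)) = real p"
    and small: "\<And>t. \<bar>Y 0 t\<bar> < comparison_wave a1 a2 B \<rho> n (\<rho> * (a1 + a2 + 2) / 2)"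
  shows "crossing_free (\<rho> * (a1 + a2 + 2)) (comparison_wave a1 a2 B \<rho> n) (Y 0)"
proof -
  let ?H = "\<rho> * (a1 + a2 + 2)" and ?G = "comparison_wave a1 a2 B \<rho>"
  have H: "?H > 0" using a \<rho> by simp
  have per': "Y k (t + 2 * real q * ?H) = Y k t" if "k < n" for k t
  proof -
    have "Y k (t + real m) = Y k t" for m :: nat
    proof (induction m)
      case (Suc m)
      have "Y k (t + real (Suc m)) = Y k ((t + real m) + 1)" by (simp add: add_ac)
      also have "\<dots> = Y k (t + real m)" by (rule per[OF that])
      finally show ?case using Suc by simp
    qed simp
    then show ?thesis unfolding q(2) .
  qed
  have w: "wave ?H (?G k)" if "k \<ge> 1" for k using wave_comparison[OF a B \<rho> that] .
  have anti: "?G k (t + ?H) = - ?G k t" "?G k (- t) = - ?G k t" if "k \<ge> 1" for k t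
    using waveD(2,3)[OF w[OF that]] by auto
  have dG: "(?G (Suc k) has_real_derivative ?G k (t + ?H / 2)) (at t)" if "k \<ge> 1" for k t
    using comparison_wave_deriv[OF a B \<rho> that] .
  have top: "norm_bounded a1 a2 B \<rho> k y \<longleftrightarrow> (\<forall>t. \<bar>y t\<bar> \<le> ?G k (?H / 2))" for k y
    unfolding norm_bounded_def comparison_wave_top[OF \<rho>] ..
  from cond show ?thesis
  proof
    assume A: "a1 = 0 \<and> norm_bounded a1 a2 B \<rho> 1 (Y (n - 1))"
    then have b: "\<bar>Y (n - 1) t\<bar> \<le> ?G 1 (?H / 2)" "\<bar>- Y (n - 1) t\<bar> \<le> ?G 1 (?H / 2)" for t unfolding top by auto
    have lip': "\<bar>- Y (n - 1) t - - Y (n - 1) s\<bar> \<le> B * \<bar>t - s\<bar>" for s t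
      using lip[of t s] by (simp add: abs_minus_commute)
    have "crossing_free ?H (?G (1 + (n - 1))) (Y 0)"
    proof (rule crossing_free_lift[OF H q(1)])
      show "crossing_free ?H (?G 1) (Y (n - 1))"
        by (rule crossing_free_comparison_1[OF a B \<rho> conjunct1[OF A] b(1) lip])
      show "crossing_free ?H (?G 1) (\<lambda>t. - Y (n - 1) t)"
        by (rule crossing_free_comparison_1[OF a B \<rho> conjunct1[OF A] b(2) lip'])
      show "\<bar>Y 0 t\<bar> < ?G (1 + (n - 1)) (?H / 2)" for t using small n by simp
      show "(Y k has_real_derivative Y (Suc k) t) (at t)" if "k < n - 1" for k t using that by (intro dY) simp
      show "Y k (t + 2 * real q * ?H) = Y k t" if "k \<le> n - 1" for k t using that n by (intro per') simp
    qed (use anti dG in auto)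
    then show ?thesis using n by simp
  next
    assume A: "n \<ge> 2 \<and> norm_bounded a1 a2 B \<rho> 2 (Y (n - 2)) \<and> (a2 = 0 \<or> norm_bounded a1 a2 B \<rho> 1 (Y (n - 1)))"
    then have n2: "Suc (n - 2) = n - 1" "2 + (n - 2) = n" by auto
    have b: "\<bar>Y (n - 2) t\<bar> \<le> ?G 2 (?H / 2)" "\<bar>- Y (n - 2) t\<bar> \<le> ?G 2 (?H / 2)" for t using A unfolding top by auto
    have pl: "a2 = 0 \<or> (\<forall>t. \<bar>Y (n - 1) t\<bar> \<le> ?G 1 (?H / 2))" "a2 = 0 \<or> (\<forall>t. \<bar>- Y (n - 1) t\<bar> \<le> ?G 1 (?H / 2))"
      using A unfolding top by auto
    have d: "(Y (n - 2) has_real_derivative Y (n - 1) t) (at t)" for t using dY[of "n - 2" t] A unfolding n2(1) by simp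
    then have d': "((\<lambda>t. - Y (n - 2) t) has_real_derivative - Y (n - 1) t) (at t)" for t by (rule DERIV_minus)
    have lip': "\<bar>- Y (n - 1) t - - Y (n - 1) s\<bar> \<le> B * \<bar>t - s\<bar>" for s t
      using lip[of t s] by (simp add: abs_minus_commute)
    have "crossing_free ?H (?G (2 + (n - 2))) (Y 0)"
    proof (rule crossing_free_lift[OF H q(1)])
      show "crossing_free ?H (?G 2) (Y (n - 2))"
        by (rule crossing_free_comparison_2[OF a B \<rho> d b(1) lip pl(1)])
      show "crossing_free ?H (?G 2) (\<lambda>t. - Y (n - 2) t)"
        by (rule crossing_free_comparison_2[OF a B \<rho> d' b(2) lip' pl(2)])
      show "\<bar>Y 0 t\<bar> < ?G (2 + (n - 2)) (?H / 2)" for t unfolding n2(2) by (rule small)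
      show "(Y k has_real_derivative Y (Suc k) t) (at t)" if "k < n - 2" for k t using that by (intro dY) simp
      show "Y k (t + 2 * real q * ?H) = Y k t" if "k \<le> n - 2" for k t using that n by (intro per') simp
    qed (use anti dG in auto)
    then show ?thesis unfolding n2(2) .
  qed
qed

text \<open>The last conclusion rests on strictness: between its extrema the rising branch vanishes
  only at 0. It turns zeros of \<open>Y 0\<close> into endpoints for the excess estimate.\<close>

lemma Lipschitz_parameter:
  assumes q: "q \<ge> 1" "2 * real q * (\<rho> * (a1 + a2 + 2)) = real p"
    and small: "\<And>t. \<bar>Y 0 t\<bar> < comparison_wave a1 a2 B \<rho> n (\<rho> * (a1 + a2 + 2) / 2)"
  shows "\<exists>v. (\<forall>s. \<bar>v s\<bar> \<le> \<rho> * (a1 + a2 + 2) / 2) \<and> (\<forall>s. comparison_wave a1 a2 B \<rho> n (v s) = Y 0 s) \<and>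
    (\<forall>s t. \<bar>v t - v s\<bar> \<le> \<bar>t - s\<bar>) \<and> (\<forall>s. Y 0 s = 0 \<longrightarrow> v s = 0)"
proof -
  let ?H = "\<rho> * (a1 + a2 + 2)" and ?G = "comparison_wave a1 a2 B \<rho> n"
  interpret neg: derivative_chain a1 a2 B \<rho> n "\<lambda>k t. - Y k t" by (rule uminus)
  have "n \<ge> 2 \<or> n = 1 \<and> a1 = 0" using cond n by auto
  then have sw: "strict_wave ?H ?G" by (rule strict_wave_comparison[OF a B \<rho>])
  then have w: "wave ?H ?G" by (simp add: strict_wave_def)
  have cf: "crossing_free ?H ?G (Y 0)" by (rule crossing_free[OF q small])
  have cf': "crossing_free ?H ?G (\<lambda>t. - Y 0 t)" using neg.crossing_free[OF q] small by simp
  obtain v where v: "\<And>s. - ?H / 2 < v s" "\<And>s. v s < ?H / 2" "\<And>s. ?G (v s) = Y 0 s" "\<And>s t. \<bar>v t - v s\<bar> \<le> \<bar>t - s\<bar>"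
    using crossing_free_Lipschitz_parameter[OF sw small cf cf'] by metis
  have "v s = 0" if "Y 0 s = 0" for s
  proof (rule ccontr)
    assume ne: "v s \<noteq> 0"
    have z: "?G (v s) = 0" "?G 0 = 0" "0 < ?G (?H / 2)" using v(3) that waveD(6,9)[OF w] by auto
    have st: "\<And>s t. - ?H / 2 \<le> s \<Longrightarrow> s < t \<Longrightarrow> t \<le> ?H / 2 \<Longrightarrow> ?G s < ?G (?H / 2) \<Longrightarrow> - ?G (?H / 2) < ?G t \<Longrightarrow> ?G s < ?G t"
      using sw unfolding strict_wave_def by blast
    have H: "?H > 0" using a \<rho> by simp
    show False
    proof (cases "v s < 0")
      case True
      then show False using st[of "v s" 0] v(1)[of s] z H by simp
    next
      case False
      then show False using st[of 0 "v s"] v(2)[of s] z H ne by simp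
    qed
  qed
  moreover have "\<bar>v s\<bar> \<le> ?H / 2" for s using v(1,2)[of s] by (simp add: abs_le_iff)
  ultimately show ?thesis using v(3,4) by blast
qed

end

section \<open>Common periods and averages over a period\<close>

lemma rational_period:
  fixes l :: real
  assumes "l \<in> \<rat>" "l > 0"
  shows "\<exists>q p. q \<ge> 1 \<and> real q * l = real p"
proof -
  obtain m n :: nat where "n \<noteq> 0" "\<bar>l\<bar> = real m / real n" using Rats_abs_nat_div_natE[OF assms(1)] by blast
  then have "real n * l = real m" "n \<ge> 1" using assms(2) by (auto simp: field_simps)
  then show ?thesis by blast
qed

lemma scale_cancel:
  fixes T l \<rho> :: real
  assumes "T > 0" "\<rho> = l / (2 * T)"
  shows "2 * (\<rho> * T) = l" "2 * c * (\<rho> * T) = c * l"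
  using assms by simp_all

lemma antiderivative_exists:
  fixes f :: "real \<Rightarrow> real"
  assumes "continuous_on UNIV f"
  shows "\<exists>P. \<forall>t. (P has_real_derivative f t) (at t)"
  using interval_integral_has_derivative[OF assms] by blast

lemma integral_of_antiderivative:
  fixes f P :: "real \<Rightarrow> real"
  assumes "\<And>t. (P has_real_derivative f t) (at t)" "a \<le> b"
  shows "integral {a..b} f = P b - P a"
proof (rule integral_unique, rule fundamental_theorem_of_calculus[OF assms(2)])
  fix t show "(P has_vector_derivative f t) (at t within {a..b})"
    using assms(1)[of t] by (simp add: has_real_derivative_iff_has_vector_derivative[symmetric] has_field_derivative_at_within)
qed

lemma periodic_antiderivative:
  fixes f P :: "real \<Rightarrow> real"
  assumes "\<And>t. (P has_real_derivative f t) (at t)" "\<And>t. f (t + d) = f t"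
  shows "P (t + d) - P t = P (s + d) - P s"
proof -
  have "((\<lambda>t. P (t + d) - P t) has_real_derivative f (t + d) - f t) (at t)" for t
    using DERIV_diff[OF DERIV_shift[THEN iffD1, OF assms(1)[of "t + d"]] assms(1)[of t]] .
  then have "((\<lambda>t. P (t + d) - P t) has_real_derivative 0) (at t)" for t using assms(2) by simp
  then show ?thesis using DERIV_isconst_all[of "\<lambda>t. P (t + d) - P t"] by blast
qed

lemma integral_period_shift:
  fixes f :: "real \<Rightarrow> real"
  assumes f: "continuous_on UNIV f" "\<And>t. f (t + 1) = f t"
  shows "integral {a..a + 1} f = integral {0..1} f"
proof -
  obtain P where P: "\<And>t. (P has_real_derivative f t) (at t)" using antiderivative_exists[OF f(1)] by blast
  have "integral {a..a + 1} f = P (a + 1) - P a" by (rule integral_of_antiderivative[OF P]) simp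
  also have "\<dots> = P (0 + 1) - P 0" by (rule periodic_antiderivative[OF P f(2)])
  also have "\<dots> = integral {0..1} f" using integral_of_antiderivative[OF P, of 0 1] by simp
  finally show ?thesis .
qed

text \<open>The modulus of \<open>g\<close> is even and has period \<open>H\<close>, so all quarter
  periods contribute equally. The unit interval runs through two half periods, at whatever phase
  \<open>d\<close> it starts.\<close>

lemma wave_excess_mean:
  assumes w: "wave H g" and "0 \<le> y"
  shows "H / 2 * integral {0..1} (\<lambda>s. max 0 (\<bar>g (2 * H * s - d)\<bar> - y)) = integral {0..H / 2} (\<lambda>w. max 0 (\<bar>g w\<bar> - y))"
proof -
  note g = waveD[OF w]
  define f where "f w = max 0 (\<bar>g w\<bar> - y)" for w
  have cf: "continuous_on UNIV f" unfolding f_def by (intro continuous_intros g(4))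
  obtain P where P: "\<And>t. (P has_real_derivative f t) (at t)" using antiderivative_exists[OF cf] by blast
  have fH: "f (t + H) = f t" "f (- t) = f t" for t using g(2)[of t] g(3)[of t] by (simp_all add: f_def)
  have H: "H > 0" by (rule g(1))
  define C where "C = P (- (H / 2) + H) - P (- (H / 2))"
  have step: "P (t + H) - P t = C" for t unfolding C_def by (rule periodic_antiderivative[OF P fH(1)])
  have "((\<lambda>t. P t + P (- t)) has_real_derivative f t + f (- t) * - 1) (at t)" for t
    by (intro DERIV_add P DERIV_chain2[OF P]) (auto intro!: derivative_eq_intros)
  then have "((\<lambda>t. P t + P (- t)) has_real_derivative 0) (at t)" for t using fH(2) by simp
  then have "P (H / 2) + P (- (H / 2)) = P 0 + P (- 0)" using DERIV_isconst_all[of "\<lambda>t. P t + P (- t)"] by blast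
  then have C: "C = 2 * (P (H / 2) - P 0)" unfolding C_def by simp
  have "((\<lambda>s. P (2 * H * s - d) / (2 * H)) has_real_derivative f (2 * H * s - d)) (at s)" for s
  proof -
    have "((\<lambda>s. P (2 * H * s - d)) has_real_derivative f (2 * H * s - d) * (2 * H)) (at s)"
      by (rule DERIV_chain2[OF P]) (auto intro!: derivative_eq_intros)
    from DERIV_cdivide[OF this, of "2 * H"] show ?thesis using H by simp
  qed
  from integral_of_antiderivative[OF this, of 0 1]
  have "integral {0..1} (\<lambda>s. f (2 * H * s - d)) = (P (2 * H - d) - P (- d)) / (2 * H)" by (simp add: diff_divide_distrib)
  also have "P (2 * H - d) - P (- d) = 2 * C" using step[of "- d"] step[of "- d + H"] by (simp add: algebra_simps)
  finally have "H / 2 * integral {0..1} (\<lambda>s. f (2 * H * s - d)) = C / 2" using H by simp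
  also have "\<dots> = integral {0..H / 2} f" using integral_of_antiderivative[OF P, of 0 "H / 2"] H C by simp
  finally show ?thesis unfolding f_def .
qed

context derivative_chain
begin

text \<open>\<open>Y 0\<close> is a wave composed with a 1-Lipschitz parameter and inherits the
  Lipschitz constant of that wave, which is the maximum of the wave one order lower. This is the
  initial bound for the chain that starts at \<open>Y 1\<close>.\<close>

lemma first_derivative_bounded:
  assumes "n \<ge> 2"
  shows "norm_bounded a1 a2 B \<rho> (n - 1) (Y 1)"
  unfolding norm_bounded_def
proof
  fix t
  let ?T = "a1 + a2 + 2"
  define \<mu> where "\<mu> = psi_centered (n - 1) a1 a2 (?T / 2)"
  have T: "?T > 0" using a by simp
  have main: "\<bar>Y 1 t\<bar> \<le> B * (l / (2 * ?T)) ^ (n - 1) * \<mu>" if l: "l \<in> \<rat>" "2 * ?T * \<rho> < l" for l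
  proof -
    define \<rho>' where "\<rho>' = l / (2 * ?T)"
    have \<rho>': "\<rho> < \<rho>'" using l T by (simp add: \<rho>'_def field_simps)
    then have \<rho>'0: "\<rho>' > 0" using \<rho> by simp
    interpret big: derivative_chain a1 a2 B \<rho>' n Y using enlarge \<rho>' by simp
    have "l > 0" using l T \<rho> by (meson less_trans mult_pos_pos zero_less_numeral)
    obtain q p where q: "q \<ge> 1" "real q * l = real p" using rational_period[OF l(1) \<open>l > 0\<close>] by blast
    have q': "2 * real q * (\<rho>' * ?T) = real p"
      using q(2) scale_cancel(2)[OF T \<rho>'_def] by (simp only:)
    let ?H = "\<rho>' * ?T" and ?G = "comparison_wave a1 a2 B \<rho>'"
    have pos: "psi_centered n a1 a2 (?T / 2) > 0" using waveD(6)[OF wave_psi_centered[OF a n]] .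
    \<comment> \<open>The larger \<rho>' makes the norm bound strict, as inverting the rising branch
      demands.\<close>
    have small: "\<bar>Y 0 s\<bar> < ?G n (?H / 2)" for s
    proof -
      have "\<bar>Y 0 s\<bar> \<le> B * \<rho> ^ n * psi_centered n a1 a2 (?T / 2)" using bounded0 by (simp add: norm_bounded_def)
      also have "\<dots> < B * \<rho>' ^ n * psi_centered n a1 a2 (?T / 2)"
        using \<rho>' \<rho> B pos n by (intro mult_strict_right_mono mult_strict_left_mono power_strict_mono) auto
      finally show ?thesis unfolding comparison_wave_top[OF \<rho>'0] .
    qed
    obtain v where v': "\<forall>s. ?G n (v s) = Y 0 s" "\<forall>s t. \<bar>v t - v s\<bar> \<le> \<bar>t - s\<bar>"
      using big.Lipschitz_parameter[OF q(1) q' small] by (elim exE conjE) (rule that)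
    note v = v'[rule_format]
    have n1: "n - 1 \<ge> 1" "Suc (n - 1) = n" using assms by auto
    let ?K = "?G (n - 1) (?H / 2)"
    have w: "wave ?H (?G (n - 1))" by (rule wave_comparison[OF a B \<rho>'0 n1(1)])
    have K: "0 \<le> ?K" using waveD(6)[OF w] by simp
    have GL: "\<bar>?G n t - ?G n s\<bar> \<le> ?K * \<bar>t - s\<bar>" for s t
    proof (rule Lipschitz_of_DERIV_bound)
      show "(?G n has_real_derivative ?G (n - 1) (t + ?H / 2)) (at t)" for t
        using comparison_wave_deriv[OF a B \<rho>'0 n1(1), of t] unfolding n1(2) .
      show "\<bar>?G (n - 1) (t + ?H / 2)\<bar> \<le> ?K" for t by (rule waveD(11)[OF w])
    qed
    have "\<bar>Y 0 t - Y 0 s\<bar> \<le> ?K * \<bar>t - s\<bar>" for s t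
    proof -
      have "\<bar>Y 0 t - Y 0 s\<bar> \<le> ?K * \<bar>v t - v s\<bar>" using GL[of "v t" "v s"] by (simp add: v(1))
      also have "\<dots> \<le> ?K * \<bar>t - s\<bar>" using v(2) K by (intro mult_left_mono) auto
      finally show ?thesis .
    qed
    moreover have "(Y 0 has_real_derivative Y 1 t) (at t)" using dY[of 0 t] assms by simp
    ultimately have "\<bar>Y 1 t\<bar> \<le> ?K" by (rule DERIV_bound_of_Lipschitz[rotated])
    then show ?thesis unfolding comparison_wave_top[OF \<rho>'0] unfolding \<mu>_def \<rho>'_def .
  qed
  define T where "T = ?T"
  \<comment> \<open>The original \<rho> corresponds to \<open>l = 2 * T * \<rho>\<close>, and the
    bound is continuous in \<open>l\<close>.\<close>
  have "isCont (\<lambda>l. B * (l / (2 * T)) ^ (n - 1) * \<mu>) (2 * T * \<rho>)" by (intro continuous_intros) (use T T_def in simp)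
  from le_of_rational_above[OF this, of "\<bar>Y 1 t\<bar>"] main
  have "\<bar>Y 1 t\<bar> \<le> B * ((2 * T * \<rho>) / (2 * T)) ^ (n - 1) * \<mu>" unfolding T_def by blast
  moreover have "(2 * T * \<rho>) / (2 * T) = \<rho>" using T by (simp add: T_def[symmetric])
  ultimately show "\<bar>Y 1 t\<bar> \<le> B * \<rho> ^ (n - 1) * psi_centered (n - 1) a1 a2 (?T / 2)" by (simp only: \<mu>_def)
qed

end

text \<open>Here the chain \<open>Y\<close> consists of the derivatives of \<open>X\<close>, starting with \<open>Y 0 = X'\<close>.\<close>

lemma derivative_excess_le:
  assumes chain: "derivative_chain a1 a2 B \<rho> n Y"
    and dX: "\<And>t. (X has_real_derivative Y 0 t) (at t)" and perX: "\<And>t. X (t + 1) = X t"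
    and bX: "norm_bounded a1 a2 B \<rho> (Suc n) X"
    and l: "l \<in> \<rat>" "\<rho> < \<rho>'" "\<rho>' = l / (2 * (a1 + a2 + 2))" and "y \<ge> 0"
  shows "integral {0..1} (\<lambda>s. max 0 (\<bar>Y 0 s\<bar> - y)) \<le>
    integral {0..1} (\<lambda>s. max 0 (\<bar>comparison_wave a1 a2 B \<rho>' n (l * s - d)\<bar> - y))"
proof -
  interpret c: derivative_chain a1 a2 B \<rho> n Y by (rule chain)
  let ?T = "a1 + a2 + 2"
  note a = c.a and B = c.B and n = c.n
  have T: "?T > 0" using a by simp
  have \<rho>'0: "\<rho>' > 0" using l(2) c.\<rho> by simp
  then have l0: "l > 0" using l(3) T by (simp add: zero_less_divide_iff)
  interpret big: derivative_chain a1 a2 B \<rho>' n Y using c.enlarge l(2) by simp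
  let ?H = "\<rho>' * ?T" and ?g = "comparison_wave a1 a2 B \<rho>' n"
  have H: "?H > 0" "2 * ?H = l" using mult_pos_pos[OF \<rho>'0 T] scale_cancel(1)[OF T l(3)] by auto
  define L where "L = ?H / 2"
  have L: "L > 0" "- L = - ?H / 2" using H by (auto simp: L_def)
  obtain q p where q: "q \<ge> 1" "real q * l = real p" using rational_period[OF l(1) l0] by blast
  have q': "2 * real q * ?H = real p" using q(2) scale_cancel(2)[OF T l(3)] by (simp only:)
  have small: "\<bar>Y 0 s\<bar> < ?g (?H / 2)" for s
  proof -
    have pos: "psi_centered n a1 a2 (?T / 2) > 0" using waveD(6)[OF wave_psi_centered[OF a n]] .
    have "\<bar>Y 0 s\<bar> \<le> B * \<rho> ^ n * psi_centered n a1 a2 (?T / 2)" using c.bounded0 by (simp add: norm_bounded_def)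
    also have "\<dots> < B * \<rho>' ^ n * psi_centered n a1 a2 (?T / 2)"
      using l(2) c.\<rho> B pos n by (intro mult_strict_right_mono mult_strict_left_mono power_strict_mono) auto
    finally show ?thesis unfolding comparison_wave_top[OF \<rho>'0] .
  qed
  obtain v where v': "\<forall>s. \<bar>v s\<bar> \<le> ?H / 2" "\<forall>s. ?g (v s) = Y 0 s" "\<forall>s t. \<bar>v t - v s\<bar> \<le> \<bar>t - s\<bar>" "\<forall>s. Y 0 s = 0 \<longrightarrow> v s = 0"
    using big.Lipschitz_parameter[OF q(1) q' small] by (elim exE conjE) (rule that)
  note v = v'[rule_format, folded L_def]
  have w: "wave ?H ?g" by (rule wave_comparison[OF a B \<rho>'0 n])
  note g = waveD[OF w]
  have gmono: "?g s \<le> ?g t" if "- L \<le> s" "s \<le> t" "t \<le> L" for s t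
    using that unfolding L(2) unfolding L_def by (rule g(5))
  have contv: "continuous_on A v" for A by (rule Lipschitz1_continuous[OF v(3)])
  have contY: "continuous_on UNIV (Y 0)"
  proof -
    have "continuous_on UNIV (\<lambda>s. ?g (v s))" by (rule continuous_on_compose2[OF g(4) contv]) auto
    then show ?thesis by (simp add: v(2))
  qed
  have perY: "Y 0 (t + 1) = Y 0 t" for t using c.per[of 0 t] n by simp
  define I where "I y = integral {0..1} (\<lambda>s. max 0 (\<bar>Y 0 s\<bar> - y))" for y
  define R where "R y = integral {0..1} (\<lambda>s. max 0 (\<bar>?g (l * s - d)\<bar> - y))" for y
  have iY: "(\<lambda>s. max 0 (\<bar>Y 0 s\<bar> - y)) integrable_on {0..1}" for y
    by (intro integrable_continuous_real continuous_intros continuous_on_subset[OF contY]) auto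
  have ig: "(\<lambda>s. max 0 (\<bar>?g (l * s - d)\<bar> - y)) integrable_on {0..1}" for y
    by (intro integrable_continuous_real continuous_intros continuous_on_compose2[OF g(4)]) auto
  have R_eq: "L * R y = integral {0..L} (\<lambda>w. max 0 (\<bar>?g w\<bar> - y))" if "0 \<le> y" for y
    unfolding R_def L_def using wave_excess_mean[OF w that, of d] unfolding H(2) .
  have R0: "0 \<le> R y" for y unfolding R_def by (rule Henstock_Kurzweil_Integration.integral_nonneg[OF ig]) auto
  have gint: "?g integrable_on {a..b}" for a b
    by (rule integrable_continuous_real, rule continuous_on_subset[OF g(4)]) auto
  \<comment> \<open>The translate \<open>?G (t - L)\<close> of the next wave is a primitive of
    \<open>?g\<close> running from \<open>- ?G L\<close> at 0 to 0 at \<open>L\<close>. So the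
    integral is the maximum of the next wave, which bounds \<open>X\<close>.\<close>
  have Xb: "\<bar>X s\<bar> \<le> integral {0..L} ?g" for s
  proof -
    let ?G = "comparison_wave a1 a2 B \<rho>' (Suc n)"
    have "Suc n \<ge> 1" by simp
    note wG = waveD[OF wave_comparison[OF a B \<rho>'0 this]]
    have dG: "((\<lambda>t. ?G (t - L)) has_real_derivative ?g t) (at t)" for t
    proof -
      have "(?G has_real_derivative ?g (t - L + ?H / 2)) (at (t + - L))"
        using comparison_wave_deriv[OF a B \<rho>'0 n, of "t - L"] by simp
      then show ?thesis using DERIV_shift[of ?G _ t "- L"] by (simp add: L_def)
    qed
    have "integral {0..L} ?g = ?G (L - L) - ?G (0 - L)" by (rule integral_of_antiderivative[OF dG]) (use L in simp)
    also have "\<dots> = ?G L" using wG(9) wG(10) unfolding L_def by simp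
    also have "\<dots> = B * \<rho>' ^ Suc n * psi_centered (Suc n) a1 a2 (?T / 2)" unfolding L_def by (rule comparison_wave_top[OF \<rho>'0])
    finally have eq: "integral {0..L} ?g = B * \<rho>' ^ Suc n * psi_centered (Suc n) a1 a2 (?T / 2)" .
    have "norm_bounded a1 a2 B \<rho>' (Suc n) X"
      by (rule norm_bounded_mono[OF a B c.\<rho> _ _ bX]) (use l(2) in auto)
    then show ?thesis unfolding eq norm_bounded_def by blast
  qed
  have pos_case: "I y \<le> R y" if "y > 0" for y
  proof (cases "?g L \<le> y")
    case True
    have "max 0 (\<bar>Y 0 s\<bar> - y) = 0" for s using small[of s] True by (simp add: L_def)
    then have "I y = 0" by (simp add: I_def)
    then show ?thesis using R0 by simp
  next
    case False
    \<comment> \<open>\<open>c\<close> is the place on the quarter period where the wave has height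
      \<open>y\<close>; excess over \<open>y\<close> becomes excess over
      \<open>?g c\<close>.\<close>
    have "\<exists>c. 0 \<le> c \<and> c \<le> L \<and> ?g c = y"
      using False \<open>y > 0\<close> g(9) L by (intro IVT' continuous_on_subset[OF g(4)]) auto
    then obtain c where c: "0 \<le> c" "c \<le> L" "?g c = y" by blast
    have "c \<noteq> 0" "c \<noteq> L" using c(3) \<open>y > 0\<close> g(9) False by auto
    then have c': "0 < c" "c < L" using c by auto
    \<comment> \<open>Periodicity of \<open>X\<close> yields a zero of its derivative. A period
      started there has zeros of \<open>v\<close> at both ends.\<close>
    have "\<exists>z>0. z < 1 \<and> X 1 - X 0 = (1 - 0) * Y 0 z" by (rule MVT2) (use dX in auto)
    then obtain z where z: "Y 0 z = 0" using perX[of 0] by auto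
    have vz: "v z = 0" "v (z + 1) = 0" using z perY by (auto intro: v(4))
    have dX': "(X has_real_derivative ?g (v s)) (at s)" for s using dX v(2) by simp
    have "L * integral {z..z + 1} (\<lambda>s. max 0 (\<bar>?g (v s)\<bar> - ?g c)) \<le> (z + 1 - z) * integral {c..L} (\<lambda>w. ?g w - ?g c)"
      by (rule excess_between_zeros[of v c L ?g X z "z + 1", OF v(3) c' v(1) g(4) g(3) gmono dX' Xb vz]) simp_all
    moreover have "integral {z..z + 1} (\<lambda>s. max 0 (\<bar>?g (v s)\<bar> - ?g c)) = I y"
      unfolding I_def v(2) c(3)
      by (rule integral_period_shift) (use perY in \<open>auto intro!: continuous_intros continuous_on_subset[OF contY]\<close>)
    moreover have "integral {c..L} (\<lambda>w. ?g w - ?g c) = integral {0..L} (\<lambda>w. max 0 (\<bar>?g w\<bar> - y))"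
    proof -
      let ?f = "\<lambda>w. max 0 (\<bar>?g w\<bar> - y)"
      have "?f integrable_on {0..L}"
        by (intro integrable_continuous_real continuous_intros continuous_on_subset[OF g(4)]) auto
      then have "integral {0..L} ?f = integral {0..c} ?f + integral {c..L} ?f"
        using c by (intro Henstock_Kurzweil_Integration.integral_combine[symmetric]) auto
      moreover have "integral {0..c} ?f = integral {0..c} (\<lambda>w. 0)"
      proof (rule Henstock_Kurzweil_Integration.integral_cong)
        fix w assume w: "w \<in> {0..c}"
        have "?g 0 \<le> ?g w" "?g w \<le> ?g c" using w c L by (auto intro!: gmono)
        then show "?f w = 0" using g(9) c(3) by simp
      qed
      moreover have "integral {c..L} ?f = integral {c..L} (\<lambda>w. ?g w - ?g c)"
      proof (rule Henstock_Kurzweil_Integration.integral_cong)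
        fix w assume w: "w \<in> {c..L}"
        have "?g c \<le> ?g w" using w c L by (auto intro!: gmono)
        then show "?f w = ?g w - ?g c" using c(3) \<open>y > 0\<close> by simp
      qed
      ultimately show ?thesis by simp
    qed
    ultimately have "L * I y \<le> L * R y" using R_eq[of y] \<open>y > 0\<close> by simp
    then show ?thesis using L by simp
  qed
  show ?thesis
  proof (cases "y = 0")
    case False
    then show ?thesis using pos_case[of y] \<open>y \<ge> 0\<close> unfolding I_def R_def by simp
  next
    case True
    \<comment> \<open>The component estimates require \<open>c > 0\<close>, so level 0 is approached
      through levels \<open>e > 0\<close>, at a cost of at most \<open>e\<close>.\<close>
    have "I 0 \<le> R 0"
    proof (rule field_le_epsilon)
      fix e :: real assume "e > 0"
      have "I 0 \<le> integral {0..1} (\<lambda>s. max 0 (\<bar>Y 0 s\<bar> - e) + e)"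
        unfolding I_def by (intro integral_le iY integrable_add) auto
      also have "\<dots> = I e + e" unfolding I_def by (subst Henstock_Kurzweil_Integration.integral_add[OF iY]) auto
      also have "I e \<le> R e" by (rule pos_case[OF \<open>e > 0\<close>])
      also have "R e \<le> R 0" unfolding R_def by (intro integral_le ig) (use \<open>e > 0\<close> in auto)
      finally show "I 0 \<le> R 0 + e" by simp
    qed
    then show ?thesis using True unfolding I_def R_def by simp
  qed
qed

text \<open>Neighbouring cells share an endpoint, so the estimates add up along the cells between
  \<open>s\<close> and \<open>t\<close>; the induction runs over their number.\<close>

lemma piecewise_Lipschitz:
  fixes f :: "real \<Rightarrow> real"
  assumes T: "T > 0" and cell: "\<And>j s t. - T / 2 + of_int j * T \<le> s \<Longrightarrow> s \<le> t \<Longrightarrow> t \<le> T / 2 + of_int j * T \<Longrightarrow> \<bar>f t - f s\<bar> \<le> t - s"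
  shows "\<bar>f t - f s\<bar> \<le> \<bar>t - s\<bar>"
proof -
  have chain: "\<bar>f t - f s\<bar> \<le> t - s"
    if "- T / 2 + of_int j * T \<le> s" "s \<le> T / 2 + of_int j * T" "s \<le> t" "- T / 2 + of_int (j + int n) * T \<le> t" "t \<le> T / 2 + of_int (j + int n) * T"
    for n j s t
    using that
  proof (induction n arbitrary: j s)
    case 0
    then show ?case by (intro cell[of j]) auto
  next
    case (Suc n)
    define c where "c = T / 2 + of_int j * T"
    have c: "c = - T / 2 + of_int (j + 1) * T" by (simp add: c_def algebra_simps)
    have j: "j + int (Suc n) = (j + 1) + int n" by simp
    show ?case
    proof (cases "t \<le> c")
      case True
      then show ?thesis using Suc.prems by (intro cell[of j]) (auto simp: c_def)
    next
      case False
      have "\<bar>f c - f s\<bar> \<le> c - s" using Suc.prems by (intro cell[of j]) (auto simp: c_def)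
      moreover have "\<bar>f t - f c\<bar> \<le> t - c"
        by (rule Suc.IH[of "j + 1"]) (use Suc.prems False c T j in \<open>auto simp: c_def algebra_simps\<close>)
      ultimately show ?thesis by linarith
    qed
  qed
  have main: "\<bar>f t - f s\<bar> \<le> t - s" if "s \<le> t" for s t
  proof -
    obtain w j where w: "s = w + of_int j * T" "- T / 2 \<le> w" "w < T / 2" using antiperiodic_reduce[OF T] by blast
    obtain w' j' where w': "t = w' + of_int j' * T" "- T / 2 \<le> w'" "w' < T / 2" using antiperiodic_reduce[OF T] by blast
    have "of_int j * T < of_int (j' + 1) * T" using that w w' by (simp add: algebra_simps)
    then have "j < j' + 1" using T by (simp only: mult_less_cancel_right_pos of_int_less_iff)
    then have "j' = j + int (nat (j' - j))" by simp
    then show ?thesis using chain[of j s t "nat (j' - j)"] w w' that by auto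
  qed
  show ?thesis using main[of s t] main[of t s] by (cases "s \<le> t") (auto simp: abs_minus_commute)
qed

lemma psi_centered_1_Lipschitz:
  assumes a: "a1 \<ge> 0" "a2 \<ge> 0"
  shows "\<bar>psi_centered 1 a1 a2 t - psi_centered 1 a1 a2 s\<bar> \<le> \<bar>t - s\<bar>"
proof (rule piecewise_Lipschitz)
  let ?T = "a1 + a2 + 2"
  show "?T > 0" using a by simp
  note w = waveD[OF wave_psi_centered_1[OF a]]
  fix j s t assume st: "- ?T / 2 + of_int j * ?T \<le> s" "s \<le> t" "t \<le> ?T / 2 + of_int j * ?T"
  define s' where "s' = s - of_int j * ?T"
  define t' where "t' = t - of_int j * ?T"
  have r: "- ?T / 2 \<le> s'" "s' \<le> t'" "t' \<le> ?T / 2" using st unfolding s'_def t'_def by linarith+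
  have "psi_centered 1 a1 a2 s = (if even j then psi_centered 1 a1 a2 s' else - psi_centered 1 a1 a2 s')"
    "psi_centered 1 a1 a2 t = (if even j then psi_centered 1 a1 a2 t' else - psi_centered 1 a1 a2 t')"
    using antiperiodic_int[of "psi_centered 1 a1 a2" ?T s' j, OF w(2)] antiperiodic_int[of "psi_centered 1 a1 a2" ?T t' j, OF w(2)]
    by (simp_all add: s'_def t'_def)
  then have e: "\<bar>psi_centered 1 a1 a2 t - psi_centered 1 a1 a2 s\<bar> = \<bar>psi_centered 1 a1 a2 t' - psi_centered 1 a1 a2 s'\<bar>" by auto
  have v: "psi_centered 1 a1 a2 s' = max 0 (min 1 (s' - a1 / 2)) - max 0 (min 1 (- s' - a1 / 2))"
    "psi_centered 1 a1 a2 t' = max 0 (min 1 (t' - a1 / 2)) - max 0 (min 1 (- t' - a1 / 2))"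
    by (rule psi_centered_1[OF a]; use r in linarith)+
  define h where "h = a1 / 2"
  have "h \<ge> 0" using a by (simp add: h_def)
  then have "\<bar>psi_centered 1 a1 a2 t' - psi_centered 1 a1 a2 s'\<bar> \<le> t' - s'"
    using r(2) unfolding v h_def[symmetric] by (simp add: max_def min_def)
  then show "\<bar>psi_centered 1 a1 a2 t - psi_centered 1 a1 a2 s\<bar> \<le> t - s" unfolding e by (simp add: s'_def t'_def)
qed

section \<open>Derivatives and norms of \<open>Psi\<close>\<close>

lemma Psi_alt:
  assumes "a1 \<ge> 0" "a2 \<ge> 0" "lam > 0" "\<rho> = lam / (2 * (a1 + a2 + 2))"
  shows "Psi n a1 a2 b lam t = b * \<rho> ^ n * psi n a1 a2 (t / \<rho>)"
proof -
  define T where "T = a1 + a2 + 2"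
  have T: "T > 0" using assms by (simp add: T_def)
  have e: "2 * a1 + 2 * a2 + 4 = 2 * T" by (simp add: T_def)
  have r: "\<rho> = lam / (2 * T)" using assms by (simp add: T_def)
  then have q: "(2 * T) / lam * t = t / \<rho>" using T assms(3) by simp
  show ?thesis unfolding Psi_def e q r[symmetric] ..
qed

lemma continuous_psi:
  assumes "a1 \<ge> 0" "a2 \<ge> 0" "n \<ge> 1"
  shows "continuous_on UNIV (psi n a1 a2)"
  unfolding psi_of_centered[abs_def]
  by (intro continuous_on_compose2[OF waveD(4)[OF wave_psi_centered[OF assms]]] continuous_intros) auto

lemma Psi_has_derivative:
  assumes "a1 \<ge> 0" "a2 \<ge> 0" "lam > 0" "n \<ge> 1"
  shows "(Psi (Suc n) a1 a2 b lam has_real_derivative Psi n a1 a2 b lam t) (at t)"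
proof -
  define \<rho> where "\<rho> = lam / (2 * (a1 + a2 + 2))"
  have \<rho>: "\<rho> > 0" using assms by (simp add: \<rho>_def)
  note e = Psi_alt[OF assms(1-3) \<rho>_def]
  have "((\<lambda>t. psi (Suc n) a1 a2 (t / \<rho>)) has_real_derivative psi n a1 a2 (t / \<rho>) * (1 / \<rho>)) (at t)"
    using \<rho> by (intro DERIV_chain2[OF psi_centered_Suc(1)[OF assms(1,2,4) wave_psi_centered[OF assms(1,2,4)]]])
      (auto intro!: derivative_eq_intros)
  from DERIV_cmult[OF this, of "b * \<rho> ^ Suc n"]
  have "((\<lambda>t. b * \<rho> ^ Suc n * psi (Suc n) a1 a2 (t / \<rho>)) has_real_derivative b * \<rho> ^ n * psi n a1 a2 (t / \<rho>)) (at t)"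
    using \<rho> by (simp add: mult_ac)
  then show ?thesis unfolding e[abs_def] .
qed

lemma deriv_funpow_Psi:
  assumes "a1 \<ge> 0" "a2 \<ge> 0" "lam > 0" "k < r"
  shows "(deriv ^^ k) (Psi r a1 a2 b lam) = Psi (r - k) a1 a2 b lam"
  using \<open>k < r\<close>
proof (induction k)
  case (Suc k)
  then have e: "r - k = Suc (r - Suc k)" "r - Suc k \<ge> 1" by auto
  have "deriv (Psi (Suc (r - Suc k)) a1 a2 b lam) = Psi (r - Suc k) a1 a2 b lam"
    using Psi_has_derivative[OF assms(1-3) e(2)] by (intro ext DERIV_imp_deriv)
  then show ?case using Suc e(1) by simp
qed simp

lemma continuous_Psi:
  assumes "a1 \<ge> 0" "a2 \<ge> 0" "lam > 0" "n \<ge> 1"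
  shows "continuous_on UNIV (Psi n a1 a2 b lam)"
proof -
  have "continuous_on UNIV (\<lambda>t. psi n a1 a2 (t / (lam / (2 * (a1 + a2 + 2)))))"
    using assms by (intro continuous_on_compose2[OF continuous_psi[OF assms(1,2,4)]] continuous_intros) auto
  then show ?thesis unfolding Psi_alt[OF assms(1-3) refl, abs_def] by (intro continuous_intros)
qed

lemma Psi_bound:
  assumes "a1 \<ge> 0" "a2 \<ge> 0" "lam > 0" "n \<ge> 1" "\<rho> = lam / (2 * (a1 + a2 + 2))"
  shows "\<bar>Psi n a1 a2 b lam t\<bar> \<le> \<bar>b\<bar> * \<rho> ^ n * psi_centered n a1 a2 ((a1 + a2 + 2) / 2)"
proof -
  have \<rho>: "\<rho> > 0" using assms by simp
  have "\<bar>psi n a1 a2 (t / \<rho>)\<bar> \<le> psi_centered n a1 a2 ((a1 + a2 + 2) / 2)"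
    unfolding psi_of_centered[of n a1 a2] by (rule waveD(11)[OF wave_psi_centered[OF assms(1,2,4)]])
  then show ?thesis unfolding Psi_alt[OF assms(1-3,5)] using \<rho>
    by (simp add: abs_mult power_abs mult_left_mono)
qed

lemma Lipschitz_imp_loc_abs_cont:
  assumes "\<And>s t. \<bar>f t - f s\<bar> \<le> K * \<bar>t - s\<bar>"
  shows "loc_abs_cont f"
  unfolding loc_abs_cont_def abs_cont_on_def
proof (intro allI impI)
  fix a b \<epsilon> :: real assume "\<epsilon> > 0"
  have K: "K \<ge> 0" using assms[of 1 0] by simp
  show "\<exists>\<delta>>0. \<forall>D. finite D \<and> (\<forall>(u, v)\<in>D. a \<le> u \<and> u \<le> v \<and> v \<le> b) \<and>
        disjoint_family_on (\<lambda>(u, v). {u<..<v}) D \<and> (\<Sum>(u, v)\<in>D. v - u) < \<delta> \<longrightarrow>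
        (\<Sum>(u, v)\<in>D. \<bar>f v - f u\<bar>) < \<epsilon>"
  proof (intro exI[of _ "\<epsilon> / (K + 1)"] conjI allI impI)
    show "\<epsilon> / (K + 1) > 0" using K \<open>\<epsilon> > 0\<close> by simp
    fix D :: "(real \<times> real) set" assume D: "finite D \<and> (\<forall>(u, v)\<in>D. a \<le> u \<and> u \<le> v \<and> v \<le> b) \<and>
        disjoint_family_on (\<lambda>(u, v). {u<..<v}) D \<and> (\<Sum>(u, v)\<in>D. v - u) < \<epsilon> / (K + 1)"
    have "(\<Sum>(u, v)\<in>D. \<bar>f v - f u\<bar>) \<le> (\<Sum>i\<in>D. (K + 1) * (case i of (u, v) \<Rightarrow> v - u))"
    proof (rule sum_mono)
      fix i assume "i \<in> D"
      obtain u v where i: "i = (u, v)" by force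
      then have "u \<le> v" using D \<open>i \<in> D\<close> by auto
      then have "\<bar>f v - f u\<bar> \<le> K * (v - u)" "K * (v - u) \<le> (K + 1) * (v - u)"
        using assms[of v u] by (auto intro: mult_right_mono)
      then show "(case i of (u, v) \<Rightarrow> \<bar>f v - f u\<bar>) \<le> (K + 1) * (case i of (u, v) \<Rightarrow> v - u)" unfolding i by simp
    qed
    also have "\<dots> = (K + 1) * (\<Sum>(u, v)\<in>D. v - u)" by (simp add: sum_distrib_left)
    also have "\<dots> < \<epsilon>" using D K by (simp add: pos_less_divide_eq mult.commute)
    finally show "(\<Sum>(u, v)\<in>D. \<bar>f v - f u\<bar>) < \<epsilon>" .
  qed
qed

lemma Linf_norm_leI:
  assumes "f \<in> borel_measurable lebesgue" "AE t in lebesgue. \<bar>f t\<bar> \<le> C"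
  shows "Linf_norm f \<le> ereal C"
  unfolding Linf_norm_def
proof (rule esssup_I)
  show "(\<lambda>t. ereal \<bar>f t\<bar>) \<in> borel_measurable lebesgue" using assms(1) by measurable
  show "AE t in lebesgue. ereal \<bar>f t\<bar> \<le> ereal C" using assms(2) by simp
qed

lemma AE_le_of_Linf_norm:
  assumes "Linf_norm f \<le> ereal C"
  shows "AE t in lebesgue. \<bar>f t\<bar> \<le> C"
proof -
  have "AE t in lebesgue. ereal \<bar>f t\<bar> \<le> Linf_norm f" unfolding Linf_norm_def by (rule esssup_AE)
  then show ?thesis
  proof eventually_elim
    case (elim t)
    then have "ereal \<bar>f t\<bar> \<le> ereal C" using assms order_trans by blast
    then show ?case by simp
  qed
qed

text \<open>The exceptional set is open, and an open null set is empty.\<close>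

lemma le_of_AE_le_continuous:
  fixes f :: "real \<Rightarrow> real"
  assumes f: "continuous_on UNIV f" and ae: "AE t in lebesgue. \<bar>f t\<bar> \<le> C"
  shows "\<bar>f t\<bar> \<le> C"
proof -
  let ?S = "{t. C < \<bar>f t\<bar>}"
  have op: "open ?S" by (intro open_Collect_less continuous_intros f)
  then have "{t \<in> space lebesgue. \<not> \<bar>f t\<bar> \<le> C} \<in> sets lebesgue" by (simp add: not_le)
  from AE_iff_null[OF this] ae have "?S \<in> null_sets lebesgue" by (simp add: not_le)
  then have "negligible ?S" by (simp add: negligible_iff_null_sets)
  then have "?S = {}" using op open_not_negligible by blast
  then show ?thesis by (auto simp: not_less)
qed

text \<open>The amplitude \<open>\<bar>b\<bar> * \<rho>\<close> and the speed
  \<open>1 / \<rho>\<close> of the argument cancel, so \<open>Psi 1\<close> is Lipschitz with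
  constant \<open>\<bar>b\<bar>\<close>; this bounds its derivative wherever one exists, hence off a
  null set.\<close>

lemma Linf_norm_deriv_Psi:
  assumes a: "a1 \<ge> 0" "a2 \<ge> 0" and lam: "lam > 0"
  shows "Linf_norm (deriv (Psi 1 a1 a2 b lam)) \<le> ereal \<bar>b\<bar>"
proof -
  define \<rho> where "\<rho> = lam / (2 * (a1 + a2 + 2))"
  have \<rho>: "\<rho> > 0" using assms by (simp add: \<rho>_def)
  have lip: "\<bar>Psi 1 a1 a2 b lam t - Psi 1 a1 a2 b lam s\<bar> \<le> \<bar>b\<bar> * \<bar>t - s\<bar>" for s t
  proof -
    have psi1: "psi 1 a1 a2 u = psi_centered 1 a1 a2 (u - a1 / 2)" for u
      using psi_of_centered[of 1 a1 a2 u] by simp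
    have "\<bar>psi 1 a1 a2 (t / \<rho>) - psi 1 a1 a2 (s / \<rho>)\<bar> \<le> \<bar>t / \<rho> - s / \<rho>\<bar>"
      using psi_centered_1_Lipschitz[OF a, of "t / \<rho> - a1 / 2" "s / \<rho> - a1 / 2"] unfolding psi1 by simp
    also have "\<dots> = \<bar>t - s\<bar> / \<rho>" using \<rho> by (simp add: diff_divide_distrib[symmetric] abs_divide)
    finally have *: "\<bar>psi 1 a1 a2 (t / \<rho>) - psi 1 a1 a2 (s / \<rho>)\<bar> \<le> \<bar>t - s\<bar> / \<rho>" .
    have "\<bar>Psi 1 a1 a2 b lam t - Psi 1 a1 a2 b lam s\<bar> = \<bar>b * \<rho> * (psi 1 a1 a2 (t / \<rho>) - psi 1 a1 a2 (s / \<rho>))\<bar>"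
      unfolding Psi_alt[OF a lam \<rho>_def] by (simp only: right_diff_distrib power_one_right)
    also have "\<dots> = \<bar>b\<bar> * \<rho> * \<bar>psi 1 a1 a2 (t / \<rho>) - psi 1 a1 a2 (s / \<rho>)\<bar>"
      by (simp only: abs_mult abs_of_pos[OF \<rho>])
    also have "\<dots> \<le> \<bar>b\<bar> * \<rho> * (\<bar>t - s\<bar> / \<rho>)" by (rule mult_left_mono[OF *]) (use \<rho> in simp)
    also have "\<dots> = \<bar>b\<bar> * \<bar>t - s\<bar>" using \<rho> by simp
    finally show ?thesis .
  qed
  have ac: "loc_abs_cont (Psi 1 a1 a2 b lam)" by (rule Lipschitz_imp_loc_abs_cont[OF lip])
  have "{t. \<not> Psi 1 a1 a2 b lam differentiable (at t)} \<in> null_sets lebesgue"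
    using loc_abs_cont_AE_differentiable[OF ac] by (simp add: negligible_iff_null_sets)
  then have "AE t in lebesgue. \<bar>deriv (Psi 1 a1 a2 b lam) t\<bar> \<le> \<bar>b\<bar>"
  proof (rule AE_I')
    have "\<bar>deriv (Psi 1 a1 a2 b lam) t\<bar> \<le> \<bar>b\<bar>" if "Psi 1 a1 a2 b lam differentiable (at t)" for t
    proof (rule DERIV_bound_of_Lipschitz[OF _ lip])
      show "(Psi 1 a1 a2 b lam has_real_derivative deriv (Psi 1 a1 a2 b lam) t) (at t)"
        using that by (simp only: DERIV_deriv_iff_real_differentiable)
    qed
    then show "{t \<in> space lebesgue. \<not> \<bar>deriv (Psi 1 a1 a2 b lam) t\<bar> \<le> \<bar>b\<bar>} \<subseteq> {t. \<not> Psi 1 a1 a2 b lam differentiable (at t)}"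
      by auto
  qed
  then show ?thesis by (intro Linf_norm_leI loc_abs_cont_deriv_measurable[OF ac])
qed

text \<open>\<open>deriv\<close> picks a value satisfying a predicate, and the predicates at
  \<open>t + d\<close> and at \<open>t\<close> coincide; so equality holds even where no derivative
  exists.\<close>

lemma deriv_periodic:
  fixes f :: "real \<Rightarrow> real"
  assumes "\<And>t. f (t + d) = f t"
  shows "deriv f (t + d) = deriv f t"
proof -
  have "(f has_real_derivative D) (at (t + d)) \<longleftrightarrow> (f has_real_derivative D) (at t)" for D
    using DERIV_shift[of f D t d] assms by simp
  then show ?thesis unfolding deriv_def by simp
qed

text \<open>At level 0 the excess is the rearrangement itself, so its measurability is already
  available.\<close>

lemma decr_rearr_measurable:
  assumes "f \<in> borel_measurable borel" "\<And>s. f s \<le> K" "0 \<le> K"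
  shows "(\<lambda>u. decr_rearr f u * indicator {0..t} u) \<in> borel_measurable lborel"
proof -
  obtain R where R': "\<forall>u. decr_rearr f u = ennreal (R u)" "\<forall>u. 0 \<le> R u"
    "\<forall>z u. 0 \<le> z \<longrightarrow> (z < R u \<longleftrightarrow> ennreal u < emeasure lborel {s \<in> {0..1}. f s > z})"
    using decr_rearr_real[OF assms(1-3)] by (elim exE conjE) (rule that)
  note R = R'[rule_format]
  have "(\<lambda>u. indicator {0..} u * max 0 (R u - 0)) \<in> borel_measurable borel"
    by (rule excess_equimeasurable(1)[where f = f and R = R, OF assms(1) R(2,3)]) simp_all
  then have "(\<lambda>u. ennreal (indicator {0..} u * max 0 (R u - 0)) * indicator {0..t} u) \<in> borel_measurable lborel" by simp
  moreover have "ennreal (indicator {0..} u * max 0 (R u - 0)) * indicator {0..t} u = decr_rearr f u * indicator {0..t} u" for u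
    using R(2)[of u] unfolding R(1) by (cases "u \<in> {0..t}") auto
  ultimately show ?thesis by simp
qed

text \<open>Without plateaus the wave of order 1 and period 1 is a triangle with corners at
  \<open>1 / 4\<close> and \<open>3 / 4\<close>.\<close>

lemma Psi_slope_triangle:
  assumes "0 \<le> s" "s \<le> 1" "s \<noteq> 1 / 4" "s \<noteq> 3 / 4"
  shows "\<bar>deriv (Psi 1 0 0 b 1) s\<bar> = \<bar>b\<bar>"
proof -
  have psi1: "psi 1 0 0 u = psi_centered 1 0 0 u" for u using psi_of_centered[of 1 0 0 u] by simp
  have w: "wave 2 (psi_centered 1 0 0)" using wave_psi_centered_1[of 0 0] by simp
  have mid: "psi_centered 1 0 0 u = u" if "\<bar>u\<bar> < 1" for u
    using psi_centered_1[of 0 0 u] that by (auto simp: max_def min_def abs_less_iff)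
  have P: "Psi 1 0 0 b 1 t = b / 4 * psi_centered 1 0 0 (4 * t)" for t
  proof -
    have P0: "Psi 1 0 0 b 1 t = b * (1 / 4) ^ 1 * psi 1 0 0 (t / (1 / 4))" by (rule Psi_alt) simp_all
    have e: "t / (1 / 4) = 4 * t" by simp
    show ?thesis unfolding P0 e psi1 by simp
  qed
  \<comment> \<open>\<open>j\<close> numbers the monotone branch through \<open>s\<close>, and its
    parity gives the sign of the slope relative to \<open>b\<close>.\<close>
  define j :: int where "j = (if s < 1 / 4 then 0 else if s < 3 / 4 then 1 else 2)"
  define \<sigma> :: real where "\<sigma> = (if even j then 1 else - 1)"
  have j: "\<bar>4 * s - 2 * of_int j\<bar> < 1" using assms by (auto simp: j_def abs_less_iff)
  have eq: "Psi 1 0 0 b 1 t = \<sigma> * b / 4 * (4 * t - 2 * of_int j)" if "\<bar>4 * t - 2 * of_int j\<bar> < 1" for t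
    using antiperiodic_int[of "psi_centered 1 0 0" 2 "4 * t - 2 * of_int j" j, OF waveD(2)[OF w]] mid[OF that]
    unfolding P \<sigma>_def by (simp add: mult.commute)
  have "((\<lambda>t. \<sigma> * b / 4 * (4 * t - 2 * of_int j)) has_real_derivative \<sigma> * b) (at s)"
    by (auto intro!: derivative_eq_intros)
  then have "(Psi 1 0 0 b 1 has_real_derivative \<sigma> * b) (at s)"
  proof (rule has_field_derivative_transform_within_open)
    show "open {t. \<bar>4 * t - 2 * of_int j\<bar> < (1::real)}" by (intro open_Collect_less continuous_intros)
    show "s \<in> {t. \<bar>4 * t - 2 * of_int j\<bar> < 1}" using j by simp
    show "\<sigma> * b / 4 * (4 * t - 2 * of_int j) = Psi 1 0 0 b 1 t" if "t \<in> {t. \<bar>4 * t - 2 * of_int j\<bar> < 1}" for t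
      using eq that by simp
  qed
  then have "deriv (Psi 1 0 0 b 1) s = \<sigma> * b" by (rule DERIV_imp_deriv)
  then show ?thesis by (simp add: \<sigma>_def abs_mult)
qed

text \<open>For \<open>u < 1\<close> the number \<open>\<bar>b\<bar>\<close> separates the two
  sides: it bounds \<open>f\<close> almost everywhere, and it is the modulus of the slope of the
  triangle off two points. For \<open>u\<close> at least 1 the left side is 0.\<close>

lemma rearrangement_order_one:
  assumes f: "f \<in> borel_measurable lebesgue" "AE s in lebesgue. \<bar>f s\<bar> \<le> \<bar>b\<bar>" and "0 \<le> u"
  shows "decr_rearr (\<lambda>s. \<bar>f s\<bar>) u \<le> decr_rearr (\<lambda>s. \<bar>deriv (Psi 1 0 0 b 1) s\<bar>) u"
proof (cases "u < 1")
  case False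
  have "decr_rearr (\<lambda>s. \<bar>f s\<bar>) u \<le> ennreal 0" unfolding decr_rearr_def
  proof (rule Inf_lower, intro CollectI exI conjI)
    have "emeasure lebesgue {s \<in> {0..1}. \<bar>f s\<bar> > 0} \<le> emeasure lebesgue {0..1::real}" by (rule emeasure_mono) auto
    also have "\<dots> = ennreal 1" by simp
    also have "\<dots> \<le> ennreal u" using False by (intro ennreal_leI) simp
    finally show "emeasure lebesgue {s \<in> {0..1}. \<bar>f s\<bar> > 0} \<le> ennreal u" .
  qed auto
  then show ?thesis by simp
next
  case True
  have "decr_rearr (\<lambda>s. \<bar>f s\<bar>) u \<le> ennreal \<bar>b\<bar>" unfolding decr_rearr_def
  proof (rule Inf_lower, intro CollectI exI conjI)
    have "{t \<in> space lebesgue. \<not> \<bar>f t\<bar> \<le> \<bar>b\<bar>} \<in> sets lebesgue" using f(1) by measurable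
    from AE_iff_null[OF this] f(2) have "{t. \<not> \<bar>f t\<bar> \<le> \<bar>b\<bar>} \<in> null_sets lebesgue" by simp
    then have n: "emeasure lebesgue {t. \<not> \<bar>f t\<bar> \<le> \<bar>b\<bar>} = 0" "{t. \<not> \<bar>f t\<bar> \<le> \<bar>b\<bar>} \<in> sets lebesgue"
      by (rule null_setsD1, rule null_setsD2)
    have sub: "{s \<in> {0..1}. \<bar>f s\<bar> > \<bar>b\<bar>} \<subseteq> {t. \<not> \<bar>f t\<bar> \<le> \<bar>b\<bar>}" by auto
    have "emeasure lebesgue {s \<in> {0..1}. \<bar>f s\<bar> > \<bar>b\<bar>} \<le> 0"
      using emeasure_mono[OF sub n(2)] unfolding n(1) .
    then show "emeasure lebesgue {s \<in> {0..1}. \<bar>f s\<bar> > \<bar>b\<bar>} \<le> ennreal u" using order_trans zero_le by blast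
  qed auto
  also have "\<dots> \<le> decr_rearr (\<lambda>s. \<bar>deriv (Psi 1 0 0 b 1) s\<bar>) u" unfolding decr_rearr_def
  proof (rule Inf_greatest)
    let ?g = "\<lambda>s. \<bar>deriv (Psi 1 0 0 b 1) s\<bar>"
    fix e assume "e \<in> {ennreal y | y. 0 \<le> y \<and> emeasure lebesgue {s \<in> {0..1}. ?g s > y} \<le> ennreal u}"
    then obtain y where y: "e = ennreal y" "0 \<le> y" "emeasure lebesgue {s \<in> {0..1}. ?g s > y} \<le> ennreal u" by blast
    have "\<bar>b\<bar> \<le> y"
    proof (rule ccontr)
      assume "\<not> \<bar>b\<bar> \<le> y"
      then have sub: "{0..1} - {1 / 4, 3 / 4} \<subseteq> {s \<in> {0..1}. ?g s > y}" using Psi_slope_triangle by auto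
      have null: "{1 / 4, 3 / 4 :: real} \<in> null_sets lebesgue" by (simp add: negligible_iff_null_sets[symmetric])
      \<comment> \<open>Monotonicity of \<open>emeasure\<close> asks for measurability of the larger
        set, whose description involves \<open>deriv\<close> at the corners; it arises from a
        measurable set by adding at most two points.\<close>
      define G where "G = {s \<in> {0..1}. ?g s > y}"
      have eq: "({0..1} - {1 / 4, 3 / 4}) \<union> ({1 / 4, 3 / 4} \<inter> G) = G" using sub unfolding G_def[symmetric] by (auto simp: G_def)
      have "{1 / 4, 3 / 4} \<inter> G \<in> sets lebesgue"
        by (rule negligible_imp_sets) (rule negligible_finite, simp)
      moreover have "{0..1} - {1 / 4, 3 / 4 :: real} \<in> sets lebesgue" by auto
      ultimately have "({0..1} - {1 / 4, 3 / 4}) \<union> ({1 / 4, 3 / 4} \<inter> G) \<in> sets lebesgue" by (intro sets.Un)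
      then have m: "{s \<in> {0..1}. ?g s > y} \<in> sets lebesgue" unfolding eq unfolding G_def .
      have "ennreal 1 = emeasure lebesgue ({0..1} - {1 / 4, 3 / 4 :: real})"
        using emeasure_Diff_null_set[OF null, of "{0..1}"] by simp
      also have "\<dots> \<le> ennreal u" using emeasure_mono[OF sub m] y(3) by (rule order_trans)
      finally show False using True \<open>0 \<le> u\<close> by (simp add: ennreal_le_iff)
    qed
    then show "ennreal \<bar>b\<bar> \<le> e" unfolding y(1) by (rule ennreal_leI)
  qed
  finally show ?thesis .
qed

text \<open>The chain of \<open>x\<close> serves to bound \<open>x'\<close>, and the chain of
  \<open>x'\<close>, shorter by one, gives the excess integrals. The alternative
  \<open>r \<ge> 3\<close> or \<open>a1 = 0\<close> in \<open>cond\<close> ensures that the shorter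
  chain still contains an order at which the comparison can start.\<close>

lemma theorem3_order_ge_2:
  fixes r :: nat and x :: "real \<Rightarrow> real" and a1 a2 lam b :: real
  assumes r: "r \<ge> 2" and x: "x \<in> Lr_inf r" and per: "\<forall>t. x (t + 1) = x t"
    and a: "a1 \<ge> 0" "a2 \<ge> 0" and lam: "lam > 0" and b: "b \<noteq> 0"
    and norm0: "Linf_norm x \<le> Linf_norm (Psi r a1 a2 b lam)"
    and normr: "Linf_norm ((deriv ^^ r) x) \<le> Linf_norm ((deriv ^^ r) (Psi r a1 a2 b lam))"
    and cond: "(a1 = 0 \<and> Linf_norm ((deriv ^^ (r - 1)) x) \<le> Linf_norm ((deriv ^^ (r - 1)) (Psi r a1 a2 b lam))) \<or>
       ((r \<ge> 3 \<or> a1 = 0) \<and> Linf_norm ((deriv ^^ (r - 2)) x) \<le> Linf_norm ((deriv ^^ (r - 2)) (Psi r a1 a2 b lam)) \<and>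
         (a2 = 0 \<or> Linf_norm ((deriv ^^ (r - 1)) x) \<le> Linf_norm ((deriv ^^ (r - 1)) (Psi r a1 a2 b lam))))"
    and t: "t > 0"
  shows "(\<integral>\<^sup>+u\<in>{0..t}. decr_rearr (\<lambda>s. \<bar>deriv x s\<bar>) u \<partial>lborel)
           \<le> ennreal (lam ^ (r - 1)) * (\<integral>\<^sup>+u\<in>{0..t}. decr_rearr (\<lambda>s. \<bar>deriv (Psi r a1 a2 b 1) s\<bar>) u \<partial>lborel)"
proof -
  define Y where "Y k = (deriv ^^ k) x" for k
  define \<rho> where "\<rho> = lam / (2 * (a1 + a2 + 2))"
  define B where "B = \<bar>b\<bar>"
  have B: "B > 0" and \<rho>: "\<rho> > 0" using a b lam by (auto simp: B_def \<rho>_def)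
  have Y0: "Y 0 = x" by (simp add: Y_def)
  have YS: "Y (Suc k) = deriv (Y k)" for k by (simp add: Y_def)
  have diff: "Y k differentiable (at t)" if "k < r - 1" for k t using x that by (auto simp: Lr_inf_def Y_def)
  have ac: "loc_abs_cont (Y (r - 1))" using x by (auto simp: Lr_inf_def Y_def)
  have dY: "(Y k has_real_derivative Y (Suc k) t) (at t)" if "k < r - 1" for k t
    using diff[OF that, of t] by (simp add: YS DERIV_deriv_iff_real_differentiable)
  have contY: "continuous_on UNIV (Y k)" if "k < r" for k
  proof (cases "k = r - 1")
    case True
    then show ?thesis using loc_abs_cont_isCont[OF ac] by (simp add: continuous_at_imp_continuous_on)
  next
    case False
    then have "isCont (Y k) s" for s using that by (intro DERIV_isCont[OF dY]) simp
    then show ?thesis by (simp add: continuous_at_imp_continuous_on)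
  qed
  have perY: "Y k (s + 1) = Y k s" for k s
  proof (induction k arbitrary: s)
    case 0
    then show ?case using per by (simp add: Y0)
  next
    case (Suc k)
    show ?case unfolding YS by (rule deriv_periodic[where f = "Y k" and d = 1, OF Suc.IH])
  qed
  \<comment> \<open>Below order \<open>r\<close> the derivatives are continuous, so essential bounds
    become pointwise ones.\<close>
  have bound: "norm_bounded a1 a2 B \<rho> (r - k) (Y k)"
    if "k < r" "Linf_norm ((deriv ^^ k) x) \<le> Linf_norm ((deriv ^^ k) (Psi r a1 a2 b lam))" for k
  proof -
    have k: "r - k \<ge> 1" using that(1) by simp
    have c: "Psi (r - k) a1 a2 b lam \<in> borel_measurable lebesgue"
      using borel_measurable_continuous_onI[OF continuous_Psi[OF a lam k]] by (simp add: measurable_completion)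
    have "Linf_norm (Psi (r - k) a1 a2 b lam) \<le> ereal (B * \<rho> ^ (r - k) * psi_centered (r - k) a1 a2 ((a1 + a2 + 2) / 2))"
      by (rule Linf_norm_leI[OF c]) (use Psi_bound[OF a lam k \<rho>_def] in \<open>simp add: B_def\<close>)
    then have "Linf_norm (Y k) \<le> ereal (B * \<rho> ^ (r - k) * psi_centered (r - k) a1 a2 ((a1 + a2 + 2) / 2))"
      using that(2) unfolding deriv_funpow_Psi[OF a lam that(1)] Y_def by (rule order_trans[rotated])
    from le_of_AE_le_continuous[OF contY[OF that(1)] AE_le_of_Linf_norm[OF this]] show ?thesis
      unfolding norm_bounded_def by blast
  qed
  have lip: "\<bar>Y (r - 1) t - Y (r - 1) s\<bar> \<le> B * \<bar>t - s\<bar>" for s t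
  proof (rule loc_abs_cont_Lipschitz[OF ac])
    have e: "r = Suc (r - 1)" "r - (r - 1) = 1" "r - 1 < r" using r by auto
    have "(deriv ^^ r) (Psi r a1 a2 b lam) = deriv ((deriv ^^ (r - 1)) (Psi r a1 a2 b lam))"
      by (subst e(1), simp only: funpow.simps o_apply)
    also have "\<dots> = deriv (Psi 1 a1 a2 b lam)" using deriv_funpow_Psi[OF a lam e(3), of b] unfolding e(2) by simp
    finally have "Linf_norm ((deriv ^^ r) x) \<le> ereal B"
      using normr Linf_norm_deriv_Psi[OF a lam, of b] unfolding B_def by (metis order_trans)
    moreover have "(deriv ^^ r) x = deriv (Y (r - 1))" using YS[of "r - 1"] e(1) by (simp add: Y_def)
    ultimately show "AE t in lebesgue. \<bar>deriv (Y (r - 1)) t\<bar> \<le> B" by (metis AE_le_of_Linf_norm)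
  qed
  have b0: "norm_bounded a1 a2 B \<rho> r (Y 0)" using bound[of 0] norm0 r by (simp add: Y0)
  have b1: "norm_bounded a1 a2 B \<rho> 1 (Y (r - 1))"
    if "Linf_norm ((deriv ^^ (r - 1)) x) \<le> Linf_norm ((deriv ^^ (r - 1)) (Psi r a1 a2 b lam))"
    using bound[of "r - 1"] that r by simp
  have b2: "norm_bounded a1 a2 B \<rho> 2 (Y (r - 2))"
    if "Linf_norm ((deriv ^^ (r - 2)) x) \<le> Linf_norm ((deriv ^^ (r - 2)) (Psi r a1 a2 b lam))"
    using bound[of "r - 2"] that r by simp
  have cond': "(a1 = 0 \<and> norm_bounded a1 a2 B \<rho> 1 (Y (r - 1))) \<or>
      ((r \<ge> 3 \<or> a1 = 0) \<and> norm_bounded a1 a2 B \<rho> 2 (Y (r - 2)) \<and> (a2 = 0 \<or> norm_bounded a1 a2 B \<rho> 1 (Y (r - 1))))"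
    using cond b1 b2 by blast
  have chain: "derivative_chain a1 a2 B \<rho> r Y"
  proof
    show "(a1 = 0 \<and> norm_bounded a1 a2 B \<rho> 1 (Y (r - 1))) \<or>
      (r \<ge> 2 \<and> norm_bounded a1 a2 B \<rho> 2 (Y (r - 2)) \<and> (a2 = 0 \<or> norm_bounded a1 a2 B \<rho> 1 (Y (r - 1))))"
      using cond' r by blast
    show "(Y k has_real_derivative Y (Suc k) t) (at t)" if "Suc k < r" for k t using that by (intro dY) simp
  qed (use a B \<rho> r perY lip b0 in auto)
  have bY1: "norm_bounded a1 a2 B \<rho> (r - 1) (Y 1)" by (rule derivative_chain.first_derivative_bounded[OF chain r])
  have chain': "derivative_chain a1 a2 B \<rho> (r - 1) (\<lambda>k. Y (Suc k))"
  proof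
    have e: "Suc (r - 1 - 1) = r - 1" using r by simp
    show "\<bar>Y (Suc (r - 1 - 1)) t - Y (Suc (r - 1 - 1)) s\<bar> \<le> B * \<bar>t - s\<bar>" for s t unfolding e by (rule lip)
    show "(a1 = 0 \<and> norm_bounded a1 a2 B \<rho> 1 (Y (Suc (r - 1 - 1)))) \<or>
      (r - 1 \<ge> 2 \<and> norm_bounded a1 a2 B \<rho> 2 (Y (Suc (r - 1 - 2))) \<and> (a2 = 0 \<or> norm_bounded a1 a2 B \<rho> 1 (Y (Suc (r - 1 - 1)))))"
      unfolding e
    proof (cases "r \<ge> 3")
      case True
      then have "Suc (r - 1 - 2) = r - 2" "r - 1 \<ge> 2" by auto
      then show "(a1 = 0 \<and> norm_bounded a1 a2 B \<rho> 1 (Y (r - 1))) \<or>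
        (r - 1 \<ge> 2 \<and> norm_bounded a1 a2 B \<rho> 2 (Y (Suc (r - 1 - 2))) \<and> (a2 = 0 \<or> norm_bounded a1 a2 B \<rho> 1 (Y (r - 1))))"
        using cond' by auto
    next
      \<comment> \<open>For \<open>r = 2\<close> the chain consists of \<open>x'\<close> alone: it
        starts at order 1 with \<open>a1 = 0\<close>, and its bound there is
        \<open>bY1\<close>.\<close>
      case False
      then have "r - 1 = 1" "a1 = 0" using r cond' by auto
      then show "(a1 = 0 \<and> norm_bounded a1 a2 B \<rho> 1 (Y (r - 1))) \<or>
        (r - 1 \<ge> 2 \<and> norm_bounded a1 a2 B \<rho> 2 (Y (Suc (r - 1 - 2))) \<and> (a2 = 0 \<or> norm_bounded a1 a2 B \<rho> 1 (Y (r - 1))))"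
        using bY1 by simp
    qed
    show "(Y (Suc k) has_real_derivative Y (Suc (Suc k)) t) (at t)" if "Suc k < r - 1" for k t using that by (intro dY) simp
    show "norm_bounded a1 a2 B \<rho> (r - 1) (Y (Suc 0))" using bY1 by simp
  qed (use a B \<rho> r perY in auto)
  have n1: "r - 1 \<ge> 1" "Suc (r - 1) = r" using r by auto
  define g where "g s = \<bar>Psi (r - 1) a1 a2 b 1 s\<bar>" for s
  have dPsi: "deriv (Psi r a1 a2 b 1) = Psi (r - 1) a1 a2 b 1"
    using deriv_funpow_Psi[OF a zero_less_one, of 1 r b] r by simp
  have contg: "continuous_on UNIV g" unfolding g_def by (intro continuous_intros continuous_Psi[OF a zero_less_one n1(1)])
  define Kg where "Kg = \<bar>b\<bar> * (1 / (2 * (a1 + a2 + 2))) ^ (r - 1) * psi_centered (r - 1) a1 a2 ((a1 + a2 + 2) / 2)"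
  have gK: "g s \<le> Kg" for s unfolding g_def Kg_def by (rule Psi_bound[OF a zero_less_one n1(1) refl])
  have Kg0: "0 \<le> Kg" using gK[of 0] by (auto simp: g_def intro: order_trans[OF abs_ge_zero])
  have gm: "g \<in> borel_measurable borel" by (rule borel_measurable_continuous_onI[OF contg])
  define f where "f s = \<bar>Y 1 s\<bar>" for s
  have contY1: "continuous_on UNIV (Y 1)" using contY[of 1] r by simp
  have contf: "continuous_on UNIV f" unfolding f_def by (intro continuous_intros contY1)
  have fm: "f \<in> borel_measurable borel" by (rule borel_measurable_continuous_onI[OF contf])
  define Kf where "Kf = B * \<rho> ^ (r - 1) * psi_centered (r - 1) a1 a2 ((a1 + a2 + 2) / 2)"
  have fK: "f s \<le> Kf" for s using bY1 unfolding norm_bounded_def f_def Kf_def by blast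
  have Kf0: "0 \<le> Kf" using fK[of 0] by (auto simp: f_def intro: order_trans[OF abs_ge_zero])
  define I where "I = (\<integral>\<^sup>+u\<in>{0..t}. decr_rearr g u \<partial>lborel)"
  define J where "J = (\<integral>\<^sup>+u\<in>{0..t}. decr_rearr f u \<partial>lborel)"
  have main: "J \<le> ennreal (l ^ (r - 1)) * I" if l: "l \<in> \<rat>" "lam < l" for l
  proof -
    define T where "T = a1 + a2 + 2"
    have T: "T > 0" using a by (simp add: T_def)
    define \<rho>' where "\<rho>' = l / (2 * (a1 + a2 + 2))"
    have l0: "l > 0" using l lam by simp
    have \<rho>'T: "\<rho>' = l / (2 * T)" by (simp add: \<rho>'_def T_def)
    have \<rho>\<rho>': "\<rho> < \<rho>'" unfolding \<rho>_def \<rho>'_def using l T by (intro divide_strict_right_mono) (auto simp: T_def)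
    \<comment> \<open>This phase undoes the recentring in \<open>psi_centered\<close>, so that the
      modulus of the comparison wave of period \<open>l\<close>, run at speed \<open>l\<close>, is
      \<open>l ^ (r - 1)\<close> times that of \<open>Psi (r - 1)\<close> with period 1.\<close>
    define d where "d = \<rho>' * (a1 / 2 + (real (r - 1) - 1) * ((a1 + a2 + 2) / 2))"
    have lp: "l ^ (r - 1) > 0" using l0 by simp
    have scaled: "l ^ (r - 1) * g s = \<bar>comparison_wave a1 a2 B \<rho>' (r - 1) (l * s - d)\<bar>" for s
    proof -
      define c where "c = a1 / 2 + (real (r - 1) - 1) * ((a1 + a2 + 2) / 2)"
      have \<rho>'0: "\<rho>' > 0" using \<rho>\<rho>' \<rho> by simp
      have "(l * s - d) / \<rho>' = s / (1 / (2 * T)) - c"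
        using \<rho>'0 T l0 unfolding d_def c_def[symmetric] by (simp add: diff_divide_distrib) (simp add: \<rho>'T)
      then have "comparison_wave a1 a2 B \<rho>' (r - 1) (l * s - d) = B * \<rho>' ^ (r - 1) * psi (r - 1) a1 a2 (s / (1 / (2 * T)))"
        unfolding comparison_wave_def psi_of_centered[of "r - 1" a1 a2] c_def[symmetric] by simp
      moreover have "Psi (r - 1) a1 a2 b 1 s = b * (1 / (2 * T)) ^ (r - 1) * psi (r - 1) a1 a2 (s / (1 / (2 * T)))"
        by (rule Psi_alt[OF a zero_less_one]) (simp add: T_def)
      moreover have "\<rho>' ^ (r - 1) = l ^ (r - 1) * (1 / (2 * T)) ^ (r - 1)" unfolding \<rho>'T by (simp add: power_divide)
      ultimately show ?thesis using T l0 unfolding g_def B_def by (simp add: abs_mult power_abs)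
    qed
    define K where "K = max Kf (l ^ (r - 1) * Kg)"
    have "J \<le> (\<integral>\<^sup>+u\<in>{0..t}. decr_rearr (\<lambda>s. l ^ (r - 1) * g s) u \<partial>lborel)" unfolding J_def
    proof (rule decr_rearr_majorization[where K = K, OF fm _ _ _ _ _ t])
      show "f s \<le> K" for s using fK[of s] by (simp add: K_def)
      show "(\<lambda>s. l ^ (r - 1) * g s) \<in> borel_measurable borel" using gm by measurable
      show "l ^ (r - 1) * g s \<le> K" for s
        using mult_left_mono[OF gK[of s] less_imp_le[OF lp]] by (simp add: K_def)
      show "0 \<le> K" using Kf0 by (simp add: K_def)
      fix y :: real assume y: "0 \<le> y"
      have cf: "continuous_on {0..1} (\<lambda>s. max 0 (f s - y))"
        by (intro continuous_intros continuous_on_subset[OF contf]) auto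
      have cg: "continuous_on {0..1} (\<lambda>s. max 0 (l ^ (r - 1) * g s - y))"
        by (intro continuous_intros continuous_on_subset[OF contg]) auto
      have "integral {0..1} (\<lambda>s. max 0 (\<bar>Y (Suc 0) s\<bar> - y)) \<le>
          integral {0..1} (\<lambda>s. max 0 (\<bar>comparison_wave a1 a2 B \<rho>' (r - 1) (l * s - d)\<bar> - y))"
      proof (rule derivative_excess_le[OF chain' _ _ _ l(1) \<rho>\<rho>' \<rho>'_def y])
        show "(x has_real_derivative Y (Suc 0) t) (at t)" for t using dY[of 0 t] r by (simp add: Y0)
        show "x (t + 1) = x t" for t using per by simp
        show "norm_bounded a1 a2 B \<rho> (Suc (r - 1)) x" using b0 unfolding n1(2) Y0 .
      qed
      then have "integral {0..1} (\<lambda>s. max 0 (f s - y)) \<le> integral {0..1} (\<lambda>s. max 0 (l ^ (r - 1) * g s - y))"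
        unfolding f_def scaled by simp
      then show "(\<integral>\<^sup>+s. ennreal (indicator {0..1} s * max 0 (f s - y)) \<partial>lborel) \<le>
        (\<integral>\<^sup>+s. ennreal (indicator {0..1} s * max 0 (l ^ (r - 1) * g s - y)) \<partial>lborel)"
        unfolding integral_eq_nn_integral(2)[OF cf max.cobounded1] integral_eq_nn_integral(2)[OF cg max.cobounded1]
        by (rule ennreal_leI)
    qed
    also have "\<dots> \<le> (\<integral>\<^sup>+u. ennreal (l ^ (r - 1)) * (decr_rearr g u * indicator {0..t} u) \<partial>lborel)"
    proof (rule nn_integral_mono)
      fix u
      show "decr_rearr (\<lambda>s. l ^ (r - 1) * g s) u * indicator {0..t} u \<le> ennreal (l ^ (r - 1)) * (decr_rearr g u * indicator {0..t} u)"
        using decr_rearr_scale_le[OF gm gK Kg0 lp, of u] by (cases "u \<in> {0..t}") simp_all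
    qed
    also have "\<dots> = ennreal (l ^ (r - 1)) * I" unfolding I_def
      by (rule nn_integral_cmult[OF decr_rearr_measurable[OF gm gK Kg0]])
    finally show ?thesis .
  qed
  \<comment> \<open>Finiteness of \<open>I\<close>, and through it of \<open>J\<close>, allows the
    limit from rational \<open>l\<close> to \<open>lam\<close> to be taken in the reals.\<close>
  have "I \<le> (\<integral>\<^sup>+u. ennreal Kg * indicator {0..t} u \<partial>lborel)" unfolding I_def
  proof (rule nn_integral_mono)
    fix u show "decr_rearr g u * indicator {0..t} u \<le> ennreal Kg * indicator {0..t} u"
      using decr_rearr_bounded[OF gm gK Kg0] by (rule mult_right_mono) simp
  qed
  also have "\<dots> = ennreal Kg * ennreal t" using t by (simp add: nn_integral_cmult_indicator)
  also have "\<dots> < top" by (simp add: ennreal_mult_less_top)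
  finally obtain i where i: "0 \<le> i" "I = ennreal i" by (cases I) auto
  obtain l0 where l0: "l0 \<in> \<rat>" "lam < l0" using Rats_dense_in_real[of lam "lam + 1"] by auto
  have le: "J \<le> ennreal (l ^ (r - 1) * i)" if "l \<in> \<rat>" "lam < l" for l
    using main[OF that] i that lam by (simp add: ennreal_mult)
  have "J < top" using le[OF l0] by (rule le_less_trans) simp
  then obtain j where j: "0 \<le> j" "J = ennreal j" by (cases J) auto
  have "j \<le> lam ^ (r - 1) * i"
  proof (rule le_of_rational_above[where f = "\<lambda>l. l ^ (r - 1) * i"])
    show "isCont (\<lambda>l. l ^ (r - 1) * i) lam" by (intro continuous_intros)
    fix l assume l: "l \<in> \<rat>" "lam < l"
    then have "0 \<le> l ^ (r - 1) * i" using lam i(1) by simp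
    then show "j \<le> l ^ (r - 1) * i" using le[OF l] unfolding j(2) by (simp add: ennreal_le_iff)
  qed
  then have "J \<le> ennreal (lam ^ (r - 1)) * I"
    unfolding i(2) j(2) using lam i(1) by (subst ennreal_mult[symmetric]) (auto intro: ennreal_leI)
  moreover have "(\<lambda>s. \<bar>deriv x s\<bar>) = f" unfolding f_def using YS[of 0] by (simp add: Y0)
  moreover have "(\<lambda>s. \<bar>deriv (Psi r a1 a2 b 1) s\<bar>) = g" unfolding g_def dPsi ..
  ultimately show ?thesis unfolding I_def J_def by simp
qed

theorem theorem3:
  fixes r :: nat and x :: "real \<Rightarrow> real" and a1 a2 lam b :: real
  assumes "r \<ge> 1"
    and "x \<in> Lr_inf_inf r"
    and "\<forall>t. x (t + 1) = x t"
    and "a1 \<ge> 0" "a2 \<ge> 0" "lam > 0" "b \<noteq> 0"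
    and "(a1 = 0 \<and> (r \<ge> 2 \<or> a2 = 0) \<and>
            (\<forall>k\<in>{0, r - 1, r}. Linf_norm ((deriv ^^ k) x) \<le> Linf_norm ((deriv ^^ k) (Psi r a1 a2 b lam))))
       \<or> (a2 = 0 \<and> (r \<ge> 3 \<or> r = 2 \<and> a1 = 0) \<and>
            (\<forall>k\<in>{0, r - 2, r}. Linf_norm ((deriv ^^ k) x) \<le> Linf_norm ((deriv ^^ k) (Psi r a1 a2 b lam))))
       \<or> ((r \<ge> 3 \<or> r = 2 \<and> a1 = 0) \<and>
            (\<forall>k\<in>{0, r - 1, r - 2, r}. Linf_norm ((deriv ^^ k) x) \<le> Linf_norm ((deriv ^^ k) (Psi r a1 a2 b lam))))"
  shows "\<forall>t>0. (\<integral>\<^sup>+u\<in>{0..t}. decr_rearr (\<lambda>s. \<bar>deriv x s\<bar>) u \<partial>lborel)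
           \<le> ennreal (lam ^ (r - 1)) *
             (\<integral>\<^sup>+u\<in>{0..t}. decr_rearr (\<lambda>s. \<bar>deriv (Psi r a1 a2 b 1) s\<bar>) u \<partial>lborel)"
proof (intro allI impI)
  fix t :: real assume t: "t > 0"
  have x: "x \<in> Lr_inf r" using assms(2) by (simp add: Lr_inf_inf_def)
  let ?N = "\<lambda>k. Linf_norm ((deriv ^^ k) x) \<le> Linf_norm ((deriv ^^ k) (Psi r a1 a2 b lam))"
  have N: "?N 0" "?N r" using assms(8) by auto
  show "(\<integral>\<^sup>+u\<in>{0..t}. decr_rearr (\<lambda>s. \<bar>deriv x s\<bar>) u \<partial>lborel)
           \<le> ennreal (lam ^ (r - 1)) * (\<integral>\<^sup>+u\<in>{0..t}. decr_rearr (\<lambda>s. \<bar>deriv (Psi r a1 a2 b 1) s\<bar>) u \<partial>lborel)"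
  proof (cases "r \<ge> 2")
    case True
    \<comment> \<open>Condition a) is the first alternative, b) the second with
      \<open>a2 = 0\<close>, and c) the second with the bound at order \<open>r - 1\<close>.\<close>
    have "(a1 = 0 \<and> ?N (r - 1)) \<or> ((r \<ge> 3 \<or> a1 = 0) \<and> ?N (r - 2) \<and> (a2 = 0 \<or> ?N (r - 1)))"
      using assms(8) by auto
    moreover have "Linf_norm x \<le> Linf_norm (Psi r a1 a2 b lam)" using N(1) by simp
    ultimately show ?thesis
      by (intro theorem3_order_ge_2[OF True x assms(3-7) _ N(2) _ t])
  next
    case False
    \<comment> \<open>For \<open>r = 1\<close> only condition a) remains, and its side condition
      removes both plateaus; this is what makes the modulus of \<open>Psi'\<close> constant almost
      everywhere.\<close>
    then have r: "r = 1" "a1 = 0" "a2 = 0" using assms(1,8) by auto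
    have "(deriv ^^ 1) x \<in> Linf" using x r(1) unfolding Lr_inf_def by blast
    then have m: "deriv x \<in> borel_measurable lebesgue" by (simp add: Linf_def)
    have "Linf_norm (deriv x) \<le> ereal \<bar>b\<bar>"
    proof -
      have "Linf_norm (deriv x) \<le> Linf_norm (deriv (Psi 1 0 0 b lam))" using N(2) unfolding r by simp
      also have "\<dots> \<le> ereal \<bar>b\<bar>" by (rule Linf_norm_deriv_Psi) (use assms(6) in simp_all)
      finally show ?thesis .
    qed
    then have ae: "AE s in lebesgue. \<bar>deriv x s\<bar> \<le> \<bar>b\<bar>" by (rule AE_le_of_Linf_norm)
    have "(\<integral>\<^sup>+u\<in>{0..t}. decr_rearr (\<lambda>s. \<bar>deriv x s\<bar>) u \<partial>lborel)
           \<le> (\<integral>\<^sup>+u\<in>{0..t}. decr_rearr (\<lambda>s. \<bar>deriv (Psi 1 0 0 b 1) s\<bar>) u \<partial>lborel)"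
    proof (rule nn_integral_mono)
      fix u
      show "decr_rearr (\<lambda>s. \<bar>deriv x s\<bar>) u * indicator {0..t} u \<le> decr_rearr (\<lambda>s. \<bar>deriv (Psi 1 0 0 b 1) s\<bar>) u * indicator {0..t} u"
        using rearrangement_order_one[OF m ae, of u] by (cases "u \<in> {0..t}") simp_all
    qed
    then show ?thesis unfolding r by simp
  qed
qed

end
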